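(* Fix $p\ge3$ and let $(\beta,h)\in\Theta$ be $p$-critical, with $h$ known and $\bm X\sim\mathbb P_{\beta,h,p}$. Let $m_1<\dots<m_K$ ($K\in\{2,3\}$) be the global maximizers of $H=H_{\beta,h,p}$ and $p_k=[(m_k^2-1)H''(m_k)]^{-1/2}/\sum_{i=1}^K[(m_i^2-1)H''(m_i)]^{-1/2}$. Write $\sigma_k^2=-H''(m_k)/(p^2m_k^{2p-2})$. As $N\to\infty$, in distribution: (1) If $p$ is odd, then $K=2$ and: if $(\beta,h)\ne(\tilde\beta_p,0)$, $N^{1/2}(\hat\beta_N-\beta)\to\frac{p_1}{2}N^-(0,\sigma_1^2)+\frac{1-p_1}{2}N^+(0,\sigma_2^2)+\frac12\delta_0$; if $(\beta,h)=(\tilde\beta_p,0)$, $N^{1/2}(\hat\beta_N-\beta)\to\frac{p_1}{2}\delta_{-\infty}+\frac{1-p_1}{2}N^+(0,\sigma_2^2)+\frac12\delta_0$. (2) If $p\ge4$ is even: if $h>0$, $N^{1/2}(\hat\beta_N-\beta)\to\frac{p_1}{2}N^-(0,\sigma_1^2)+\frac{1-p_1}{2}N^+(0,\sigma_2^2)+\frac12\delta_0$; if $h<0$, $N^{1/2}(\hat\beta_N-\beta)\to\frac{p_1}{2}N^+(0,\sigma_1^2)+\frac{1-p_1}{2}N^-(0,\sigma_2^2)+\frac12\delta_0$; if $h=0$ and $\beta>\tilde\beta_p$, then the maximizers are $\pm m_*$ with $m_*>0$ and $N^{1/2}(\hat\beta_N-\beta)\to N\big(0,-\frac{H''(m_*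 )}{p^2m_*^{2p-2}}\big)$; if $h=0$ and $\beta=\tilde\beta_p$, then the maximizers are $-m_*,0,m_*$ with $m_*>0$ and $N^{1/2}(\hat\beta_N-\beta)\to p_2\gamma_p\delta_{-\infty}+p_1N^+\big(0,-\frac{H''(m_* )}{p^2m_*^{2p-2}}\big)+(1-p_1-p_2\gamma_p)\delta_0$, where $\gamma_p=\mathbb P(Z^p\le\mathbb EZ^p)$, $Z\sim N(0,1)$.
   Context: The $p$-tensor Curie–Weiss model on $\{-1,1\}^N$: $\mathbb P_{\beta,h,p}(\bm X)=\frac{1}{2^NZ_N(\beta,h,p)}\exp\{N(\beta\bar X_N^p+h\bar X_N)\}$ with $\bar X_N=N^{-1}\sum_iX_i$, $(\beta,h)\in\mathbb R^2$; $\Theta=[0,\infty)\times\mathbb R$. $I(x)=\frac12[(1+x)\log(1+x)+(1-x)\log(1-x)]$, $H_{\beta,h,p}(x)=\beta x^p+hx-I(x)$ on $[-1,1]$. $(\beta,h)$ is $p$-critical if $H_{\beta,h,p}$ has more than one global maximizer (points attaining $\sup_{[-1,1]}H$); these lie in $(-1,1)$ with $H''<0$. $\tilde\beta_p=\sup\{\beta\ge0:\sup_{x\in[-1,1]}H_{\beta,0,p}(x)=0\}$. For known $h$, $\hat\beta_N$ is the maximum likelihood estimate of $\beta$ over $\mathbb R$, the solution of $\mathbb E_{\beta,h,p}(\bar X_N^p)=\bar X_N^p$. $N^+(0,\sigma^2)$, $N^-(0,\sigma^2)$ are the laws of $|Z|$, $-|Z|$ for $Z\sim N(0,\sigma^2)$;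 sums denote mixtures; convergence with atoms at $\pm\infty$ is weak convergence on $[-\infty,\infty]$. *)

theory Defs
  imports "HOL-Probability.Probability"
begin

definition Ient :: "real \<Rightarrow> real" where
  "Ient x = ((1 + x) * ln (1 + x) + (1 - x) * ln (1 - x)) / 2"

definition Hfun :: "real \<Rightarrow> real \<Rightarrow> nat \<Rightarrow> real \<Rightarrow> real" where
  "Hfun b h p x = b * x ^ p + h * x - Ient x"

definition maximizers :: "real \<Rightarrow> real \<Rightarrow> nat \<Rightarrow> real set" where
  "maximizers b h p = {x \<in> {-1..1}. \<forall>y \<in> {-1..1}. Hfun b h p y \<le> Hfun b h p x}"

definition p_critical :: "real \<Rightarrow> real \<Rightarrow> nat \<Rightarrow> bool" where
  "p_critical b h p \<longleftrightarrow> (\<exists>x y. x \<in> maximizers b h p \<and> y \<in> maximizers b h p \<and> x \<noteq> y)"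

definition beta_tilde :: "nat \<Rightarrow> real" where
  "beta_tilde p = Sup {b. b \<ge> 0 \<and> (SUP x\<in>{-1..1}. Hfun b 0 p x) = 0}"

definition configs :: "nat \<Rightarrow> (nat \<Rightarrow> real) set" where
  "configs N = PiE {..<N} (\<lambda>_. {-1, 1})"

definition xbar :: "nat \<Rightarrow> (nat \<Rightarrow> real) \<Rightarrow> real" where
  "xbar N x = (\<Sum>i<N. x i) / real N"

text \<open>Unnormalised weight; the factor 2^N cancels against Z_N.\<close>
definition cw_weight :: "real \<Rightarrow> real \<Rightarrow> nat \<Rightarrow> nat \<Rightarrow> (nat \<Rightarrow> real) \<Rightarrow> real" where
  "cw_weight b h p N x = exp (real N * (b * xbar N x ^ p + h * xbar N x))"

definition cw_expect :: "real \<Rightarrow> real \<Rightarrow> nat \<Rightarrow> nat \<Rightarrow> ((nat \<Rightarrow> real) \<Rightarrow> real) \<Rightarrow> real" where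
  "cw_expect b h p N g =
     (\<Sum>x\<in>configs N. cw_weight b h p N x * g x) / (\<Sum>x\<in>configs N. cw_weight b h p N x)"

text \<open>MLE of beta (h known): the solution b of E_{b,h,p}(xbar^p) = xbar^p; if no real
  solution exists (xbar^p at an extreme value) it is -\<infinity> resp. +\<infinity>.\<close>
definition mle :: "real \<Rightarrow> nat \<Rightarrow> nat \<Rightarrow> (nat \<Rightarrow> real) \<Rightarrow> ereal" where
  "mle h p N x =
     (let t = xbar N x ^ p; F = (\<lambda>b. cw_expect b h p N (\<lambda>y. xbar N y ^ p)) in
      if \<exists>b. F b = t then ereal (THE b. F b = t)
      else if \<forall>b. t \<le> F b then -\<infinity> else \<infinity>)"

definition Tstat :: "real \<Rightarrow> real \<Rightarrow> nat \<Rightarrow> nat \<Rightarrow> (nat \<Rightarrow> real) \<Rightarrow> ereal" where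
  "Tstat b h p N x = ereal (sqrt (real N)) * (mle h p N x - ereal b)"

text \<open>Weak convergence on [-\<infinity>,\<infinity>], expressed through bounded continuous test functions:
  E N f is the expectation of f under the N-th law, L f the integral of f under the limit.\<close>
definition conv_dist_ereal :: "(nat \<Rightarrow> (ereal \<Rightarrow> real) \<Rightarrow> real) \<Rightarrow> ((ereal \<Rightarrow> real) \<Rightarrow> real) \<Rightarrow> bool" where
  "conv_dist_ereal E L \<longleftrightarrow>
     (\<forall>f :: ereal \<Rightarrow> real. continuous_on UNIV f \<longrightarrow> bounded (range f) \<longrightarrow> (\<lambda>N. E N f) \<longlonglongrightarrow> L f)"

definition std_normal :: "real measure" where
  "std_normal = density lborel std_normal_density"

definition Nint :: "real \<Rightarrow> (ereal \<Rightarrow> real) \<Rightarrow> real" where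
  "Nint s2 f = (\<integral>z. f (ereal (sqrt s2 * z)) \<partial>std_normal)"

definition Nplus :: "real \<Rightarrow> (ereal \<Rightarrow> real) \<Rightarrow> real" where
  "Nplus s2 f = (\<integral>z. f (ereal \<bar>sqrt s2 * z\<bar>) \<partial>std_normal)"

definition Nminus :: "real \<Rightarrow> (ereal \<Rightarrow> real) \<Rightarrow> real" where
  "Nminus s2 f = (\<integral>z. f (ereal (- \<bar>sqrt s2 * z\<bar>)) \<partial>std_normal)"

definition gamma_p :: "nat \<Rightarrow> real" where
  "gamma_p p = measure std_normal {z. z ^ p \<le> (\<integral>w. w ^ p \<partial>std_normal)}"

end

(* Under the product measure of biased spins with mean m, sqrt N * (xbar - m) satisfies the central
   limit theorem. When m is a critical point of H, the Curie-Weiss weight is this product weight times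
   2^N * exp (N * H m) times exp (N * O((xbar - m)^2)); since H'' m < 0, the last factor is uniformly
   integrable near m, so each maximizer contributes a Gaussian integral whose total mass is
   ((m^2 - 1) * H'' m) powr (-1/2).

   The estimate exceeds beta + t / sqrt N iff xbar^p exceeds tau_N(t), the mean of xbar^p at inverse
   temperature beta + t / sqrt N. For t > 0 (t < 0) this tilt selects the maximizers with the largest
   (smallest) value M0 of m^p, and sqrt N * (tau_N(t) - M0) tends to t * p^2 * m^(2p-2) / (- H'' m)
   unless m = 0, where tau_N(t) is of the smaller order N^(-p/2). Comparing with the law of xbar gives
   the limiting distribution function away from its atom at 0.

   The number of maximizers and their nondegeneracy follow from Rolle's theorem, because H'' has at
   most two zeros in (0,1). *)
theory Submission
  imports Defs "HOL-Real_Asymp.Real_Asymp"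
begin

section \<open>Biased product measures on spin configurations\<close>

text \<open>The central limit theorem controls bounded continuous functionals only, while the
  Curie-Weiss weight adds about exp(a w^2 / 2) with w = sqrt N * (xbar - m) and a = b p (p - 1)
  m^(p-2). The obstacle is a tail bound sharp enough for every a with a (1 - m^2) < 1, which is what
  H'' m < 0 says; Hoeffding's variance proxy 1 would cover only a < 1. The numerator and the
  denominator of tau_N(t), and the law of xbar, are all written as expectations of N-dependent
  functions under the one law at (beta, h). A single Laplace theorem then serves; it admits growth
  exp(c sqrt N), the size of the tilt from beta to beta + t / sqrt N. As t > 0 and t < 0 may select
  different peaks, the limiting distribution function can jump at 0, so only t \<noteq> 0 is
  examined and the atom at 0 is what is left over. At a peak m = 0 the threshold has, for each t <
  0, the scale on which xbar^p itself fluctuates there; the limit does not depend on t, and this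
  mass sits at minus infinity. Its share \<open>gamma_p\<close> is the chance that Z^p lies below
  its mean.\<close>

definition Bexp :: "real \<Rightarrow> nat \<Rightarrow> (real \<Rightarrow> real) \<Rightarrow> real" where
  "Bexp m N g = (\<Sum>x\<in>configs N. (\<Prod>i<N. (1 + m * x i) / 2) * g (xbar N x))"

abbreviation gauss :: "real measure" where
  "gauss \<equiv> std_normal_distribution"

lemma finite_configs [simp, intro]: "finite (configs N)"
  unfolding configs_def by (intro finite_PiE) auto

lemma configs_cases: "x \<in> configs N \<Longrightarrow> i < N \<Longrightarrow> x i = -1 \<or> x i = 1"
  unfolding configs_def by (force simp: PiE_def Pi_def)

lemma configs_nonempty [simp]: "configs N \<noteq> {}"
  unfolding configs_def by (simp add: PiE_eq_empty_iff)

lemma sum_eq_xbar: "(\<Sum>i<N. x i) = real N * xbar N x"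
  unfolding xbar_def by simp

lemma abs_xbar_le_1:
  assumes "x \<in> configs N" shows "\<bar>xbar N x\<bar> \<le> 1"
proof (cases "N = 0")
  case False
  have "\<bar>\<Sum>i<N. x i\<bar> \<le> (\<Sum>i<N. 1)"
    by (rule order_trans[OF sum_abs]) (intro sum_mono, use configs_cases[OF assms] in force)
  then have "\<bar>\<Sum>i<N. x i\<bar> \<le> real N" by simp
  then show ?thesis using False by (simp add: xbar_def abs_divide divide_le_eq)
qed (simp add: xbar_def)

text \<open>Distributivity factorizes every product functional over the sites; this yields both the
  total mass and the moment generating function of the product measure.\<close>

lemma sum_configs_prod: "(\<Sum>x\<in>configs N. \<Prod>i<N. f (x i)) = (f (-1) + f 1 :: real) ^ N"
proof -
  have "(\<Prod>i<N. \<Sum>y\<in>{-1,1::real}. f y) = (\<Sum>x\<in>configs N. \<Prod>i<N. f (x i))"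
    unfolding configs_def by (rule prod_sum_PiE) auto
  then show ?thesis by simp
qed

lemma Bexp_const: "Bexp m N (\<lambda>_. 1) = 1"
  unfolding Bexp_def using sum_configs_prod[of "\<lambda>y. (1 + m * y) / 2" N] by (simp add: field_simps)

lemma config_weight_nonneg:
  assumes "\<bar>m\<bar> \<le> 1" "x \<in> configs N" shows "(\<Prod>i<N. (1 + m * x i) / 2) \<ge> 0"
  by (intro prod_nonneg) (use assms configs_cases[OF assms(2)] in force)

lemma Bexp_mono:
  assumes "\<bar>m\<bar> \<le> 1" "\<And>x. \<bar>x\<bar> \<le> 1 \<Longrightarrow> f x \<le> g x"
  shows "Bexp m N f \<le> Bexp m N g"
  unfolding Bexp_def
  by (intro sum_mono mult_left_mono assms config_weight_nonneg abs_xbar_le_1)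

lemma Bexp_exp:
  "Bexp m N (\<lambda>x. exp (s * (real N * x))) = ((1 - m) / 2 * exp (- s) + (1 + m) / 2 * exp s) ^ N"
proof -
  have "Bexp m N (\<lambda>x. exp (s * (real N * x)))
      = (\<Sum>x\<in>configs N. \<Prod>i<N. (1 + m * x i) / 2 * exp (s * x i))"
    unfolding Bexp_def
    by (simp only: prod.distrib sum_eq_xbar[symmetric] sum_distrib_left exp_sum finite_lessThan)
  then show ?thesis
    using sum_configs_prod[of "\<lambda>y. (1 + m * y) / 2 * exp (s * y)" N] by simp
qed

text \<open>The central limit theorem for i.i.d. signs is combined with the Skorohod representation,
  which turns weak convergence into pointwise convergence on one space \<Omega>. Integrands that
  themselves depend on N can then be treated by dominated convergence. The last clause ties \<Omega>
  back to the finite sum \<open>Bexp\<close>, because \<open>Ys N\<close> has the law of the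
  normalized sum.\<close>

lemma biased_bernoulli_CLT:
  assumes m: "\<bar>m\<bar> < 1"
  obtains \<Omega> :: "real measure" and Ys :: "nat \<Rightarrow> real \<Rightarrow> real" and Y :: "real \<Rightarrow> real"
  where "prob_space \<Omega>" "\<And>n. Ys n \<in> borel_measurable \<Omega>" "Y \<in> borel_measurable \<Omega>"
    "distr \<Omega> borel Y = gauss"
    "\<And>x. x \<in> space \<Omega> \<Longrightarrow> (\<lambda>n. Ys n x) \<longlonglongrightarrow> Y x"
    "\<And>N g. N > 0 \<Longrightarrow> g \<in> borel_measurable borel \<Longrightarrow>
       Bexp m N g = (\<integral>\<omega>. g (m + sqrt (1 - m\<^sup>2) * Ys N \<omega> / sqrt (real N)) \<partial>\<Omega>)"
proof -
  define q where "q = (1 + m) / 2"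
  have q: "0 \<le> q" "q \<le> 1" using m unfolding q_def by auto
  define sg where "sg = (\<lambda>b. if b then 1 else - 1 :: real)"
  define \<rho> where "\<rho> = distr (measure_pmf (bernoulli_pmf q)) borel sg"
  interpret \<rho>: prob_space \<rho>
    unfolding \<rho>_def by (intro prob_space.prob_space_distr) (auto simp: measure_pmf.prob_space_axioms)
  have sets\<rho> [measurable_cong, simp]: "sets \<rho> = sets borel" by (simp add: \<rho>_def)
  define P where "P = PiM (UNIV :: nat set) (\<lambda>_. \<rho>)"
  interpret P: product_prob_space "\<lambda>_. \<rho>" "UNIV :: nat set" ..
  interpret P: prob_space P unfolding P_def by (rule P.prob_space_axioms)
  have int\<rho>: "(\<integral>y. f y \<partial>\<rho>) = q * f 1 + (1 - q) * f (-1)"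
    if [measurable]: "f \<in> borel_measurable borel" for f :: "real \<Rightarrow> real"
    unfolding \<rho>_def using q by (subst integral_distr) (auto simp: sg_def)
  have integ\<rho>: "integrable \<rho> f" if [measurable]: "f \<in> borel_measurable borel" for f :: "real \<Rightarrow> real"
    unfolding \<rho>_def by (subst integrable_distr_eq) (auto intro!: integrable_measure_pmf_finite)
  define X where "X = (\<lambda>(i::nat) (\<omega>::nat \<Rightarrow> real). \<omega> i)"
  have setsP [measurable_cong]: "sets P = sets (PiM UNIV (\<lambda>_. borel))"
    unfolding P_def by (intro sets_PiM_cong) auto
  have X_meas [measurable]: "X i \<in> borel_measurable P" for i
    unfolding X_def by measurable
  have distX: "distr P borel (X i) = \<rho>" for i
  proof -
    have "distr P \<rho> (\<lambda>x. x i) = \<rho>"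
      unfolding P_def by (rule distr_PiM_component) (auto simp: \<rho>.prob_space_axioms)
    moreover have "distr P borel (X i) = distr P \<rho> (\<lambda>x. x i)"
      unfolding X_def by (intro distr_cong) auto
    ultimately show ?thesis by simp
  qed
  have indep: "P.indep_vars (\<lambda>_. borel) X UNIV"
  proof (subst P.indep_vars_iff_distr_eq_PiM')
    have "distr P (PiM UNIV (\<lambda>_. borel)) (\<lambda>x. \<lambda>i\<in>UNIV. X i x) = distr P P (\<lambda>x. x)"
      by (intro distr_cong) (auto simp: X_def setsP)
    also have "\<dots> = P" by (rule distr_id)
    also have "\<dots> = PiM UNIV (\<lambda>i. distr P borel (X i))" unfolding distX by (simp add: P_def)
    finally show "distr P (PiM UNIV (\<lambda>_. borel)) (\<lambda>x. \<lambda>i\<in>UNIV. X i x)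
      = PiM UNIV (\<lambda>i. distr P borel (X i))" .
  qed auto
  have EX: "P.expectation (\<lambda>\<omega>. f (X i \<omega>)) = q * f 1 + (1 - q) * f (-1)"
    if "f \<in> borel_measurable borel" for f :: "real \<Rightarrow> real" and i
    using int\<rho>[OF that] unfolding distX[of i, symmetric] by (subst (asm) integral_distr) (use that in auto)
  have IX: "integrable P (\<lambda>\<omega>. f (X i \<omega>))"
    if "f \<in> borel_measurable borel" for f :: "real \<Rightarrow> real" and i
    using integ\<rho>[OF that] unfolding distX[of i, symmetric] by (subst (asm) integrable_distr_eq) (use that in auto)
  define \<sigma> where "\<sigma> = sqrt (1 - m\<^sup>2)"
  have m2: "m\<^sup>2 < 1" using m by (simp add: abs_square_less_1)
  then have \<sigma>: "\<sigma> > 0" "\<sigma>\<^sup>2 = 1 - m\<^sup>2" unfolding \<sigma>_def by auto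
  have mean: "P.expectation (X n) = m" for n
    using EX[of "\<lambda>x. x"] by (simp add: q_def field_simps)
  have clt: "weak_conv_m (\<lambda>n. distr P borel (\<lambda>x. (\<Sum>i<n. X i x - m) / sqrt (n*\<sigma>\<^sup>2)))
      gauss"
  proof (rule P.central_limit_theorem[OF indep mean \<open>\<sigma> > 0\<close> _ _ distX])
    show "integrable P (\<lambda>x. (X n x)\<^sup>2)" for n by (rule IX) auto
    show "P.variance (X n) = \<sigma>\<^sup>2" for n
      unfolding mean using EX[of "\<lambda>x. (x - m)\<^sup>2"]
      by (simp add: q_def \<sigma>(2)) (simp add: field_simps power2_eq_square)
  qed
  define S where "S = (\<lambda>n x. (\<Sum>i<n. X i x - m) / sqrt (real n*\<sigma>\<^sup>2))"
  have S_meas [measurable]: "S n \<in> borel_measurable P" for n unfolding S_def by measurable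
  have rd: "real_distribution (distr P borel (S n))" for n
    by (rule P.real_distribution_distr) simp
  have "\<exists>(\<Omega> :: real measure) (Ys :: nat \<Rightarrow> real \<Rightarrow> real) (Y :: real \<Rightarrow> real). prob_space \<Omega> \<and>
    (\<forall>n. Ys n \<in> measurable \<Omega> borel) \<and>
    (\<forall>n. distr \<Omega> borel (Ys n) = distr P borel (S n)) \<and>
    Y \<in> measurable \<Omega> lborel \<and> distr \<Omega> borel Y = gauss \<and>
    (\<forall>x \<in> space \<Omega>. (\<lambda>n. Ys n x) \<longlonglongrightarrow> Y x)"
    by (rule Skorohod[OF rd real_dist_normal_dist]) (unfold S_def, rule clt)
  then obtain \<Omega> :: "real measure" and Ys Y where sk: "prob_space \<Omega> \<and>
    (\<forall>n. Ys n \<in> measurable \<Omega> borel) \<and>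
    (\<forall>n. distr \<Omega> borel (Ys n) = distr P borel (S n)) \<and>
    Y \<in> measurable \<Omega> lborel \<and> distr \<Omega> borel Y = gauss \<and>
    (\<forall>x \<in> space \<Omega>. (\<lambda>n. Ys n x) \<longlonglongrightarrow> Y x)"
    by (elim exE)
  then have \<Omega>: "prob_space \<Omega>" and Ys: "\<And>n. Ys n \<in> measurable \<Omega> borel"
      and dY: "\<And>n. distr \<Omega> borel (Ys n) = distr P borel (S n)"
      and Y: "Y \<in> measurable \<Omega> lborel" "distr \<Omega> borel Y = gauss"
      and conv: "\<And>x. x \<in> space \<Omega> \<Longrightarrow> (\<lambda>n. Ys n x) \<longlonglongrightarrow> Y x"
    by simp_all
  have cyl: "P.prob {\<omega> \<in> space P. \<forall>i<N. \<omega> i = x i} = (\<Prod>i<N. (1 + m * x i) / 2)"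
    if "N > 0" "x \<in> configs N" for N and x
  proof -
    have "{\<omega> \<in> space P. \<forall>i<N. \<omega> i = x i} = (\<Inter>i\<in>{..<N}. X i -` {x i} \<inter> space P)"
      using that(1) by (auto simp: X_def)
    also have "P.prob \<dots> = (\<Prod>i\<in>{..<N}. P.prob (X i -` {x i} \<inter> space P))"
      by (rule P.indep_varsD[OF indep]) (use that(1) in auto)
    also have "\<dots> = (\<Prod>i<N. (1 + m * x i) / 2)"
    proof (rule prod.cong)
      fix i assume "i \<in> {..<N}"
      then have xi: "x i = -1 \<or> x i = 1" using configs_cases[OF that(2)] by auto
      moreover have "P.prob (X i -` {x i} \<inter> space P) = P.expectation (\<lambda>\<omega>. indicator {x i} (X i \<omega>))"
      proof -
        have "P.expectation (\<lambda>\<omega>. indicator {x i} (X i \<omega>) :: real)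
          = P.expectation (indicator (X i -` {x i} \<inter> space P))"
          by (intro Bochner_Integration.integral_cong) (auto simp: indicator_def)
        then show ?thesis by simp
      qed
      moreover have "P.expectation (\<lambda>\<omega>. indicator {x i} (X i \<omega>))
          = q * indicator {x i} 1 + (1 - q) * indicator {x i} (-1)"
        by (rule EX) auto
      ultimately show "P.prob (X i -` {x i} \<inter> space P) = (1 + m * x i) / 2"
        using xi by (elim disjE) (auto simp: q_def field_simps)
    qed simp
    finally show ?thesis .
  qed
  \<comment> \<open>The infinite product space contains all real sequences. Only almost surely are
    the coordinates signs, and on that event exactly one cylinder over \<open>configs N\<close>
    contains \<omega>.\<close>
  have AEpm: "AE \<omega> in P. \<forall>i<N. X i \<omega> \<in> {-1, 1}" for N
  proof -
    have "AE \<omega> in P. X i \<omega> \<in> {-1,1}" for i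
    proof -
      have "AE y in \<rho>. y \<in> {-1, 1}"
        unfolding \<rho>_def by (subst AE_distr_iff) (auto simp: sg_def)
      then have "AE y in distr P borel (X i). y \<in> {-1, 1}" by (simp only: distX)
      then show ?thesis by (subst (asm) AE_distr_iff) auto
    qed
    then show ?thesis by (simp add: AE_all_countable)
  qed
  have key: "Bexp m N g = (\<integral>\<omega>. g (m + sqrt (1 - m\<^sup>2) * Ys N \<omega> / sqrt (real N)) \<partial>\<Omega>)"
    if N: "N > 0" and g [measurable]: "g \<in> borel_measurable borel" for N g
  proof -
    define A where "A = (\<lambda>x. {\<omega> \<in> space P. \<forall>i<N. \<omega> i = (x i :: real)})"
    have A_sets: "A x \<in> sets P" for x
    proof -
      have "A x = {\<omega> \<in> space P. \<forall>i<N. X i \<omega> = x i}" by (simp add: A_def X_def)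
      also have "\<dots> \<in> sets P" by measurable
      finally show ?thesis .
    qed
    have [measurable]: "Ys N \<in> borel_measurable \<Omega>" by (rule Ys)
    have "(\<integral>\<omega>. g (m + sqrt (1 - m\<^sup>2) * Ys N \<omega> / sqrt (real N)) \<partial>\<Omega>)
       = (\<integral>y. g (m + \<sigma> * y / sqrt (real N)) \<partial>distr \<Omega> borel (Ys N))"
      unfolding \<sigma>_def by (subst integral_distr) auto
    also have "\<dots> = (\<integral>\<omega>. g (m + \<sigma> * S N \<omega> / sqrt (real N)) \<partial>P)"
      unfolding dY by (subst integral_distr) auto
    also have "\<dots> = (\<integral>\<omega>. g ((\<Sum>i<N. X i \<omega>) / real N) \<partial>P)"
    proof (rule Bochner_Integration.integral_cong[OF refl])
      fix \<omega>
      have "\<sigma> * S N \<omega> / sqrt (real N) = (\<Sum>i<N. X i \<omega> - m) / real N"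
        using \<sigma>(1) N by (simp add: S_def real_sqrt_mult field_simps)
      also have "\<dots> = (\<Sum>i<N. X i \<omega>) / real N - m"
        using N by (simp add: sum_subtractf field_simps)
      finally show "g (m + \<sigma> * S N \<omega> / sqrt (real N)) = g ((\<Sum>i<N. X i \<omega>) / real N)" by simp
    qed
    also have "\<dots> = (\<integral>\<omega>. (\<Sum>x\<in>configs N. indicator (A x) \<omega> * g (xbar N x)) \<partial>P)"
    proof (rule integral_cong_AE)
      show "(\<lambda>\<omega>. \<Sum>x\<in>configs N. indicator (A x) \<omega> * g (xbar N x)) \<in> borel_measurable P"
        using A_sets by measurable
      show "AE \<omega> in P. g ((\<Sum>i<N. X i \<omega>) / real N)
              = (\<Sum>x\<in>configs N. indicator (A x) \<omega> * g (xbar N x))"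
        using AEpm[of N] AE_space
      proof eventually_elim
        fix \<omega> assume *: "\<forall>i<N. X i \<omega> \<in> {- 1, 1}" "\<omega> \<in> space P"
        define x0 where "x0 = restrict \<omega> {..<N}"
        have x0: "x0 \<in> configs N" using * by (auto simp: x0_def configs_def X_def PiE_def Pi_def)
        have "(\<Sum>x\<in>configs N. indicator (A x) \<omega> * g (xbar N x))
            = (\<Sum>x\<in>configs N. if x = x0 then g (xbar N x) else 0)"
        proof (rule sum.cong)
          fix x assume x: "x \<in> configs N"
          have "\<omega> \<in> A x \<longleftrightarrow> x = x0"
            using x *(2) x0 unfolding A_def x0_def configs_def
            by (auto simp: PiE_def extensional_def fun_eq_iff restrict_def)
          then show "indicator (A x) \<omega> * g (xbar N x) = (if x = x0 then g (xbar N x) else 0)"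
            by (simp add: indicator_def)
        qed simp
        also have "\<dots> = g (xbar N x0)" using x0 by simp
        also have "xbar N x0 = (\<Sum>i<N. X i \<omega>) / real N"
          by (simp add: xbar_def x0_def X_def)
        finally show "g ((\<Sum>i<N. X i \<omega>) / real N)
              = (\<Sum>x\<in>configs N. indicator (A x) \<omega> * g (xbar N x))" by simp
      qed
    qed measurable
    also have "\<dots> = (\<Sum>x\<in>configs N. P.prob (A x) * g (xbar N x))"
      using A_sets by (subst Bochner_Integration.integral_sum) (auto simp: less_top[symmetric])
    also have "\<dots> = Bexp m N g"
      unfolding Bexp_def using cyl[OF N] by (intro sum.cong) (auto simp: A_def)
    finally show ?thesis by simp
  qed
  have Y': "Y \<in> borel_measurable \<Omega>" using Y(1) by simp
  show thesis by (rule that[OF \<Omega> Ys Y' Y(2) conv key])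
qed

lemma Bexp_add: "Bexp m N (\<lambda>x. f x + g x) = Bexp m N f + Bexp m N g"
  unfolding Bexp_def by (simp add: distrib_left sum.distrib)

lemma Bexp_cmult: "Bexp m N (\<lambda>x. c * f x) = c * Bexp m N f"
  unfolding Bexp_def by (simp add: sum_distrib_left mult_ac)

lemma Bexp_sum: "Bexp m N (\<lambda>x. \<Sum>j\<in>J. f j x) = (\<Sum>j\<in>J. Bexp m N (f j))"
  unfolding Bexp_def by (simp add: sum_distrib_left) (rule sum.swap)

lemma Bexp_diff_le:
  assumes "\<bar>m\<bar> \<le> 1" "\<And>x. \<bar>x\<bar> \<le> 1 \<Longrightarrow> \<bar>f x - g x\<bar> \<le> h x"
  shows "\<bar>Bexp m N f - Bexp m N g\<bar> \<le> Bexp m N h"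
proof -
  have "Bexp m N f \<le> Bexp m N (\<lambda>x. g x + h x)" "Bexp m N g \<le> Bexp m N (\<lambda>x. f x + h x)"
    by (intro Bexp_mono assms(1); use assms(2) in \<open>force simp: abs_le_iff\<close>)+
  then show ?thesis by (simp add: Bexp_add)
qed

section \<open>Sub-Gaussian tails of the product measure with a nearly optimal variance
  proxy\<close>

lemma exp_le_second_order: "exp (x::real) \<le> 1 + x + x\<^sup>2 / 2 * exp \<bar>x\<bar>"
proof -
  obtain t where t: "\<bar>t\<bar> \<le> \<bar>x\<bar>" "exp x = (\<Sum>k<2. x ^ k / fact k) + exp t / fact 2 * x ^ 2"
    using Maclaurin_exp_le[of x 2] by blast
  have "exp t * x\<^sup>2 \<le> exp \<bar>x\<bar> * x\<^sup>2" using t(1) by (intro mult_right_mono) auto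
  then show ?thesis using t(2) by (simp add: numeral_2_eq_2 field_simps)
qed

text \<open>Taylor expansion to second order around the mean: the linear terms cancel, the quadratic
  ones add up to the variance 1 - m^2, and the error factor exp(2 s0) tends to 1 with s0. Hence the
  proxy v' may be any number above 1 - m^2, at the price of restricting s to a small
  interval.\<close>

lemma biased_bernoulli_mgf_le:
  fixes m s s0 v' :: real
  assumes "\<bar>m\<bar> < 1" "\<bar>s\<bar> \<le> s0" "(1 - m\<^sup>2) * exp (2 * s0) \<le> v'"
  shows "(1 - m) / 2 * exp (- s) + (1 + m) / 2 * exp s \<le> exp (m * s + v' * s\<^sup>2 / 2)"
proof -
  have m2: "m\<^sup>2 < 1" using assms(1) by (simp add: abs_square_less_1)
  have bd: "exp (s * c) \<le> 1 + s * c + (s\<^sup>2 / 2 * exp (2 * s0)) * c\<^sup>2" if "\<bar>c\<bar> \<le> 2" for c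
  proof -
    have "\<bar>s * c\<bar> \<le> s0 * 2" unfolding abs_mult using assms(2) that by (intro mult_mono) auto
    then have "(s * c)\<^sup>2 / 2 * exp \<bar>s * c\<bar> \<le> (s * c)\<^sup>2 / 2 * exp (2 * s0)"
      by (intro mult_left_mono) auto
    then show ?thesis using exp_le_second_order[of "s * c"] by (simp add: power_mult_distrib algebra_simps)
  qed
  \<comment> \<open>The factor exp(m s) is split off, so that the spin takes the centered values -(1
    + m) and 1 - m, both at most 2 in modulus.\<close>
  have "(1 - m) / 2 * exp (- s * (1 + m)) + (1 + m) / 2 * exp (s * (1 - m))
     \<le> (1 - m) / 2 * (1 - s * (1 + m) + (s\<^sup>2 / 2 * exp (2 * s0)) * (1 + m)\<^sup>2)
      + (1 + m) / 2 * (1 + s * (1 - m) + (s\<^sup>2 / 2 * exp (2 * s0)) * (1 - m)\<^sup>2)"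
    using bd[of "-(1 + m)"] bd[of "1 - m"] assms(1)
    by (intro add_mono mult_left_mono) (auto simp: power2_eq_square algebra_simps)
  also have "\<dots> = 1 + (1 - m\<^sup>2) * exp (2 * s0) * s\<^sup>2 / 2"
    by (simp add: field_simps power2_eq_square)
  also have "\<dots> \<le> 1 + v' * s\<^sup>2 / 2"
    using assms(3) by (simp add: mult_right_mono divide_right_mono)
  also have "\<dots> \<le> exp (v' * s\<^sup>2 / 2)" by (rule exp_ge_add_one_self)
  finally have "exp (m * s) * ((1 - m) / 2 * exp (- s * (1 + m)) + (1 + m) / 2 * exp (s * (1 - m)))
      \<le> exp (m * s) * exp (v' * s\<^sup>2 / 2)" by (rule mult_left_mono) simp
  also have "exp (m * s) * ((1 - m) / 2 * exp (- s * (1 + m)) + (1 + m) / 2 * exp (s * (1 - m)))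
     = (1 - m) / 2 * exp (- s) + (1 + m) / 2 * exp s"
  proof -
    have "exp (m * s) * exp (- s * (1 + m)) = exp (- s)" "exp (m * s) * exp (s * (1 - m)) = exp s"
      by (simp_all add: exp_add[symmetric] algebra_simps)
    then show ?thesis unfolding distrib_left mult.left_commute[of "exp (m * s)"] by simp
  qed
  finally show ?thesis by (simp add: exp_add)
qed

text \<open>Chernoff bound applied to both tails. The upper limit on y is exactly what keeps the
  optimal exponent below s0, where the moment generating function is under control.\<close>

lemma Bexp_tail_le:
  assumes m: "\<bar>m\<bar> < 1" and v': "(1 - m\<^sup>2) * exp (2 * s0) \<le> v'" "v' > 0"
    and y: "0 \<le> y" "y \<le> v' * s0 * sqrt (real N)"
  shows "Bexp m N (\<lambda>x. if y \<le> \<bar>sqrt (real N) * (x - m)\<bar> then 1 else 0) \<le> 2 * exp (- y\<^sup>2 / (2 * v'))"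
proof (cases "N = 0")
  case True
  have "Bexp m N (\<lambda>x. if y \<le> \<bar>sqrt (real N) * (x - m)\<bar> then 1 else 0) \<le> Bexp m N (\<lambda>_. 1)"
    using m by (intro Bexp_mono) auto
  also have "\<dots> \<le> 2 * exp (- y\<^sup>2 / (2 * v'))"
    using y True by (simp add: Bexp_const)
  finally show ?thesis .
next
  case False
  define r where "r = sqrt (real N)"
  have r: "r > 0" "r * r = real N" using False by (auto simp: r_def)
  \<comment> \<open>The minimizer of N v' s^2 / 2 - s r y.\<close>
  define s where "s = y / (v' * r)"
  have s: "0 \<le> s" "s \<le> s0" using y v' r by (auto simp: s_def r_def field_simps)
  have one: "Bexp m N (\<lambda>x. exp (t * (real N * x)) * exp (- (t * (real N * m)) - s * r * y)) \<le> exp (- y\<^sup>2 / (2 * v'))"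
    if t: "\<bar>t\<bar> = s" for t
  proof -
    have "Bexp m N (\<lambda>x. exp (t * (real N * x)) * exp (- (t * (real N * m)) - s * r * y))
       = exp (- (t * (real N * m)) - s * r * y) * ((1 - m) / 2 * exp (- t) + (1 + m) / 2 * exp t) ^ N"
      unfolding Bexp_exp[symmetric] Bexp_cmult[symmetric] by (simp add: mult.commute)
    also have "\<dots> \<le> exp (- (t * (real N * m)) - s * r * y) * (exp (m * t + v' * t\<^sup>2 / 2)) ^ N"
    proof (intro mult_left_mono power_mono)
      show "(1 - m) / 2 * exp (- t) + (1 + m) / 2 * exp t \<le> exp (m * t + v' * t\<^sup>2 / 2)"
        by (rule biased_bernoulli_mgf_le[OF m _ v'(1)]) (use s t in auto)
      show "0 \<le> (1 - m) / 2 * exp (- t) + (1 + m) / 2 * exp t"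
        using m by (intro add_nonneg_nonneg mult_nonneg_nonneg) auto
    qed simp
    also have "\<dots> = exp (real N * v' * t\<^sup>2 / 2 - s * r * y)"
      by (simp add: exp_of_nat_mult[symmetric] exp_add[symmetric] algebra_simps)
    also have "t\<^sup>2 = s\<^sup>2" using t by (metis power2_abs)
    also have "real N * v' * s\<^sup>2 / 2 - s * r * y = - y\<^sup>2 / (2 * v')"
      unfolding r(2)[symmetric] using r v' by (simp add: s_def field_simps power2_eq_square)
    finally show ?thesis .
  qed
  have "Bexp m N (\<lambda>x. if y \<le> \<bar>sqrt (real N) * (x - m)\<bar> then 1 else 0)
    \<le> Bexp m N (\<lambda>x. exp (s * (real N * x)) * exp (- (s * (real N * m)) - s * r * y)
       + exp (- s * (real N * x)) * exp (- (- s * (real N * m)) - s * r * y))"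
  proof (rule Bexp_mono)
    fix x
    have eq: "exp (t * (real N * x)) * exp (- (t * (real N * m)) - s * r * y)
      = exp (r * (t * (r * (x - m)) - s * y))" for t
      unfolding r(2)[symmetric] exp_add[symmetric] by (simp add: algebra_simps)
    show "(if y \<le> \<bar>sqrt (real N) * (x - m)\<bar> then 1 else 0)
       \<le> exp (s * (real N * x)) * exp (- (s * (real N * m)) - s * r * y)
       + exp (- s * (real N * x)) * exp (- (- s * (real N * m)) - s * r * y)"
    proof (cases "y \<le> \<bar>sqrt (real N) * (x - m)\<bar>")
      case True
      then consider "y \<le> r * (x - m)" | "y \<le> - (r * (x - m))" unfolding r_def by linarith
      then show ?thesis
      proof cases
        case 1
        then have "s * y \<le> s * (r * (x - m))" using s by (intro mult_left_mono) auto
        then have "1 \<le> exp (r * (s * (r * (x - m)) - s * y))" using r by simp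
        then show ?thesis unfolding eq using True by (auto intro: add_increasing2)
      next
        case 2
        then have "s * y \<le> s * (- (r * (x - m)))" using s by (intro mult_left_mono) auto
        then have "1 \<le> exp (r * (- s * (r * (x - m)) - s * y))" using r by simp
        then show ?thesis unfolding eq using True by (auto intro: add_increasing)
      qed
    qed (auto intro: add_nonneg_nonneg)
  qed (use m in auto)
  also have "\<dots> \<le> 2 * exp (- y\<^sup>2 / (2 * v'))"
    unfolding Bexp_add using one[of s] one[of "- s"] s by simp
  finally show ?thesis .
qed

text \<open>Completing the square with b + 1 in place of b leaves a spare factor exp(-j), so a
  geometric series dominates.\<close>

lemma summable_exp_quadratic:
  fixes a b c :: real assumes "a > 0"
  shows "summable (\<lambda>j::nat. exp (- a * (real j)\<^sup>2 + b * real j + c))"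
proof (rule summable_comparison_test_ev)
  show "summable (\<lambda>j::nat. exp (c + (b + 1)\<^sup>2 / (4 * a)) * exp (-1::real) ^ j)"
    by (intro summable_mult summable_geometric) auto
  show "eventually (\<lambda>j. norm (exp (- a * (real j)\<^sup>2 + b * real j + c))
      \<le> exp (c + (b + 1)\<^sup>2 / (4 * a)) * exp (-1::real) ^ j) sequentially"
  proof (intro always_eventually allI)
    fix j :: nat
    have "0 \<le> a * (real j - (b + 1) / (2 * a))\<^sup>2" using assms by simp
    also have "\<dots> = a * (real j)\<^sup>2 - (b + 1) * real j + (b + 1)\<^sup>2 / (4 * a)"
      using assms by (simp add: field_simps power2_eq_square)
    finally have "- a * (real j)\<^sup>2 + b * real j + c \<le> c + (b + 1)\<^sup>2 / (4 * a) - real j"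
      by (simp add: algebra_simps)
    then show "norm (exp (- a * (real j)\<^sup>2 + b * real j + c))
      \<le> exp (c + (b + 1)\<^sup>2 / (4 * a)) * exp (-1::real) ^ j"
      by (simp add: exp_of_nat_mult[symmetric] exp_add[symmetric])
  qed
qed

abbreviation annulus_exp where
  "annulus_exp \<kappa> \<delta> A N w \<equiv>
    (if real A \<le> \<bar>w\<bar> \<and> \<bar>w\<bar> \<le> \<delta> * sqrt (real N) then exp (\<kappa> * w\<^sup>2 / 2 :: real) else 0)"

text \<open>This is the uniform integrability of exp(\<kappa> w^2 / 2) near the peak. The annulus is
  cut into shells j \<le> |w| \<le> j + 1; each shell costs at most exp(\<kappa> (j + 1)^2 / 2)
  times the Chernoff bound exp(-j^2 / (2 v')), and v' < 1 / \<kappa> makes the quadratic exponent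
  negative. The resulting series does not involve N. The outer radius \<delta> sqrt N is the range
  of validity of the tail bound.\<close>

lemma Bexp_gaussian_tail:
  assumes m: "\<bar>m\<bar> < 1" and \<kappa>: "0 < \<kappa>" "\<kappa> * (1 - m\<^sup>2) < 1"
  obtains \<delta> where "\<delta> > 0"
    "\<And>e. e > 0 \<Longrightarrow> \<exists>A0. \<forall>A\<ge>A0::nat. \<forall>N. Bexp m N (\<lambda>x. annulus_exp \<kappa> \<delta> A N (sqrt (real N) * (x - m))) \<le> e"
proof -
  define v where "v = 1 - m\<^sup>2"
  have v: "v > 0" using m by (simp add: v_def abs_square_less_1)
  obtain v' where v': "v < v'" "v' < 1 / \<kappa>"
    using dense[of v "1 / \<kappa>"] \<kappa> by (auto simp: v_def field_simps)
  then have v'0: "v' > 0" using v by simp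
  \<comment> \<open>Solves v exp(2 s0) = v', the largest s0 that the moment generating function
    estimate permits.\<close>
  define s0 where "s0 = ln (v' / v) / 2"
  have s0: "s0 > 0" "v * exp (2 * s0) \<le> v'" using v v' by (auto simp: s0_def)
  define a where "a = (1 / v' - \<kappa>) / 2"
  have a: "a > 0" using v' v'0 \<kappa> by (simp add: a_def field_simps)
  define T where "T = (\<lambda>j::nat. 2 * exp (- a * (real j)\<^sup>2 + \<kappa> * real j + \<kappa> / 2))"
  have sT: "summable T" unfolding T_def by (intro summable_mult summable_exp_quadratic a)
  show thesis
  proof (rule that)
    show "v' * s0 > 0" using v'0 s0 by simp
    fix e :: real assume "e > 0"
    obtain A0 where A0: "\<And>n. n \<ge> A0 \<Longrightarrow> norm (\<Sum>i. T (i + n)) < e"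
      using suminf_exist_split[OF \<open>e > 0\<close> sT] by blast
    show "\<exists>A0. \<forall>A\<ge>A0::nat. \<forall>N. Bexp m N (\<lambda>x. annulus_exp \<kappa> (v' * s0) A N (sqrt (real N) * (x - m))) \<le> e"
    proof (intro exI[of _ A0] allI impI)
      fix A N :: nat assume A: "A0 \<le> A"
      define J where "J = {j. A \<le> j \<and> real j \<le> v' * s0 * sqrt (real N)}"
      have finJ: "finite J"
        by (rule finite_subset[of _ "{..nat \<lfloor>v' * s0 * sqrt (real N)\<rfloor>}"]) (auto simp: J_def le_nat_floor)
      define w where "w = (\<lambda>x. sqrt (real N) * (x - m))"
      have "Bexp m N (\<lambda>x. if real A \<le> \<bar>w x\<bar> \<and> \<bar>w x\<bar> \<le> v' * s0 * sqrt (real N)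
         then exp (\<kappa> * (w x)\<^sup>2 / 2) else 0)
        \<le> Bexp m N (\<lambda>x. \<Sum>j\<in>J. exp (\<kappa> * (real j + 1)\<^sup>2 / 2) * (if real j \<le> \<bar>w x\<bar> then 1 else 0))"
      proof (rule Bexp_mono)
        fix x
        have nonneg: "0 \<le> (\<Sum>j\<in>J. exp (\<kappa> * (real j + 1)\<^sup>2 / 2) * (if real j \<le> \<bar>w x\<bar> then 1 else 0))"
          by (intro sum_nonneg) auto
        show "(if real A \<le> \<bar>w x\<bar> \<and> \<bar>w x\<bar> \<le> v' * s0 * sqrt (real N) then exp (\<kappa> * (w x)\<^sup>2 / 2) else 0)
          \<le> (\<Sum>j\<in>J. exp (\<kappa> * (real j + 1)\<^sup>2 / 2) * (if real j \<le> \<bar>w x\<bar> then 1 else 0))"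
        proof (cases "real A \<le> \<bar>w x\<bar> \<and> \<bar>w x\<bar> \<le> v' * s0 * sqrt (real N)")
          case True
          \<comment> \<open>The shell containing w. Its own summand already dominates the integrand;
            the other summands are nonnegative.\<close>
          define j where "j = nat \<lfloor>\<bar>w x\<bar>\<rfloor>"
          have j: "real j \<le> \<bar>w x\<bar>" "\<bar>w x\<bar> \<le> real j + 1" "A \<le> j"
            using True unfolding j_def by (simp, linarith, simp add: le_nat_floor)
          then have jJ: "j \<in> J" using True unfolding J_def by auto
          have "(w x)\<^sup>2 \<le> (real j + 1)\<^sup>2" using j by (metis abs_ge_zero power2_abs power_mono)
          then have "exp (\<kappa> * (w x)\<^sup>2 / 2) \<le> exp (\<kappa> * (real j + 1)\<^sup>2 / 2) * (if real j \<le> \<bar>w x\<bar> then 1 else 0)"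
            using j \<kappa> by simp
          also have "\<dots> \<le> (\<Sum>j\<in>J. exp (\<kappa> * (real j + 1)\<^sup>2 / 2) * (if real j \<le> \<bar>w x\<bar> then 1 else 0))"
            by (rule member_le_sum[OF jJ]) (auto simp: finJ)
          finally show ?thesis using True by simp
        qed (use nonneg in auto)
      qed (use m in auto)
      also have "\<dots> = (\<Sum>j\<in>J. exp (\<kappa> * (real j + 1)\<^sup>2 / 2) * Bexp m N (\<lambda>x. if real j \<le> \<bar>w x\<bar> then 1 else 0))"
        unfolding Bexp_sum Bexp_cmult ..
      also have "\<dots> \<le> (\<Sum>j\<in>J. T j)"
      proof (rule sum_mono)
        fix j assume "j \<in> J"
        then have "Bexp m N (\<lambda>x. if real j \<le> \<bar>w x\<bar> then 1 else 0) \<le> 2 * exp (- (real j)\<^sup>2 / (2 * v'))"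
          unfolding w_def using s0 by (intro Bexp_tail_le m v'0) (auto simp: J_def v_def)
        then have "exp (\<kappa> * (real j + 1)\<^sup>2 / 2) * Bexp m N (\<lambda>x. if real j \<le> \<bar>w x\<bar> then 1 else 0)
          \<le> exp (\<kappa> * (real j + 1)\<^sup>2 / 2) * (2 * exp (- (real j)\<^sup>2 / (2 * v')))"
          by (intro mult_left_mono) auto
        also have "\<dots> = 2 * exp (\<kappa> * (real j + 1)\<^sup>2 / 2 - (real j)\<^sup>2 / (2 * v'))"
        proof -
          have "exp x * (2 * exp (- y)) = 2 * exp (x - y)" for x y :: real
            by (simp add: exp_diff exp_minus field_simps)
          from this[of "\<kappa> * (real j + 1)\<^sup>2 / 2" "(real j)\<^sup>2 / (2 * v')"] show ?thesis by simp
        qed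
        also have "\<kappa> * (real j + 1)\<^sup>2 / 2 - (real j)\<^sup>2 / (2 * v') = - a * (real j)\<^sup>2 + \<kappa> * real j + \<kappa> / 2"
        proof -
          have alg: "\<kappa> * (x + 1)\<^sup>2 / 2 - i * x\<^sup>2 / 2 = - ((i - \<kappa>) / 2) * x\<^sup>2 + \<kappa> * x + \<kappa> / 2" for x i :: real
            by (simp add: power2_eq_square field_simps)
          show ?thesis using alg[of "real j" "1 / v'"] by (simp add: a_def)
        qed
        finally show "exp (\<kappa> * (real j + 1)\<^sup>2 / 2) * Bexp m N (\<lambda>x. if real j \<le> \<bar>w x\<bar> then 1 else 0) \<le> T j"
          unfolding T_def .
      qed
      also have "\<dots> \<le> (\<Sum>i\<in>(\<lambda>j. j - A) ` J. T (i + A))"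
        by (subst sum.reindex) (auto simp: inj_on_def J_def intro!: sum_mono)
      also have "\<dots> \<le> (\<Sum>i. T (i + A))"
        using summable_ignore_initial_segment[OF sT] finJ
        by (intro sum_le_suminf) (auto simp: T_def)
      also have "\<dots> \<le> e" using A0[OF A] by auto
      finally show "Bexp m N (\<lambda>x. annulus_exp \<kappa> (v' * s0) A N (sqrt (real N) * (x - m))) \<le> e" unfolding w_def .
    qed
  qed
qed

section \<open>Gaussian limit of exponentially growing functionals\<close>

lemma std_normal_measure_UNIV [simp]: "measure gauss UNIV = 1"
  using prob_space.prob_space[OF real_distribution.axioms(1)[OF real_dist_normal_dist]] by simp

lemma std_normal_const [simp]: "(\<integral>z. c \<partial>gauss) = (c::real)"
  by simp

lemma AE_std_normal_notin_finite:
  assumes "finite bad" shows "AE z in gauss. z \<notin> bad"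
proof -
  have "AE z in lborel. z \<notin> bad"
    by (rule AE_not_in) (use assms in \<open>auto intro: countable_imp_null_set_lborel countable_finite\<close>)
  then show ?thesis by (subst AE_density) auto
qed

lemma integral_std_normal_eq:
  fixes f :: "real \<Rightarrow> real"
  assumes [measurable]: "f \<in> borel_measurable borel"
  shows "(\<integral>z. f z \<partial>gauss) = (\<integral>z. std_normal_density z * f z \<partial>lborel)"
  by (subst integral_real_density) auto

text \<open>The factor exp(a z^2 / 2) turns the standard Gaussian into a multiple of a Gaussian of
  variance 1 / (1 - a); the scaling by (1 - a)^(-1/2) brings it back. The change of variables also
  matches the default value 0 of a divergent integral, so the identity is available before
  integrability is known.\<close>

lemma std_normal_exp_square_integral:
  fixes f :: "real \<Rightarrow> real"
  assumes a: "a < 1" and [measurable]: "f \<in> borel_measurable borel"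
  shows "(\<integral>z. exp (a * z\<^sup>2 / 2) * f z \<partial>gauss)
    = (1 - a) powr (-1/2) * (\<integral>z. f ((1 - a) powr (-1/2) * z) \<partial>gauss)"
proof -
  define c where "c = (1 - a) powr (-1/2)"
  have c: "c > 0" "c * c * (1 - a) = 1"
    using a by (auto simp: c_def powr_minus powr_half_sqrt field_simps)
  have "(\<integral>z. exp (a * z\<^sup>2 / 2) * f z \<partial>gauss)
      = (\<integral>z. std_normal_density z * (exp (a * z\<^sup>2 / 2) * f z) \<partial>lborel)"
    by (rule integral_std_normal_eq) measurable
  also have "\<dots> = \<bar>c\<bar> *\<^sub>R (\<integral>z. std_normal_density (0 + c * z) * (exp (a * (0 + c * z)\<^sup>2 / 2) * f (0 + c * z)) \<partial>lborel)"
    by (rule lborel_integral_real_affine) (use c in simp)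
  also have "\<dots> = c * (\<integral>z. std_normal_density z * f (c * z) \<partial>lborel)"
  proof -
    have sq: "std_normal_density (0 + c * z) * (exp (a * (0 + c * z)\<^sup>2 / 2) * f (0 + c * z))
      = std_normal_density z * f (c * z)" for z
    proof -
      have "- (c * z)\<^sup>2 / 2 + a * (c * z)\<^sup>2 / 2 = - (c * c * (1 - a)) * z\<^sup>2 / 2"
        by (simp add: field_simps power2_eq_square)
      then have "exp (- (c * z)\<^sup>2 / 2) * exp (a * (c * z)\<^sup>2 / 2) = exp (- z\<^sup>2 / 2)"
        unfolding c(2) exp_add[symmetric] by simp
      then show ?thesis by (simp add: std_normal_density_def)
    qed
    show ?thesis using c(1) unfolding sq by simp
  qed
  also have "\<dots> = c * (\<integral>z. f (c * z) \<partial>gauss)"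
    by (subst integral_std_normal_eq) measurable
  finally show ?thesis unfolding c_def .
qed

text \<open>A non-integrable function has integral 0 by convention, but the scaling identity assigns
  this one the positive value (1 - a)^(-1/2).\<close>

lemma integrable_std_normal_exp_square:
  assumes "a < 1"
  shows "integrable gauss (\<lambda>z. exp (a * z\<^sup>2 / 2))"
proof (rule ccontr)
  assume n: "\<not> integrable gauss (\<lambda>z. exp (a * z\<^sup>2 / 2))"
  have "0 = (\<integral>z. exp (a * z\<^sup>2 / 2) \<partial>gauss)"
    using not_integrable_integral_eq[OF n] by simp
  also have "\<dots> = (1 - a) powr (-1/2)"
    using std_normal_exp_square_integral[OF assms, of "\<lambda>_. 1"] by simp
  finally show False using assms by simp
qed

text \<open>The radius \<delta> is chosen before \<open>F\<close>, \<open>G\<close>,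
  \<open>C\<close> and \<open>bad\<close>, so that it can serve many functionals at once.
  Convergence of \<open>F N (u N)\<close> along all sequences u tending to w is what the Skorohod
  representation can use. The finite set \<open>bad\<close> leaves room for threshold indicators;
  the Gaussian limit does not charge it.\<close>

lemma Bexp_tendsto_gaussian:
  assumes m: "\<bar>m\<bar> < 1" and \<kappa>: "0 < \<kappa>" "\<kappa> * (1 - m\<^sup>2) < 1"
  shows "\<exists>\<delta>>0. \<forall>F G C bad. (\<forall>N. F N \<in> borel_measurable borel) \<longrightarrow> G \<in> borel_measurable borel \<longrightarrow>
      finite bad \<longrightarrow> (\<forall>w u. w \<notin> bad \<longrightarrow> u \<longlonglongrightarrow> w \<longrightarrow> (\<lambda>N. F N (u N)) \<longlonglongrightarrow> G w) \<longrightarrow>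
      (\<forall>N w. \<bar>F N w\<bar> \<le> (if \<bar>w\<bar> \<le> \<delta> * sqrt (real N) then C * exp (\<kappa> * w\<^sup>2 / 2) else 0)) \<longrightarrow>
      (\<lambda>N. Bexp m N (\<lambda>x. F N (sqrt (real N) * (x - m)))) \<longlonglongrightarrow>
        (\<integral>z. G (sqrt (1 - m\<^sup>2) * z) \<partial>gauss)"
proof -
  obtain \<delta> where \<delta>: "\<delta> > 0" and tail:
    "\<And>e. e > 0 \<Longrightarrow> \<exists>A0. \<forall>A\<ge>A0::nat. \<forall>N. Bexp m N (\<lambda>x. annulus_exp \<kappa> \<delta> A N (sqrt (real N) * (x - m))) \<le> e"
    by (rule Bexp_gaussian_tail[OF assms]) (rule that)
  define \<sigma> where "\<sigma> = sqrt (1 - m\<^sup>2)"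
  have "m\<^sup>2 < 1" using m by (simp add: abs_square_less_1)
  then have \<sigma>: "\<sigma> > 0" "\<sigma>\<^sup>2 = 1 - m\<^sup>2" by (auto simp: \<sigma>_def)
  obtain \<Omega> :: "real measure" and Ys :: "nat \<Rightarrow> real \<Rightarrow> real" and Y :: "real \<Rightarrow> real"
  where "prob_space \<Omega>" and Ys[measurable]: "\<And>n. Ys n \<in> borel_measurable \<Omega>"
    and Y[measurable]: "Y \<in> borel_measurable \<Omega>"
    and dY: "distr \<Omega> borel Y = gauss"
    and conv: "\<And>x. x \<in> space \<Omega> \<Longrightarrow> (\<lambda>n. Ys n x) \<longlonglongrightarrow> Y x"
    and repr: "\<And>N g. N > 0 \<Longrightarrow> g \<in> borel_measurable borel \<Longrightarrow>
       Bexp m N g = (\<integral>\<omega>. g (m + \<sigma> * Ys N \<omega> / sqrt (real N)) \<partial>\<Omega>)"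
    by (rule biased_bernoulli_CLT[OF m, folded \<sigma>_def]) (rule that)
  interpret \<Omega>: prob_space \<Omega> by fact
  show ?thesis
  proof (intro exI[of _ \<delta>] conjI \<delta> allI impI)
    fix F :: "nat \<Rightarrow> real \<Rightarrow> real" and G C bad
    assume F': "\<forall>N. F N \<in> borel_measurable borel" and G[measurable]: "G \<in> borel_measurable borel"
      and bad: "finite bad"
      and FG': "\<forall>w u. w \<notin> bad \<longrightarrow> u \<longlonglongrightarrow> w \<longrightarrow> (\<lambda>N. F N (u N)) \<longlonglongrightarrow> G w"
      and bound': "\<forall>N w. \<bar>F N w\<bar> \<le> (if \<bar>w\<bar> \<le> \<delta> * sqrt (real N) then C * exp (\<kappa> * w\<^sup>2 / 2) else 0)"
    have F[measurable]: "\<And>N. F N \<in> borel_measurable borel"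
      and FG: "\<And>w u. w \<notin> bad \<Longrightarrow> u \<longlonglongrightarrow> w \<Longrightarrow> (\<lambda>N. F N (u N)) \<longlonglongrightarrow> G w"
      and bound: "\<And>N w. \<bar>F N w\<bar> \<le> (if \<bar>w\<bar> \<le> \<delta> * sqrt (real N) then C * exp (\<kappa> * w\<^sup>2 / 2) else 0)"
      using F' FG' bound' by blast+
    have C: "C \<ge> 0" using bound[of 0 0] by auto
    have bound': "\<bar>F N w\<bar> \<le> C * exp (\<kappa> * w\<^sup>2 / 2)" for N w
      using bound[of N w] C by (auto split: if_splits intro: order_trans[of _ 0])
    have AEY: "AE \<omega> in \<Omega>. \<sigma> * Y \<omega> \<notin> B" if "finite B" for B
    proof -
      have "AE z in gauss. z \<notin> (\<lambda>b. b / \<sigma>) ` B"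
        by (rule AE_std_normal_notin_finite) (use that in auto)
      then have "AE z in distr \<Omega> borel Y. z \<notin> (\<lambda>b. b / \<sigma>) ` B" unfolding dY .
      then have "AE \<omega> in \<Omega>. Y \<omega> \<notin> (\<lambda>b. b / \<sigma>) ` B" by (rule AE_distrD[rotated]) simp
      then show ?thesis by eventually_elim (use \<sigma> in \<open>auto simp: image_iff field_simps\<close>)
    qed
    have Gbound: "\<bar>G w\<bar> \<le> C * exp (\<kappa> * w\<^sup>2 / 2)" if "w \<notin> bad" for w
      by (rule tendsto_upperbound[OF tendsto_rabs[OF FG[OF that tendsto_const]]])
        (use bound' in auto)
    \<comment> \<open>Truncation at |w| < A: for fixed A a constant dominates, as A grows the
      Gaussian integral of exp(\<kappa> w^2 / 2) dominates, and the error for finite N is bounded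
      uniformly by the annulus estimate. The discontinuities at A and -A join the exceptional null
      set.\<close>
    define trunc where "trunc = (\<lambda>A::nat. \<lambda>w::real. if \<bar>w\<bar> < real A then 1 else 0 :: real)"
    have [measurable]: "trunc A \<in> borel_measurable borel" for A unfolding trunc_def by measurable
    define b where "b = (\<lambda>A N. Bexp m N (\<lambda>x. F N (sqrt (real N) * (x - m)) * trunc A (sqrt (real N) * (x - m))))"
    define gA where "gA = (\<lambda>A. \<integral>\<omega>. G (\<sigma> * Y \<omega>) * trunc A (\<sigma> * Y \<omega>) \<partial>\<Omega>)"
    define L where "L = (\<integral>\<omega>. G (\<sigma> * Y \<omega>) \<partial>\<Omega>)"
    have L: "L = (\<integral>z. G (sqrt (1 - m\<^sup>2) * z) \<partial>gauss)"
      unfolding L_def \<sigma>_def[symmetric] dY[symmetric] by (subst integral_distr) auto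
    have b_lim: "b A \<longlonglongrightarrow> gA A" for A
    proof -
      have "(\<lambda>N. \<integral>\<omega>. F N (\<sigma> * Ys N \<omega>) * trunc A (\<sigma> * Ys N \<omega>) \<partial>\<Omega>) \<longlonglongrightarrow> gA A"
        unfolding gA_def
      proof (rule integral_dominated_convergence[where w = "\<lambda>_. C * exp (\<kappa> * (real A)\<^sup>2 / 2)"])
        show "AE \<omega> in \<Omega>. (\<lambda>N. F N (\<sigma> * Ys N \<omega>) * trunc A (\<sigma> * Ys N \<omega>)) \<longlonglongrightarrow> G (\<sigma> * Y \<omega>) * trunc A (\<sigma> * Y \<omega>)"
        proof -
          have pm: "finite {real A, - real A}" by simp
          show ?thesis
          using AEY[OF bad] AEY[OF pm] AE_space
        proof eventually_elim
          fix \<omega> assume *: "\<sigma> * Y \<omega> \<notin> bad" "\<sigma> * Y \<omega> \<notin> {real A, - real A}" "\<omega> \<in> space \<Omega>"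
          have lim: "(\<lambda>N. \<sigma> * Ys N \<omega>) \<longlonglongrightarrow> \<sigma> * Y \<omega>" by (intro tendsto_intros conv *)
          have "(\<lambda>N. trunc A (\<sigma> * Ys N \<omega>)) \<longlonglongrightarrow> trunc A (\<sigma> * Y \<omega>)"
          proof (cases "\<bar>\<sigma> * Y \<omega>\<bar> < real A")
            case True
            then have "eventually (\<lambda>N. \<bar>\<sigma> * Ys N \<omega>\<bar> < real A) sequentially"
              by (rule order_tendstoD(2)[OF tendsto_rabs[OF lim]])
            then show ?thesis using True
              by (intro tendsto_eventually) (auto simp: trunc_def elim: eventually_mono)
          next
            case False
            then have "real A < \<bar>\<sigma> * Y \<omega>\<bar>" using *(2) by (auto simp: abs_if split: if_splits)
            then have "eventually (\<lambda>N. real A < \<bar>\<sigma> * Ys N \<omega>\<bar>) sequentially"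
              by (rule order_tendstoD(1)[OF tendsto_rabs[OF lim]])
            then show ?thesis using False
              by (intro tendsto_eventually) (auto simp: trunc_def elim: eventually_mono)
          qed
          then show "(\<lambda>N. F N (\<sigma> * Ys N \<omega>) * trunc A (\<sigma> * Ys N \<omega>)) \<longlonglongrightarrow> G (\<sigma> * Y \<omega>) * trunc A (\<sigma> * Y \<omega>)"
            by (intro tendsto_mult FG *(1) lim)
        qed
        qed
        fix N
        have "\<bar>F N w * trunc A w\<bar> \<le> C * exp (\<kappa> * (real A)\<^sup>2 / 2)" for w
        proof (cases "\<bar>w\<bar> < real A")
          case True
          then have "w\<^sup>2 \<le> (real A)\<^sup>2" by (metis abs_ge_zero less_imp_le power2_abs power_mono)
          then have "C * exp (\<kappa> * w\<^sup>2 / 2) \<le> C * exp (\<kappa> * (real A)\<^sup>2 / 2)"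
            using C \<kappa> by (intro mult_left_mono) auto
          then show ?thesis using True bound'[of N w] by (simp add: trunc_def)
        qed (use C in \<open>auto simp: trunc_def\<close>)
        then show "AE \<omega> in \<Omega>. norm (F N (\<sigma> * Ys N \<omega>) * trunc A (\<sigma> * Ys N \<omega>)) \<le> C * exp (\<kappa> * (real A)\<^sup>2 / 2)"
          by auto
      qed auto
      moreover have "eventually (\<lambda>N. (\<integral>\<omega>. F N (\<sigma> * Ys N \<omega>) * trunc A (\<sigma> * Ys N \<omega>) \<partial>\<Omega>) = b A N) sequentially"
        using eventually_gt_at_top[of "0::nat"]
      proof eventually_elim
        fix N :: nat assume "N > 0"
        then show "(\<integral>\<omega>. F N (\<sigma> * Ys N \<omega>) * trunc A (\<sigma> * Ys N \<omega>) \<partial>\<Omega>) = b A N"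
          unfolding b_def by (subst repr) auto
      qed
      ultimately show ?thesis by (rule Lim_transform_eventually)
    qed
    have gA_lim: "gA \<longlonglongrightarrow> L"
      unfolding gA_def L_def
    proof (rule integral_dominated_convergence[where w = "\<lambda>\<omega>. C * exp (\<kappa> * (\<sigma> * Y \<omega>)\<^sup>2 / 2)"])
      have "\<kappa> * \<sigma>\<^sup>2 < 1" using \<kappa> \<sigma> by simp
      from integrable_std_normal_exp_square[OF this]
      have "integrable (distr \<Omega> borel Y) (\<lambda>z. exp (\<kappa> * \<sigma>\<^sup>2 * z\<^sup>2 / 2))" unfolding dY .
      then have "integrable \<Omega> (\<lambda>\<omega>. exp (\<kappa> * \<sigma>\<^sup>2 * (Y \<omega>)\<^sup>2 / 2))"
        by (subst (asm) integrable_distr_eq) auto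
      then show "integrable \<Omega> (\<lambda>\<omega>. C * exp (\<kappa> * (\<sigma> * Y \<omega>)\<^sup>2 / 2))"
        by (intro integrable_mult_right) (simp add: power_mult_distrib mult.assoc)
      show "AE \<omega> in \<Omega>. (\<lambda>A. G (\<sigma> * Y \<omega>) * trunc A (\<sigma> * Y \<omega>)) \<longlonglongrightarrow> G (\<sigma> * Y \<omega>)"
      proof (intro AE_I2 tendsto_eventually)
        fix \<omega>
        have "eventually (\<lambda>A::nat. \<bar>\<sigma> * Y \<omega>\<bar> < real A) sequentially"
          using filterlim_real_sequentially by (auto simp: filterlim_at_top_dense)
        then show "eventually (\<lambda>A. G (\<sigma> * Y \<omega>) * trunc A (\<sigma> * Y \<omega>) = G (\<sigma> * Y \<omega>)) sequentially"
          by eventually_elim (simp add: trunc_def)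
      qed
      fix A
      show "AE \<omega> in \<Omega>. norm (G (\<sigma> * Y \<omega>) * trunc A (\<sigma> * Y \<omega>)) \<le> C * exp (\<kappa> * (\<sigma> * Y \<omega>)\<^sup>2 / 2)"
        using AEY[OF bad] by eventually_elim (use Gbound C in \<open>auto simp: trunc_def\<close>)
    qed auto
    have "(\<lambda>N. Bexp m N (\<lambda>x. F N (sqrt (real N) * (x - m)))) \<longlonglongrightarrow> L"
    proof (rule LIMSEQ_I)
      fix e :: real assume e: "e > 0"
      have "e / (3 * (C + 1)) > 0" using e C by simp
      from tail[OF this] obtain A0 where A0: "\<And>A N. A \<ge> A0 \<Longrightarrow> Bexp m N (\<lambda>x. annulus_exp \<kappa> \<delta> A N (sqrt (real N) * (x - m))) \<le> e / (3 * (C + 1))" by blast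
      obtain A1 where A1: "\<And>A. A \<ge> A1 \<Longrightarrow> norm (gA A - L) < e / 3"
        using LIMSEQ_D[OF gA_lim, of "e / 3"] e by auto
      define A where "A = max A0 A1"
      obtain N0 where N0: "\<And>N. N \<ge> N0 \<Longrightarrow> norm (b A N - gA A) < e / 3"
        using LIMSEQ_D[OF b_lim[of A], of "e / 3"] e by auto
      show "\<exists>N0. \<forall>N\<ge>N0. norm (Bexp m N (\<lambda>x. F N (sqrt (real N) * (x - m))) - L) < e"
      proof (intro exI[of _ N0] allI impI)
        fix N assume N: "N \<ge> N0"
        have "\<bar>Bexp m N (\<lambda>x. F N (sqrt (real N) * (x - m))) - b A N\<bar>
          \<le> Bexp m N (\<lambda>x. C * (annulus_exp \<kappa> \<delta> A N (sqrt (real N) * (x - m))))"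
          unfolding b_def
        proof (rule Bexp_diff_le)
          fix x
          show "\<bar>F N (sqrt (real N) * (x - m)) - F N (sqrt (real N) * (x - m)) * trunc A (sqrt (real N) * (x - m))\<bar>
           \<le> C * (annulus_exp \<kappa> \<delta> A N (sqrt (real N) * (x - m)))"
            using bound[of N "sqrt (real N) * (x - m)"] C
            by (cases "\<bar>sqrt (real N) * (x - m)\<bar> < real A") (auto simp: trunc_def not_less split: if_splits)
        qed (use m in auto)
        also have "\<dots> \<le> C * (e / (3 * (C + 1)))"
          unfolding Bexp_cmult using A0[of A N] C by (intro mult_left_mono) (auto simp: A_def)
        also have "\<dots> \<le> e / 3" using C e by (simp add: field_simps)
        finally have *: "\<bar>Bexp m N (\<lambda>x. F N (sqrt (real N) * (x - m))) - b A N\<bar> \<le> e / 3" .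
        have A1': "norm (gA A - L) < e / 3" by (rule A1) (simp add: A_def)
        show "norm (Bexp m N (\<lambda>x. F N (sqrt (real N) * (x - m))) - L) < e"
          using * N0[OF N] A1' unfolding real_norm_def by linarith
      qed
    qed
    then show "(\<lambda>N. Bexp m N (\<lambda>x. F N (sqrt (real N) * (x - m)))) \<longlonglongrightarrow>
        (\<integral>z. G (sqrt (1 - m\<^sup>2) * z) \<partial>gauss)" unfolding L .
  qed
qed

section \<open>Counting configurations with given magnetization\<close>

text \<open>On the two values y = -1 and y = 1, the factor 1 + m y is the exponential of an affine
  function of y with slope artanh m. The weight therefore depends on the configuration only through
  its magnetization.\<close>

lemma biased_weight_eq:
  assumes m: "\<bar>m\<bar> < 1" and x: "x \<in> configs N"
  shows "(\<Prod>i<N. (1 + m * x i) / 2) = exp (real N * (Ient m + artanh m * (xbar N x - m))) / 2 ^ N"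
proof -
  define c where "c = (ln (1 + m) + ln (1 - m)) / 2"
  have art: "artanh m = (ln (1 + m) - ln (1 - m)) / 2"
  proof -
    have "1 + m > 0" "1 - m > 0" using m by auto
    then show ?thesis by (simp add: artanh_def ln_div)
  qed
  have "(1 + m * x i) / 2 = exp (c + artanh m * x i) / 2" if i: "i < N" for i
  proof -
    consider "x i = -1" | "x i = 1" using configs_cases[OF x i] by auto
    then show ?thesis
    proof cases
      case 1
      then have "c + artanh m * x i = ln (1 - m)" unfolding art c_def by (simp add: field_simps)
      then show ?thesis using 1 m by simp
    next
      case 2
      then have "c + artanh m * x i = ln (1 + m)" unfolding art c_def by (simp add: field_simps)
      then show ?thesis using 2 m by simp
    qed
  qed
  then have "(\<Prod>i<N. (1 + m * x i) / 2) = (\<Prod>i<N. exp (c + artanh m * x i) / 2)"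
    by (intro prod.cong) auto
  also have "\<dots> = exp (real N * c + artanh m * (real N * xbar N x)) / 2 ^ N"
    by (simp add: prod_dividef exp_sum[symmetric] sum.distrib sum_distrib_left[symmetric] sum_eq_xbar)
  also have "real N * c + artanh m * (real N * xbar N x) = real N * (Ient m + artanh m * (xbar N x - m))"
    unfolding Ient_def art c_def by (simp add: field_simps)
  finally show ?thesis .
qed

lemma all_eq_of_xbar_extreme:
  assumes "x \<in> configs N" "i < N" "\<bar>y\<bar> = 1" "xbar N x = y"
  shows "x i = y"
proof -
  have "0 \<le> 1 - y * x j" if "j \<in> {..<N}" for j
    using assms configs_cases[OF assms(1), of j] that by (auto simp: abs_if split: if_splits)
  moreover have "(\<Sum>j<N. 1 - y * x j) = 0"
    using assms by (simp add: sum_subtractf sum_distrib_left[symmetric] sum_eq_xbar abs_if split: if_splits)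
  ultimately have "1 - y * x i = 0"
    using assms(2) by (subst (asm) sum_nonneg_eq_0_iff) auto
  then show ?thesis
    using assms configs_cases[OF assms(1,2)] by (auto simp: abs_if split: if_splits)
qed

text \<open>Under the product measure with mean y, all configurations of magnetization y have the
  same weight exp(N I(y)) / 2^N, and the total mass is 1. At |y| = 1 artanh is of no use, but there
  a single constant configuration carries everything.\<close>

lemma card_configs_xbar_le:
  assumes "N > 0" "\<bar>y\<bar> \<le> 1"
  shows "real (card {x \<in> configs N. xbar N x = y}) \<le> 2 ^ N * exp (- real N * Ient y)"
proof -
  let ?S = "{x \<in> configs N. xbar N x = y}"
  have wt: "(\<Prod>i<N. (1 + y * x i) / 2) = exp (real N * Ient y) / 2 ^ N" if x: "x \<in> ?S" for x
  proof (cases "\<bar>y\<bar> < 1")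
    case True
    then show ?thesis using biased_weight_eq[OF True, of x N] x by simp
  next
    case False
    then have y: "\<bar>y\<bar> = 1" using assms by simp
    have "(\<Prod>i<N. (1 + y * x i) / 2) = (\<Prod>i<N. 1)"
    proof (rule prod.cong)
      fix i assume "i \<in> {..<N}"
      then have "x i = y" using all_eq_of_xbar_extreme[of x N i y] x y by auto
      then show "(1 + y * x i) / 2 = 1" using y by (auto simp: abs_if split: if_splits)
    qed simp
    moreover have "Ient y = ln 2" using y by (auto simp: Ient_def abs_if split: if_splits)
    moreover have "exp (real N * ln 2) = 2 ^ N" by (simp add: exp_of_nat_mult)
    ultimately show ?thesis by simp
  qed
  have "real (card ?S) * (exp (real N * Ient y) / 2 ^ N) = (\<Sum>x\<in>?S. \<Prod>i<N. (1 + y * x i) / 2)"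
    by (simp add: wt)
  also have "\<dots> \<le> (\<Sum>x\<in>configs N. \<Prod>i<N. (1 + y * x i) / 2)"
    by (rule sum_mono2) (auto intro!: config_weight_nonneg assms)
  also have "\<dots> = 1" using Bexp_const[of y N] by (simp add: Bexp_def)
  finally show ?thesis by (simp add: exp_minus field_simps)
qed

lemma card_xbar_values_le: "card (xbar N ` configs N) \<le> N + 1"
proof -
  have "xbar N ` configs N \<subseteq> (\<lambda>k. (2 * real k - real N) / real N) ` {..N}"
  proof
    fix y assume "y \<in> xbar N ` configs N"
    then obtain x where x: "x \<in> configs N" "y = xbar N x" by auto
    let ?k = "card {i \<in> {..<N}. x i = 1}"
    have "(\<Sum>i<N. x i) = (\<Sum>i<N. 2 * (if x i = 1 then 1 else 0) - 1)"
      by (intro sum.cong) (use configs_cases[OF x(1)] in force)+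
    also have "\<dots> = 2 * real ?k - real N"
      by (simp add: sum_subtractf sum_distrib_left[symmetric] sum.If_cases Int_def)
    finally have "y = (2 * real ?k - real N) / real N" by (simp add: x(2) xbar_def)
    moreover have "?k \<le> N" using card_mono[of "{..<N}" "{i \<in> {..<N}. x i = 1}"] by auto
    ultimately show "y \<in> (\<lambda>k. (2 * real k - real N) / real N) ` {..N}" by auto
  qed
  then have "card (xbar N ` configs N) \<le> card ((\<lambda>k. (2 * real k - real N) / real N) ` {..N})"
    by (intro card_mono) auto
  also have "\<dots> \<le> N + 1" using card_image_le[of "{..N}"] by simp
  finally show ?thesis .
qed

text \<open>Grouping by magnetization: there are at most N + 1 levels, and entropy and energy of a
  level combine to exp(N H(y)). The polynomial factor is harmless where H stays strictly below its
  maximum.\<close>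

lemma cw_weight_sum_le:
  assumes "N > 0" "\<And>y. y \<in> B \<Longrightarrow> \<bar>y\<bar> \<le> 1 \<Longrightarrow> Hfun b h p y \<le> s"
  shows "(\<Sum>x | x \<in> configs N \<and> xbar N x \<in> B. cw_weight b h p N x) \<le> real (N + 1) * (2 ^ N * exp (real N * s))"
proof -
  let ?S = "{x \<in> configs N. xbar N x \<in> B}"
  have "(\<Sum>x\<in>?S. cw_weight b h p N x)
      = (\<Sum>y\<in>xbar N ` ?S. \<Sum>x | x \<in> ?S \<and> xbar N x = y. cw_weight b h p N x)"
    by (rule sum.group[symmetric]) auto
  also have "\<dots> \<le> (\<Sum>y\<in>xbar N ` ?S. 2 ^ N * exp (real N * s))"
  proof (rule sum_mono)
    fix y assume "y \<in> xbar N ` ?S"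
    then have y: "y \<in> B" "\<bar>y\<bar> \<le> 1" by (auto intro: abs_xbar_le_1)
    have "(\<Sum>x | x \<in> ?S \<and> xbar N x = y. cw_weight b h p N x)
       = (\<Sum>x | x \<in> configs N \<and> xbar N x = y. exp (real N * (b * y ^ p + h * y)))"
      using y by (intro sum.cong) (auto simp: cw_weight_def)
    also have "\<dots> = real (card {x \<in> configs N. xbar N x = y}) * exp (real N * (b * y ^ p + h * y))"
      by simp
    also have "\<dots> \<le> (2 ^ N * exp (- real N * Ient y)) * exp (real N * (b * y ^ p + h * y))"
      by (intro mult_right_mono card_configs_xbar_le assms y) auto
    also have "\<dots> = 2 ^ N * exp (real N * Hfun b h p y)"
      by (simp add: Hfun_def exp_add[symmetric] algebra_simps)
    also have "\<dots> \<le> 2 ^ N * exp (real N * s)"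
      using assms(2)[OF y] by (auto intro: mult_left_mono)
    finally show "(\<Sum>x | x \<in> ?S \<and> xbar N x = y. cw_weight b h p N x) \<le> 2 ^ N * exp (real N * s)" .
  qed
  also have "\<dots> = real (card (xbar N ` ?S)) * (2 ^ N * exp (real N * s))" by simp
  also have "\<dots> \<le> real (N + 1) * (2 ^ N * exp (real N * s))"
  proof (intro mult_right_mono)
    have "card (xbar N ` ?S) \<le> card (xbar N ` configs N)" by (intro card_mono) auto
    then show "real (card (xbar N ` ?S)) \<le> real (N + 1)" using card_xbar_values_le[of N] by linarith
  qed auto
  finally show ?thesis .
qed

text \<open>Taylor's formula with a remainder quotient Q that is continuous at 0 as well. After u =
  w / sqrt N, the term N u^2 Q(u) becomes w^2 Q(w / sqrt N), whose limit is read off from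
  Q(0).\<close>

lemma power_second_order:
  "\<exists>Q. continuous_on UNIV Q \<and> Q 0 = real p * (real p - 1) / 2 * m ^ (p - 2) \<and>
     (\<forall>u::real. (m + u) ^ p = m ^ p + real p * m ^ (p - 1) * u + u\<^sup>2 * Q u)"
proof (induction p)
  case 0
  show ?case by (rule exI[of _ "\<lambda>_. 0"]) auto
next
  case (Suc p)
  then obtain Q where Q: "continuous_on UNIV Q" "Q 0 = real p * (real p - 1) / 2 * m ^ (p - 2)"
     "\<And>u. (m + u) ^ p = m ^ p + real p * m ^ (p - 1) * u + u\<^sup>2 * Q u" by blast
  have mp: "real p * (m * m ^ (p - 1)) = real p * m ^ p" by (cases p) auto
  have mp2: "m * (real p * (real p - 1) / 2 * m ^ (p - 2)) = real p * (real p - 1) / 2 * m ^ (p - 1)"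
    by (cases p; cases "p - 1") auto
  show ?case
  proof (intro exI[of _ "\<lambda>u. real p * m ^ (p - 1) + (m + u) * Q u"] conjI allI)
    show "continuous_on UNIV (\<lambda>u. real p * m ^ (p - 1) + (m + u) * Q u)"
      by (intro continuous_intros Q(1))
    show "real p * m ^ (p - 1) + (m + 0) * Q 0 = real (Suc p) * (real (Suc p) - 1) / 2 * m ^ (Suc p - 2)"
    proof -
      have "real p * m ^ (p - 1) + (m + 0) * Q 0 = real p * m ^ (p - 1) + real p * (real p - 1) / 2 * m ^ (p - 1)"
        unfolding Q(2) using mp2 by simp
      also have "\<dots> = real (Suc p) * real p / 2 * m ^ (p - 1)" by (simp add: field_simps)
      finally show ?thesis by simp
    qed
    fix u
    have "(m + u) ^ Suc p = (m + u) * (m ^ p + real p * m ^ (p - 1) * u + u\<^sup>2 * Q u)" by (simp add: Q(3))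
    also have "\<dots> = m ^ Suc p + (m ^ p + real p * (m * m ^ (p - 1))) * u
        + u\<^sup>2 * (real p * m ^ (p - 1) + (m + u) * Q u)"
      by (simp add: algebra_simps power2_eq_square)
    also have "m ^ p + real p * (m * m ^ (p - 1)) = real (Suc p) * m ^ (Suc p - 1)"
      unfolding mp by (simp add: algebra_simps)
    finally show "(m + u) ^ Suc p = m ^ Suc p + real (Suc p) * m ^ (Suc p - 1) * u
        + u\<^sup>2 * (real p * m ^ (p - 1) + (m + u) * Q u)" .
  qed
qed

text \<open>Linear growth in the exponent is absorbed by a slightly larger quadratic coefficient,
  again by completing the square.\<close>

lemma exp_linear_le_exp_square:
  assumes "k1 < k2"
  shows "exp (k1 * w\<^sup>2 / 2 + c * \<bar>w\<bar>) \<le> exp (c\<^sup>2 / (2 * (k2 - k1))) * exp (k2 * w\<^sup>2 / 2 :: real)"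
proof -
  define d where "d = k2 - k1"
  have d: "d > 0" using assms by (simp add: d_def)
  have "0 \<le> d / 2 * (\<bar>w\<bar> - c / d)\<^sup>2" using d by simp
  also have "\<dots> = d / 2 * w\<^sup>2 - c * \<bar>w\<bar> + c\<^sup>2 / (2 * d)"
    using d by (simp add: power2_diff field_simps) (simp add: power2_eq_square field_simps)
  finally have "k1 * w\<^sup>2 / 2 + c * \<bar>w\<bar> \<le> c\<^sup>2 / (2 * d) + k2 * w\<^sup>2 / 2"
    by (simp add: d_def algebra_simps diff_divide_distrib)
  then show ?thesis unfolding d_def exp_add[symmetric] by simp
qed

section \<open>Laplace asymptotics of the partition sum\<close>

text \<open>The quantity (m^2 - 1) H''(m) multiplied out, which avoids the quotient in H''. It also
  equals 1 - a (1 - m^2), where a is the quadratic coefficient left in the exponent after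
  tilting.\<close>

definition curv :: "real \<Rightarrow> nat \<Rightarrow> real \<Rightarrow> real" where
  "curv b p m = 1 - b * real p * (real p - 1) * m ^ (p - 2) * (1 - m\<^sup>2)"

definition peak_weight :: "real \<Rightarrow> nat \<Rightarrow> real \<Rightarrow> real" where
  "peak_weight b p m = curv b p m powr (-1/2)"

text \<open>The standard deviation of sqrt N * (xbar - m) near the peak: its square is -1 /
  H''(m).\<close>

definition peak_sd :: "real \<Rightarrow> nat \<Rightarrow> real \<Rightarrow> real" where
  "peak_sd b p m = sqrt (1 - m\<^sup>2) * curv b p m powr (-1/2)"

abbreviation peak_sum where
  "peak_sum b h p G m Hm \<delta> \<equiv> (\<lambda>N. \<Sum>x\<in>configs N. if \<bar>xbar N x - m\<bar> \<le> \<delta>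
     then cw_weight b h p N x * G N (xbar N x) / (2 ^ N * exp (real N * Hm)) else 0)"

abbreviation peak_int where
  "peak_int b p m g \<equiv> peak_weight b p m * (\<integral>z. g (peak_sd b p m * z) \<partial>gauss)"

text \<open>The equation artanh m = h + b p m^(p-1) says H'(m) = 0. It makes the linear part of the
  energy coincide with that of the log product weight, so only b times the second-order remainder of
  x^p survives.\<close>

lemma cw_weight_tilt:
  assumes m: "\<bar>m\<bar> < 1" "artanh m = h + b * real p * m ^ (p - 1)" and x: "x \<in> configs N"
  shows "cw_weight b h p N x / (2 ^ N * exp (real N * Hfun b h p m))
    = (\<Prod>i<N. (1 + m * x i) / 2)
      * exp (real N * (b * (xbar N x ^ p - m ^ p - real p * m ^ (p - 1) * (xbar N x - m))))"
proof -
  have "(\<Prod>i<N. (1 + m * x i) / 2)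
      * exp (real N * (b * (xbar N x ^ p - m ^ p - real p * m ^ (p - 1) * (xbar N x - m))))
    = exp (real N * (Ient m + artanh m * (xbar N x - m))
       + real N * (b * (xbar N x ^ p - m ^ p - real p * m ^ (p - 1) * (xbar N x - m)))) / 2 ^ N"
    unfolding biased_weight_eq[OF m(1) x] by (simp add: exp_add)
  also have "real N * (Ient m + artanh m * (xbar N x - m))
       + real N * (b * (xbar N x ^ p - m ^ p - real p * m ^ (p - 1) * (xbar N x - m)))
     = real N * (b * xbar N x ^ p + h * xbar N x) - real N * Hfun b h p m"
    unfolding m(2) Hfun_def by (simp add: algebra_simps)
  finally show ?thesis by (simp add: cw_weight_def exp_diff)
qed

text \<open>After the tilt, the local sum is a \<open>Bexp\<close> of exp(N R) times G, where N R
  tends to a w^2 / 2 at scale w / sqrt N. Positivity of \<open>curv\<close> leaves room for two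
  numbers above a and below 1 / (1 - m^2): one bounds the remainder near m, the other in addition
  absorbs the growth exp(c |w|) of G. The radius again precedes the choice of G.\<close>

lemma cw_peak_laplace:
  assumes m: "\<bar>m\<bar> < 1" "artanh m = h + b * real p * m ^ (p - 1)" and curv: "curv b p m > 0"
  shows "\<exists>\<delta>0>0. \<forall>\<delta> G g C c bad. 0 < \<delta> \<longrightarrow> \<delta> \<le> \<delta>0 \<longrightarrow>
     (\<forall>N. G N \<in> borel_measurable borel) \<longrightarrow> g \<in> borel_measurable borel \<longrightarrow> finite bad \<longrightarrow>
     (\<forall>w u. w \<notin> bad \<longrightarrow> u \<longlonglongrightarrow> w \<longrightarrow> (\<lambda>N. G N (m + u N / sqrt (real N))) \<longlonglongrightarrow> g w) \<longrightarrow>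
     (\<forall>N w. \<bar>w\<bar> \<le> \<delta> * sqrt (real N) \<longrightarrow> \<bar>G N (m + w / sqrt (real N))\<bar> \<le> C * exp (c * \<bar>w\<bar>)) \<longrightarrow>
     peak_sum b h p G m (Hfun b h p m) \<delta>
     \<longlonglongrightarrow> peak_int b p m g"
proof -
  define v where "v = 1 - m\<^sup>2"
  have v: "v > 0" using m(1) by (simp add: v_def abs_square_less_1)
  define a where "a = b * (real p * (real p - 1) * m ^ (p - 2))"
  have av: "a * v < 1" using curv unfolding curv_def a_def v_def by (simp add: mult_ac)
  have curv_av: "curv b p m = 1 - a * v" unfolding curv_def a_def v_def by (simp add: mult_ac)
  \<comment> \<open>The coefficient a may be negative, whereas the tail estimate asks for a positive
    \<kappa>.\<close>
  have "max a 0 < 1 / v" using av v by (simp add: field_simps)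
  then obtain \<kappa> where k: "max a 0 < \<kappa>" "\<kappa> < 1 / v" using dense by blast
  obtain k1 where k1: "max a 0 < k1" "k1 < \<kappa>" using dense[OF k(1)] by blast
  have kv: "0 < \<kappa>" "\<kappa> * (1 - m\<^sup>2) < 1" using k v by (auto simp: v_def field_simps)
  obtain Q where Q: "continuous_on UNIV Q" "Q 0 = real p * (real p - 1) / 2 * m ^ (p - 2)"
     "\<And>u. (m + u) ^ p = m ^ p + real p * m ^ (p - 1) * u + u\<^sup>2 * Q u"
    using power_second_order[of p m] by blast
  have Qcont: "isCont Q x" for x using Q(1) by (simp add: continuous_on_eq_continuous_at)
  obtain \<delta>1 where d1: "\<delta>1 > 0" and lim0:
    "\<forall>F G C bad. (\<forall>N. F N \<in> borel_measurable borel) \<longrightarrow> G \<in> borel_measurable borel \<longrightarrow>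
      finite bad \<longrightarrow> (\<forall>w u. w \<notin> bad \<longrightarrow> u \<longlonglongrightarrow> w \<longrightarrow> (\<lambda>N. F N (u N)) \<longlonglongrightarrow> G w) \<longrightarrow>
      (\<forall>N w. \<bar>F N w\<bar> \<le> (if \<bar>w\<bar> \<le> \<delta>1 * sqrt (real N) then C * exp (\<kappa> * w\<^sup>2 / 2) else 0)) \<longrightarrow>
      (\<lambda>N. Bexp m N (\<lambda>x. F N (sqrt (real N) * (x - m)))) \<longlonglongrightarrow>
        (\<integral>z. G (sqrt (1 - m\<^sup>2) * z) \<partial>gauss)"
    using Bexp_tendsto_gaussian[OF m(1) kv] by (elim exE conjE) (rule that)
  note lim = lim0[rule_format]
  have "b * Q 0 < k1 / 2" using k1 unfolding Q(2) a_def by simp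
  moreover have "isCont (\<lambda>u. b * Q u) 0" by (intro continuous_intros Qcont)
  ultimately have "eventually (\<lambda>u. b * Q u < k1 / 2) (nhds 0)"
    using tendsto_at_iff_tendsto_nhds[of "\<lambda>u. b * Q u" 0]
    by (intro order_tendstoD(2)[of "\<lambda>u. b * Q u" "b * Q 0"]) (simp_all add: isCont_def)
  then obtain \<delta>2 where d2: "\<delta>2 > 0" "\<And>u. \<bar>u\<bar> < \<delta>2 \<Longrightarrow> b * Q u < k1 / 2"
    unfolding eventually_nhds_metric by (auto simp: dist_real_def)
  define \<delta>0 where "\<delta>0 = min \<delta>1 (\<delta>2 / 2)"
  show ?thesis
  proof (intro exI[of _ \<delta>0] conjI allI impI)
    show "\<delta>0 > 0" using d1 d2 by (simp add: \<delta>0_def)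
    fix \<delta> :: real and G :: "nat \<Rightarrow> real \<Rightarrow> real" and g C c bad
    assume d: "0 < \<delta>" "\<delta> \<le> \<delta>0" and G: "\<forall>N. G N \<in> borel_measurable borel"
      and g[measurable]: "g \<in> borel_measurable borel" and bad: "finite bad"
      and Gg: "\<forall>w u. w \<notin> bad \<longrightarrow> u \<longlonglongrightarrow> w \<longrightarrow> (\<lambda>N. G N (m + u N / sqrt (real N))) \<longlonglongrightarrow> g w"
      and bound: "\<forall>N w. \<bar>w\<bar> \<le> \<delta> * sqrt (real N) \<longrightarrow> \<bar>G N (m + w / sqrt (real N))\<bar> \<le> C * exp (c * \<bar>w\<bar>)"
    have Gm[measurable]: "G N \<in> borel_measurable borel" for N using G by blast
    define R where "R = (\<lambda>u. b * ((m + u) ^ p - m ^ p - real p * m ^ (p - 1) * u))"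
    have R: "R u = b * Q u * u\<^sup>2" for u unfolding R_def Q(3) by simp
    have [measurable]: "R \<in> borel_measurable borel" unfolding R_def by measurable
    define F where "F = (\<lambda>N w. if \<bar>w\<bar> \<le> \<delta> * sqrt (real N)
      then exp (real N * R (w / sqrt (real N))) * G N (m + w / sqrt (real N)) else 0)"
    have C: "C \<ge> 0" using bound[rule_format, of 0 0] by auto
    have NR: "real N * R (w / sqrt (real N)) = b * Q (w / sqrt (real N)) * w\<^sup>2" if "N > 0" for N w
      unfolding R using that by (simp add: power_divide)
    have "(\<lambda>N. Bexp m N (\<lambda>x. F N (sqrt (real N) * (x - m)))) \<longlonglongrightarrow>
        (\<integral>z. exp (a * (sqrt (1 - m\<^sup>2) * z)\<^sup>2 / 2) * g (sqrt (1 - m\<^sup>2) * z) \<partial>gauss)"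
    proof (rule lim[where G = "\<lambda>w. exp (a * w\<^sup>2 / 2) * g w"])
      show "F N \<in> borel_measurable borel" for N unfolding F_def by measurable
      show "(\<lambda>w. exp (a * w\<^sup>2 / 2) * g w) \<in> borel_measurable borel" by measurable
      show "finite bad" by fact
    next
      fix w u assume wu: "w \<notin> bad" "u \<longlonglongrightarrow> w"
      have inv: "(\<lambda>N. 1 / sqrt (real N)) \<longlonglongrightarrow> 0" by real_asymp
      have u0: "(\<lambda>N. u N / sqrt (real N)) \<longlonglongrightarrow> 0"
        using tendsto_mult[OF wu(2) inv] by simp
      have "(\<lambda>N. exp (b * Q (u N / sqrt (real N)) * (u N)\<^sup>2) * G N (m + u N / sqrt (real N)))
         \<longlonglongrightarrow> exp (b * Q 0 * w\<^sup>2) * g w"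
        using Gg wu by (intro tendsto_intros isCont_tendsto_compose[OF Qcont] u0) auto
      also have "b * Q 0 * w\<^sup>2 = a * w\<^sup>2 / 2" unfolding Q(2) a_def by simp
      finally have *: "(\<lambda>N. exp (b * Q (u N / sqrt (real N)) * (u N)\<^sup>2) * G N (m + u N / sqrt (real N)))
         \<longlonglongrightarrow> exp (a * w\<^sup>2 / 2) * g w" .
      have "eventually (\<lambda>N. \<bar>u N / sqrt (real N)\<bar> < \<delta>) sequentially"
        using order_tendstoD(2)[OF tendsto_rabs[OF u0]] d by simp
      then have "eventually (\<lambda>N. exp (b * Q (u N / sqrt (real N)) * (u N)\<^sup>2) * G N (m + u N / sqrt (real N))
          = F N (u N)) sequentially"
        using eventually_gt_at_top[of "0::nat"]
      proof eventually_elim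
        fix N :: nat assume N: "\<bar>u N / sqrt (real N)\<bar> < \<delta>" "0 < N"
        then have "\<bar>u N\<bar> \<le> \<delta> * sqrt (real N)" by (simp add: abs_divide divide_less_eq)
        then show "exp (b * Q (u N / sqrt (real N)) * (u N)\<^sup>2) * G N (m + u N / sqrt (real N)) = F N (u N)"
          unfolding F_def NR[OF N(2)] by simp
      qed
      with * show "(\<lambda>N. F N (u N)) \<longlonglongrightarrow> exp (a * w\<^sup>2 / 2) * g w"
        by (rule Lim_transform_eventually)
    next
      fix N w
      show "\<bar>F N w\<bar> \<le> (if \<bar>w\<bar> \<le> \<delta>1 * sqrt (real N)
         then C * exp (c\<^sup>2 / (2 * (\<kappa> - k1))) * exp (\<kappa> * w\<^sup>2 / 2) else 0)"
      proof (cases "\<bar>w\<bar> \<le> \<delta> * sqrt (real N)")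
        case True
        also have "\<delta> * sqrt (real N) \<le> \<delta>1 * sqrt (real N)"
          using d by (intro mult_right_mono) (auto simp: \<delta>0_def)
        finally have w1: "\<bar>w\<bar> \<le> \<delta>1 * sqrt (real N)" .
        have "real N * R (w / sqrt (real N)) \<le> k1 * w\<^sup>2 / 2"
        proof (cases "N = 0")
          case False
          then have "\<bar>w / sqrt (real N)\<bar> \<le> \<delta>" using True by (simp add: abs_divide divide_le_eq)
          also have "\<delta> < \<delta>2" using d d2 by (simp add: \<delta>0_def)
          finally have "b * Q (w / sqrt (real N)) < k1 / 2" by (rule d2)
          then have "b * Q (w / sqrt (real N)) * w\<^sup>2 \<le> k1 / 2 * w\<^sup>2" by (intro mult_right_mono) auto
          then show ?thesis using NR[of N w] False by simp
        qed (use k1 in auto)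
        then have "exp (real N * R (w / sqrt (real N))) * \<bar>G N (m + w / sqrt (real N))\<bar>
          \<le> exp (k1 * w\<^sup>2 / 2) * (C * exp (c * \<bar>w\<bar>))"
          using bound True by (intro mult_mono) auto
        also have "\<dots> = C * exp (k1 * w\<^sup>2 / 2 + c * \<bar>w\<bar>)" by (simp add: exp_add)
        also have "\<dots> \<le> C * (exp (c\<^sup>2 / (2 * (\<kappa> - k1))) * exp (\<kappa> * w\<^sup>2 / 2))"
          by (intro mult_left_mono exp_linear_le_exp_square k1 C)
        finally show ?thesis using True w1 by (simp add: F_def abs_mult mult.assoc)
      qed (use C in \<open>auto simp: F_def\<close>)
    qed
    also have "(\<integral>z. exp (a * (sqrt (1 - m\<^sup>2) * z)\<^sup>2 / 2) * g (sqrt (1 - m\<^sup>2) * z) \<partial>gauss)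
      = (\<integral>z. exp ((a * v) * z\<^sup>2 / 2) * g (sqrt v * z) \<partial>gauss)"
      using v unfolding v_def[symmetric] by (simp add: power_mult_distrib mult_ac)
    also have "\<dots> = peak_int b p m g"
      using std_normal_exp_square_integral[OF av, of "\<lambda>z. g (sqrt v * z)"]
      by (simp add: peak_weight_def peak_sd_def curv_av v_def mult.assoc)
    finally have L: "(\<lambda>N. Bexp m N (\<lambda>x. F N (sqrt (real N) * (x - m)))) \<longlonglongrightarrow>
       peak_int b p m g" .
    have "eventually (\<lambda>N. Bexp m N (\<lambda>x. F N (sqrt (real N) * (x - m)))
      = peak_sum b h p G m (Hfun b h p m) \<delta> N) sequentially"
      using eventually_gt_at_top[of "0::nat"]
    proof eventually_elim
      fix N :: nat assume N: "N > 0"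
      show "Bexp m N (\<lambda>x. F N (sqrt (real N) * (x - m)))
        = peak_sum b h p G m (Hfun b h p m) \<delta> N"
        unfolding Bexp_def
      proof (rule sum.cong)
        fix x assume x: "x \<in> configs N"
        have r: "sqrt (real N) * (xbar N x - m) / sqrt (real N) = xbar N x - m" using N by simp
        have le: "\<bar>sqrt (real N) * (xbar N x - m)\<bar> \<le> \<delta> * sqrt (real N) \<longleftrightarrow> \<bar>xbar N x - m\<bar> \<le> \<delta>"
          using N by (simp add: abs_mult mult.commute)
        show "(\<Prod>i<N. (1 + m * x i) / 2) * F N (sqrt (real N) * (xbar N x - m))
          = (if \<bar>xbar N x - m\<bar> \<le> \<delta>
             then cw_weight b h p N x * G N (xbar N x) / (2 ^ N * exp (real N * Hfun b h p m)) else 0)"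
        proof (cases "\<bar>xbar N x - m\<bar> \<le> \<delta>")
          case True
          have "cw_weight b h p N x * G N (xbar N x) / (2 ^ N * exp (real N * Hfun b h p m))
             = cw_weight b h p N x / (2 ^ N * exp (real N * Hfun b h p m)) * G N (xbar N x)" by simp
          also have "\<dots> = (\<Prod>i<N. (1 + m * x i) / 2) * F N (sqrt (real N) * (xbar N x - m))"
            unfolding cw_weight_tilt[OF m x] F_def le r R_def using True by simp
          finally show ?thesis using True by simp
        next
          case False
          then show ?thesis unfolding F_def le by simp
        qed
      qed simp
    qed
    with L show "peak_sum b h p G m (Hfun b h p m) \<delta>
     \<longlonglongrightarrow> peak_int b p m g"
      by (rule Lim_transform_eventually)
  qed
qed

section \<open>From single peaks to the whole partition sum\<close>

lemma continuous_on_x_ln_x: "continuous_on {0..} (\<lambda>x::real. x * ln x)"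
  unfolding continuous_on_def
proof
  fix x :: real assume x: "x \<in> {0..}"
  show "((\<lambda>x. x * ln x) \<longlongrightarrow> x * ln x) (at x within {0..})"
  proof (cases "x = 0")
    case True
    have "((\<lambda>x::real. x * ln x) \<longlongrightarrow> 0) (at_right 0)" by real_asymp
    then show ?thesis using True by (simp add: at_within_Ici_at_right)
  next
    case False
    then show ?thesis using x by (intro tendsto_intros) auto
  qed
qed

lemma continuous_on_Hfun: "continuous_on {-1..1} (Hfun b h p)"
proof -
  have *: "continuous_on {-1..1} (\<lambda>x::real. (1 + c * x) * ln (1 + c * x))" if "\<bar>c\<bar> = 1" for c
    by (rule continuous_on_compose2[OF continuous_on_x_ln_x])
      (use that in \<open>auto intro!: continuous_intros simp: abs_if split: if_splits\<close>)
  have "continuous_on {-1..1} (\<lambda>x. b * x ^ p + h * x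
      - ((1 + 1 * x) * ln (1 + 1 * x) + (1 + (-1) * x) * ln (1 + (-1) * x)) / 2)"
    by (intro continuous_on_diff continuous_on_add continuous_on_mult continuous_on_power
        continuous_on_divide continuous_on_const continuous_on_id *) auto
  then show ?thesis by (simp add: Hfun_def Ient_def cong: continuous_on_cong)
qed

text \<open>The behaviour of \<open>G N\<close> seen at distance w / sqrt N from m, in the form that
  the local Laplace lemma consumes. The exceptional set is meant for jumps of indicators, the
  exponential growth for tilts of size t / sqrt N in the inverse temperature.\<close>

definition gauss_local :: "(nat \<Rightarrow> real \<Rightarrow> real) \<Rightarrow> real \<Rightarrow> (real \<Rightarrow> real) \<Rightarrow> bool" where
  "gauss_local G m g \<longleftrightarrow> g \<in> borel_measurable borel \<and>
    (\<exists>bad. finite bad \<and>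
       (\<forall>w u. w \<notin> bad \<longrightarrow> u \<longlonglongrightarrow> w \<longrightarrow> (\<lambda>N. G N (m + u N / sqrt (real N))) \<longlonglongrightarrow> g w)) \<and>
    (\<exists>\<delta>>0. \<exists>C c. \<forall>N w. \<bar>w\<bar> \<le> \<delta> * sqrt (real N) \<longrightarrow> \<bar>G N (m + w / sqrt (real N))\<bar> \<le> C * exp (c * \<bar>w\<bar>))"

lemma finite_separated:
  assumes "finite (S :: real set)"
  shows "\<exists>\<eta>>0. \<forall>x\<in>S. \<forall>y\<in>S. x \<noteq> y \<longrightarrow> 2 * \<eta> < \<bar>x - y\<bar>"
proof -
  \<comment> \<open>The element 1 keeps the minimum meaningful when \<open>S\<close> has fewer than
    two points; the divisor 3 makes the separation by twice the minimum strict.\<close>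
  define D where "D = insert 1 ((\<lambda>(x, y). \<bar>x - y\<bar> / 3) ` {(x, y). x \<in> S \<and> y \<in> S \<and> x \<noteq> y})"
  have "finite {(x, y). x \<in> S \<and> y \<in> S \<and> x \<noteq> y}"
    by (rule finite_subset[of _ "S \<times> S"]) (use assms in auto)
  then have fin: "finite D" unfolding D_def by simp
  have "Min D > 0" using fin by (subst Min_gr_iff) (auto simp: D_def)
  moreover have "2 * Min D < \<bar>x - y\<bar>" if "x \<in> S" "y \<in> S" "x \<noteq> y" for x y
  proof -
    have "Min D \<le> \<bar>x - y\<bar> / 3" by (rule Min_le[OF fin]) (use that in \<open>auto simp: D_def\<close>)
    then show ?thesis using that by (simp add: \<open>Min D > 0\<close>)
  qed
  ultimately show ?thesis by blast
qed

lemma cw_laplace: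
  assumes fin: "finite (maximizers b h p)"
    and Hmax: "\<And>m. m \<in> maximizers b h p \<Longrightarrow> Hfun b h p m = Hm"
    and ne: "maximizers b h p \<noteq> {}"
    and nondeg: "\<And>m. m \<in> maximizers b h p \<Longrightarrow> \<bar>m\<bar> < 1 \<and> artanh m = h + b * real p * m ^ (p - 1) \<and> curv b p m > 0"
    and G: "\<And>N. G N \<in> borel_measurable borel"
    and loc: "\<And>m. m \<in> maximizers b h p \<Longrightarrow> gauss_local G m (g m)"
    and glob: "\<And>N x. \<bar>x\<bar> \<le> 1 \<Longrightarrow> \<bar>G N x\<bar> \<le> C * exp (c * sqrt (real N))"
  shows "(\<lambda>N. (\<Sum>x\<in>configs N. cw_weight b h p N x * G N (xbar N x)) / (2 ^ N * exp (real N * Hm)))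
    \<longlonglongrightarrow> (\<Sum>m\<in>maximizers b h p. peak_int b p m (g m))"
proof -
  let ?M = "maximizers b h p"
  define Lim where "Lim = (\<lambda>m \<delta>. peak_sum b h p G m Hm \<delta>
     \<longlonglongrightarrow> peak_int b p m (g m))"
  have ex: "\<exists>\<delta>0>0. \<forall>\<delta>. 0 < \<delta> \<longrightarrow> \<delta> \<le> \<delta>0 \<longrightarrow> Lim m \<delta>"
    if m: "m \<in> ?M" for m
  proof -
    from loc[OF m] obtain bad \<delta>1 C1 c1 where gm: "g m \<in> borel_measurable borel" and bad: "finite bad"
      and lim: "\<And>w u. w \<notin> bad \<Longrightarrow> u \<longlonglongrightarrow> w \<Longrightarrow> (\<lambda>N. G N (m + u N / sqrt (real N))) \<longlonglongrightarrow> g m w"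
      and d1: "\<delta>1 > 0" and bd: "\<And>N w. \<bar>w\<bar> \<le> \<delta>1 * sqrt (real N) \<Longrightarrow> \<bar>G N (m + w / sqrt (real N))\<bar> \<le> C1 * exp (c1 * \<bar>w\<bar>)"
      unfolding gauss_local_def by blast
    have nd: "\<bar>m\<bar> < 1" "artanh m = h + b * real p * m ^ (p - 1)" "curv b p m > 0"
      using nondeg[OF m] by auto
    obtain \<delta>2 where d2: "\<delta>2 > 0" and L: "\<forall>\<delta> G g C c bad. 0 < \<delta> \<longrightarrow> \<delta> \<le> \<delta>2 \<longrightarrow>
     (\<forall>N. G N \<in> borel_measurable borel) \<longrightarrow> g \<in> borel_measurable borel \<longrightarrow> finite bad \<longrightarrow>
     (\<forall>w u. w \<notin> bad \<longrightarrow> u \<longlonglongrightarrow> w \<longrightarrow> (\<lambda>N. G N (m + u N / sqrt (real N))) \<longlonglongrightarrow> g w) \<longrightarrow>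
     (\<forall>N w. \<bar>w\<bar> \<le> \<delta> * sqrt (real N) \<longrightarrow> \<bar>G N (m + w / sqrt (real N))\<bar> \<le> C * exp (c * \<bar>w\<bar>)) \<longrightarrow>
     peak_sum b h p G m (Hfun b h p m) \<delta>
     \<longlonglongrightarrow> peak_int b p m g"
      using cw_peak_laplace[OF nd] by (elim exE conjE) (rule that)
    show ?thesis
    proof (intro exI[of _ "min \<delta>1 \<delta>2"] conjI allI impI)
      show "min \<delta>1 \<delta>2 > 0" using d1 d2 by simp
      fix \<delta> assume d: "0 < \<delta>" "\<delta> \<le> min \<delta>1 \<delta>2"
      have "\<bar>G N (m + w / sqrt (real N))\<bar> \<le> C1 * exp (c1 * \<bar>w\<bar>)" if "\<bar>w\<bar> \<le> \<delta> * sqrt (real N)" for N w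
      proof (rule bd)
        have "\<delta> * sqrt (real N) \<le> \<delta>1 * sqrt (real N)" using d by (intro mult_right_mono) auto
        then show "\<bar>w\<bar> \<le> \<delta>1 * sqrt (real N)" using that by linarith
      qed
      then show "Lim m \<delta>"
        unfolding Lim_def Hmax[OF m, symmetric]
        by (intro L[rule_format, of \<delta> G "g m" bad C1 c1]) (use d G gm bad lim in auto)
    qed
  qed
  then have "\<forall>m\<in>?M. \<exists>\<delta>0. \<delta>0 > 0 \<and> (\<forall>\<delta>. 0 < \<delta> \<longrightarrow> \<delta> \<le> \<delta>0 \<longrightarrow> Lim m \<delta>)" by blast
  from bchoice[OF this] obtain d0 where
    d0': "\<forall>m\<in>?M. d0 m > 0 \<and> (\<forall>\<delta>. 0 < \<delta> \<longrightarrow> \<delta> \<le> d0 m \<longrightarrow> Lim m \<delta>)" ..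
  then have d0: "\<And>m. m \<in> ?M \<Longrightarrow> d0 m > 0" by blast
  have lim0: "peak_sum b h p G m Hm \<delta>
     \<longlonglongrightarrow> peak_int b p m (g m)"
    if "m \<in> ?M" "0 < \<delta>" "\<delta> \<le> d0 m" for m \<delta>
    using d0' that unfolding Lim_def by blast
  obtain \<eta> where eta: "\<eta> > 0" "\<And>x y. x \<in> ?M \<Longrightarrow> y \<in> ?M \<Longrightarrow> x \<noteq> y \<Longrightarrow> 2 * \<eta> < \<bar>x - y\<bar>"
    using finite_separated[OF fin] by blast
  define \<delta> where "\<delta> = Min (insert \<eta> (d0 ` ?M))"
  have d: "\<delta> > 0" "\<delta> \<le> \<eta>" "\<And>m. m \<in> ?M \<Longrightarrow> \<delta> \<le> d0 m"
    unfolding \<delta>_def using fin eta d0 by auto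
  have disj: "m = m'" if "m \<in> ?M" "m' \<in> ?M" "\<bar>y - m\<bar> \<le> \<delta>" "\<bar>y - m'\<bar> \<le> \<delta>" for m m' y
    using eta(2)[OF that(1,2)] that(3,4) d(2) by linarith
  \<comment> \<open>The weak inequality makes \<open>K\<close> closed; the magnetizations left over
    by the closed neighbourhoods satisfy the strict one and so lie in \<open>K\<close>.\<close>
  define K where "K = {y \<in> {-1..1}. \<forall>m\<in>?M. \<delta> \<le> \<bar>y - m\<bar>}"
  have "\<exists>s<Hm. \<forall>y\<in>K. Hfun b h p y \<le> s"
  proof (cases "K = {}")
    case True
    then show ?thesis using lt_ex by auto
  next
    case False
    have "K = {-1..1} \<inter> (\<Inter>m\<in>?M. {y. \<delta> \<le> \<bar>y - m\<bar>})" by (auto simp: K_def)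
    moreover have "closed (\<Inter>m\<in>?M. {y. \<delta> \<le> \<bar>y - m\<bar>})"
      by (intro closed_INT ballI closed_Collect_le continuous_intros)
    ultimately have "compact K" by (simp add: compact_Int_closed)
    moreover have "continuous_on K (Hfun b h p)"
      by (rule continuous_on_subset[OF continuous_on_Hfun]) (auto simp: K_def)
    ultimately obtain y0 where y0: "y0 \<in> K" "\<And>y. y \<in> K \<Longrightarrow> Hfun b h p y \<le> Hfun b h p y0"
      using continuous_attains_sup[of K "Hfun b h p"] False by auto
    obtain m where m: "m \<in> ?M" using ne by blast
    have le: "Hfun b h p y \<le> Hm" if "y \<in> {-1..1}" for y
      using m Hmax[OF m] that by (auto simp: maximizers_def)
    have "Hfun b h p y0 \<noteq> Hm"
    proof
      assume "Hfun b h p y0 = Hm"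
      then have "y0 \<in> ?M" using y0 le by (auto simp: maximizers_def K_def)
      then show False using y0(1) d(1) by (auto simp: K_def)
    qed
    then have "Hfun b h p y0 < Hm" using le[of y0] y0(1) by (auto simp: K_def)
    then show ?thesis using y0 by blast
  qed
  then obtain s where s: "s < Hm" "\<And>y. y \<in> K \<Longrightarrow> Hfun b h p y \<le> s" by blast
  \<comment> \<open>A positive exponent is wanted only to fix the sign for the asymptotic comparison
    below.\<close>
  define c' where "c' = \<bar>c\<bar> + 1"
  have c': "c' > 0" by (simp add: c'_def)
  have glob': "\<bar>G N x\<bar> \<le> C * exp (c' * sqrt (real N))" if "\<bar>x\<bar> \<le> 1" for N x
  proof -
    have "C \<ge> 0" using glob[of 0 0] by simp
    moreover have "c * sqrt (real N) \<le> c' * sqrt (real N)" by (intro mult_right_mono) (auto simp: c'_def)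
    ultimately show ?thesis using glob[OF that, of N]
      by (smt (verit) exp_le_cancel_iff mult_left_mono)
  qed
  define T where "T = (\<lambda>N x. cw_weight b h p N x * G N (xbar N x) / (2 ^ N * exp (real N * Hm)))"
  define rest where "rest = (\<lambda>N. \<Sum>x\<in>configs N. if \<forall>m\<in>?M. \<delta> < \<bar>xbar N x - m\<bar> then T N x else 0)"
  have C: "C \<ge> 0" using glob[of 0 0] by simp
  have rest0: "rest \<longlonglongrightarrow> 0"
  proof (rule Lim_null_comparison)
    show "eventually (\<lambda>N. norm (rest N) \<le> C * exp (c' * sqrt (real N)) * (real (N + 1) * exp (- (Hm - s) * real N))) sequentially"
      using eventually_gt_at_top[of "0::nat"]
    proof eventually_elim
      fix N :: nat assume N: "N > 0"
      have w0: "0 \<le> cw_weight b h p N x" for x by (simp add: cw_weight_def)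
      have "norm (rest N) \<le> (\<Sum>x\<in>configs N. \<bar>if \<forall>m\<in>?M. \<delta> < \<bar>xbar N x - m\<bar> then T N x else 0\<bar>)"
        unfolding rest_def by (simp add: sum_abs)
      also have "\<dots> \<le> (\<Sum>x\<in>configs N. if xbar N x \<in> K then
         C * exp (c' * sqrt (real N)) / (2 ^ N * exp (real N * Hm)) * cw_weight b h p N x else 0)"
      proof (rule sum_mono)
        fix x assume x: "x \<in> configs N"
        show "\<bar>if \<forall>m\<in>?M. \<delta> < \<bar>xbar N x - m\<bar> then T N x else 0\<bar> \<le> (if xbar N x \<in> K then
         C * exp (c' * sqrt (real N)) / (2 ^ N * exp (real N * Hm)) * cw_weight b h p N x else 0)"
        proof (cases "\<forall>m\<in>?M. \<delta> < \<bar>xbar N x - m\<bar>")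
          case True
          have x1: "\<bar>xbar N x\<bar> \<le> 1" by (rule abs_xbar_le_1[OF x])
          then have K: "xbar N x \<in> K" using True by (force simp: K_def)
          have "\<bar>T N x\<bar> = \<bar>G N (xbar N x)\<bar> * (cw_weight b h p N x / (2 ^ N * exp (real N * Hm)))"
            unfolding T_def using w0[of x] by (simp add: abs_mult)
          also have "\<dots> \<le> C * exp (c' * sqrt (real N)) * (cw_weight b h p N x / (2 ^ N * exp (real N * Hm)))"
            by (intro mult_right_mono glob' x1) (use w0 in auto)
          finally show ?thesis using True K by (simp add: mult_ac)
        next
          case False
          show ?thesis unfolding if_not_P[OF False] using C w0[of x] by simp
        qed
      qed
      also have "\<dots> = C * exp (c' * sqrt (real N)) / (2 ^ N * exp (real N * Hm)) *
          (\<Sum>x | x \<in> configs N \<and> xbar N x \<in> K. cw_weight b h p N x)"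
        by (simp add: sum.inter_filter[symmetric] sum_distrib_left)
      also have "\<dots> \<le> C * exp (c' * sqrt (real N)) / (2 ^ N * exp (real N * Hm)) *
          (real (N + 1) * (2 ^ N * exp (real N * s)))"
        by (intro mult_left_mono cw_weight_sum_le N s) (use C in auto)
      also have "\<dots> = C * exp (c' * sqrt (real N)) * (real (N + 1) * (exp (real N * s) / exp (real N * Hm)))"
        by simp
      also have "exp (real N * s) / exp (real N * Hm) = exp (- (Hm - s) * real N)"
        by (simp add: exp_diff[symmetric] algebra_simps)
      finally show "norm (rest N) \<le> C * exp (c' * sqrt (real N)) * (real (N + 1) * exp (- (Hm - s) * real N))" .
    qed
    define e where "e = Hm - s"
    have "e > 0" using s by (simp add: e_def)
    then have "(\<lambda>N::nat. exp (c' * sqrt (real N)) * (real (N + 1) * exp (- e * real N))) \<longlonglongrightarrow> 0"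
      using c' by real_asymp
    from tendsto_mult_left[OF this, of C]
    show "(\<lambda>N. C * exp (c' * sqrt (real N)) * (real (N + 1) * exp (- (Hm - s) * real N))) \<longlonglongrightarrow> 0"
      unfolding e_def by (simp add: mult.assoc)
  qed
  have split: "(\<Sum>x\<in>configs N. cw_weight b h p N x * G N (xbar N x)) / (2 ^ N * exp (real N * Hm))
     = (\<Sum>m\<in>?M. \<Sum>x\<in>configs N. if \<bar>xbar N x - m\<bar> \<le> \<delta> then T N x else 0) + rest N" for N
  proof -
    have "T N x = (\<Sum>m\<in>?M. if \<bar>xbar N x - m\<bar> \<le> \<delta> then T N x else 0)
       + (if \<forall>m\<in>?M. \<delta> < \<bar>xbar N x - m\<bar> then T N x else 0)" for x
    proof (cases "\<exists>m\<in>?M. \<bar>xbar N x - m\<bar> \<le> \<delta>")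
      case True
      then obtain m where m: "m \<in> ?M" "\<bar>xbar N x - m\<bar> \<le> \<delta>" by blast
      have "(\<Sum>m'\<in>?M. if \<bar>xbar N x - m'\<bar> \<le> \<delta> then T N x else 0) = (\<Sum>m'\<in>?M. if m' = m then T N x else 0)"
        using m disj by (intro sum.cong) auto
      then show ?thesis using m fin by (auto simp: not_less[symmetric])
    next
      case False
      then show ?thesis by (auto simp: not_le intro!: sum.neutral)
    qed
    then have "(\<Sum>x\<in>configs N. T N x) = (\<Sum>x\<in>configs N. (\<Sum>m\<in>?M. if \<bar>xbar N x - m\<bar> \<le> \<delta> then T N x else 0)
       + (if \<forall>m\<in>?M. \<delta> < \<bar>xbar N x - m\<bar> then T N x else 0))" by (intro sum.cong) auto
    also have "\<dots> = (\<Sum>m\<in>?M. \<Sum>x\<in>configs N. if \<bar>xbar N x - m\<bar> \<le> \<delta> then T N x else 0) + rest N"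
      unfolding rest_def sum.distrib by (subst sum.swap) simp
    finally show ?thesis unfolding T_def by (simp add: sum_divide_distrib)
  qed
  have "(\<lambda>N. (\<Sum>m\<in>?M. \<Sum>x\<in>configs N. if \<bar>xbar N x - m\<bar> \<le> \<delta> then T N x else 0) + rest N)
    \<longlonglongrightarrow> (\<Sum>m\<in>?M. peak_int b p m (g m)) + 0"
    unfolding T_def by (intro tendsto_add tendsto_sum lim0 d rest0)
  then show ?thesis unfolding split by simp
qed

section \<open>Maximizers of H\<close>

definition dHfun :: "real \<Rightarrow> real \<Rightarrow> nat \<Rightarrow> real \<Rightarrow> real" where
  "dHfun b h p x = h + b * real p * x ^ (p - 1) - artanh x"

definition ddHfun :: "real \<Rightarrow> nat \<Rightarrow> real \<Rightarrow> real" where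
  "ddHfun b p x = b * real p * (real p - 1) * x ^ (p - 2) - 1 / (1 - x\<^sup>2)"

lemma artanh_eq_ln: "\<bar>x\<bar> < 1 \<Longrightarrow> artanh x = (ln (1 + x) - ln (1 - x)) / 2" for x :: real
proof -
  assume "\<bar>x\<bar> < 1"
  then have "1 + x > 0" "1 - x > 0" by auto
  then show ?thesis by (simp add: artanh_def ln_div)
qed

lemma has_derivative_Hfun:
  assumes "\<bar>x\<bar> < 1"
  shows "(Hfun b h p has_real_derivative dHfun b h p x) (at x)"
proof -
  have x: "1 + x > 0" "1 - x > 0" using assms by auto
  have "((\<lambda>x. b * x ^ p + h * x - ((1 + x) * ln (1 + x) + (1 - x) * ln (1 - x)) / 2) has_real_derivative
    (b * (real p * x ^ (p - 1)) + h - ((ln (1 + x) + 1) + (- ln (1 - x) - 1)) / 2)) (at x)"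
    using x by (auto intro!: derivative_eq_intros simp: divide_simps)
  moreover have "b * (real p * x ^ (p - 1)) + h - ((ln (1 + x) + 1) + (- ln (1 - x) - 1)) / 2 = dHfun b h p x"
    unfolding dHfun_def artanh_eq_ln[OF assms] by (simp add: field_simps)
  moreover have "Hfun b h p = (\<lambda>x. b * x ^ p + h * x - ((1 + x) * ln (1 + x) + (1 - x) * ln (1 - x)) / 2)"
    by (simp add: Hfun_def Ient_def fun_eq_iff)
  ultimately show ?thesis by simp
qed

lemma has_derivative_dHfun:
  assumes "\<bar>x\<bar> < 1" "p \<ge> 1"
  shows "(dHfun b h p has_real_derivative ddHfun b p x) (at x)"
proof -
  have p: "real (p - Suc 0) = real p - 1" using assms(2) by simp
  have "((\<lambda>x. h + b * real p * x ^ (p - 1) - artanh x) has_real_derivative ddHfun b p x) (at x)"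
    using assms(1) p by (auto intro!: derivative_eq_intros simp: numeral_2_eq_2 ddHfun_def)
  then show ?thesis by (simp add: dHfun_def[abs_def])
qed

lemma deriv_deriv_Hfun:
  assumes "\<bar>x\<bar> < 1" "p \<ge> 1"
  shows "deriv (deriv (Hfun b h p)) x = ddHfun b p x"
proof -
  have ev: "eventually (\<lambda>y. y \<in> {-1<..<1}) (nhds x)"
    by (rule eventually_nhds_in_open) (use assms in auto)
  have "eventually (\<lambda>y. deriv (Hfun b h p) y = dHfun b h p y) (nhds x)"
    using ev by eventually_elim (auto intro!: DERIV_imp_deriv has_derivative_Hfun)
  then have "deriv (deriv (Hfun b h p)) x = deriv (dHfun b h p) x"
    by (rule deriv_cong_ev) simp
  also have "\<dots> = ddHfun b p x" by (intro DERIV_imp_deriv has_derivative_dHfun assms)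
  finally show ?thesis .
qed

lemma curv_eq:
  assumes "\<bar>x\<bar> < 1" shows "curv b p x = (x\<^sup>2 - 1) * ddHfun b p x"
proof -
  have "1 - x\<^sup>2 > 0" using assms by (simp add: abs_square_less_1)
  then show ?thesis unfolding curv_def ddHfun_def by (simp add: field_simps)
qed

text \<open>The logarithmic singularity of artanh at 1 makes H' negative just below 1, whatever the
  coefficients. The mean value theorem then gives a larger value of H to the left of the
  endpoint.\<close>

lemma Hfun_not_max_at_1: "\<exists>y\<in>{-1..1}. Hfun b h p 1 < Hfun b h p y"
proof -
  define C where "C = \<bar>b\<bar> * real p + \<bar>h\<bar>"
  have C: "C \<ge> 0" by (simp add: C_def)
  \<comment> \<open>C bounds the polynomial part of H'. For z beyond y, -ln(1 - z) exceeds 2 C + 1,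
    hence artanh z exceeds C.\<close>
  define y where "y = 1 - exp (- (2 * C + 1))"
  have y: "0 \<le> y" "y < 1" using C by (auto simp: y_def)
  have "\<exists>l z. y < z \<and> z < 1 \<and> (Hfun b h p has_real_derivative l) (at z) \<and> Hfun b h p 1 - Hfun b h p y = (1 - y) * l"
  proof (rule MVT)
    show "continuous_on {y..1} (Hfun b h p)"
      by (rule continuous_on_subset[OF continuous_on_Hfun]) (use y in auto)
    show "Hfun b h p differentiable at x" if "y < x" "x < 1" for x
      using has_derivative_Hfun[of x b h p] that y by (auto simp: real_differentiable_def)
  qed (use y in auto)
  then obtain l z where z: "y < z" "z < 1" and l: "(Hfun b h p has_real_derivative l) (at z)"
    "Hfun b h p 1 - Hfun b h p y = (1 - y) * l" by blast
  have z1: "\<bar>z\<bar> < 1" using z y by auto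
  have "l = dHfun b h p z" using DERIV_unique[OF l(1) has_derivative_Hfun[OF z1]] .
  also have "\<dots> < 0"
  proof -
    have "ln (1 - z) < ln (exp (- (2 * C + 1)))" using z by (subst ln_less_cancel_iff) (auto simp: y_def)
    then have "ln (1 - z) < - (2 * C + 1)" by simp
    moreover have "ln (1 + z) \<ge> 0" using z y by (intro ln_ge_zero) auto
    ultimately have "artanh z > C" using artanh_eq_ln[OF z1] by simp
    moreover have "b * real p * z ^ (p - 1) \<le> \<bar>b\<bar> * real p * 1"
    proof -
      have "\<bar>b * real p * z ^ (p - 1)\<bar> \<le> \<bar>b\<bar> * real p * 1"
        unfolding abs_mult using z1 by (intro mult_mono) (auto simp: power_abs intro: power_le_one)
      then show ?thesis by linarith
    qed
    ultimately show ?thesis unfolding dHfun_def C_def by linarith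
  qed
  finally have "(1 - y) * l < 0" using y by (intro mult_pos_neg) auto
  then have "Hfun b h p 1 < Hfun b h p y" using l(2) by simp
  then show ?thesis using y by (intro bexI[of _ y]) auto
qed

lemma Hfun_minus: "Hfun b h p (- x) = Hfun (b * (-1) ^ p) (- h) p x"
  by (simp add: Hfun_def Ient_def power_minus[of x] add.commute)

lemma maximizers_max: "m \<in> maximizers b h p \<Longrightarrow> \<bar>y\<bar> \<le> 1 \<Longrightarrow> Hfun b h p y \<le> Hfun b h p m"
proof -
  assume m: "m \<in> maximizers b h p" and "\<bar>y\<bar> \<le> 1"
  then have "y \<in> {-1..1}" by auto
  then show ?thesis using m by (simp add: maximizers_def)
qed

lemma maximizers_interior:
  assumes "m \<in> maximizers b h p" shows "\<bar>m\<bar> < 1"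
proof -
  have "m \<noteq> 1" using Hfun_not_max_at_1[of b h p] assms by (force simp: maximizers_def)
  moreover have "m \<noteq> -1"
  proof
    assume "m = -1"
    obtain y where y: "y \<in> {-1..1}" "Hfun (b * (-1) ^ p) (- h) p 1 < Hfun (b * (-1) ^ p) (- h) p y"
      using Hfun_not_max_at_1 by blast
    then have "Hfun b h p (-1) < Hfun b h p (- y)" using Hfun_minus[of b h p 1] Hfun_minus[of b h p y] by simp
    moreover have "\<bar>- y\<bar> \<le> 1" using y(1) by auto
    ultimately show False using maximizers_max[OF assms, of "- y"] \<open>m = -1\<close> by simp
  qed
  ultimately show ?thesis using assms by (auto simp: maximizers_def)
qed

lemma maximizers_eq: "m \<in> maximizers b h p \<Longrightarrow> m' \<in> maximizers b h p \<Longrightarrow> Hfun b h p m = Hfun b h p m'"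
  by (rule antisym) (auto simp: maximizers_def)

lemma dHfun_maximizer:
  assumes "m \<in> maximizers b h p" shows "dHfun b h p m = 0"
proof -
  have m: "\<bar>m\<bar> < 1" by (rule maximizers_interior[OF assms])
  show ?thesis
  proof (rule DERIV_local_max[OF has_derivative_Hfun[OF m]])
    show "0 < 1 - \<bar>m\<bar>" using m by simp
    show "\<forall>y. \<bar>m - y\<bar> < 1 - \<bar>m\<bar> \<longrightarrow> Hfun b h p y \<le> Hfun b h p m"
      using maximizers_max[OF assms] by (auto simp: abs_if split: if_splits)
  qed
qed

lemma artanh_maximizer: "m \<in> maximizers b h p \<Longrightarrow> artanh m = h + b * real p * m ^ (p - 1)"
  using dHfun_maximizer by (fastforce simp: dHfun_def)

text \<open>Otherwise H' would increase through its zero at m and be positive just to the right, so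
  H would exceed its maximum there.\<close>

lemma ddHfun_maximizer_le_0:
  assumes "m \<in> maximizers b h p" "p \<ge> 1" shows "ddHfun b p m \<le> 0"
proof (rule ccontr)
  assume "\<not> ddHfun b p m \<le> 0"
  then have pos: "ddHfun b p m > 0" by simp
  have m: "\<bar>m\<bar> < 1" by (rule maximizers_interior[OF assms(1)])
  obtain d where d: "d > 0" "\<And>k. 0 < k \<Longrightarrow> k < d \<Longrightarrow> dHfun b h p m < dHfun b h p (m + k)"
    using DERIV_pos_inc_right[OF has_derivative_dHfun[OF m assms(2)] pos] by blast
  define k where "k = min (d / 2) ((1 - m) / 2)"
  have k: "0 < k" "k < d" "m + k < 1" using d m by (auto simp: k_def min_def field_simps)
  obtain z where z: "m < z" "z < m + k" "Hfun b h p (m + k) - Hfun b h p m = (m + k - m) * dHfun b h p z"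
    using MVT2[of m "m + k" "Hfun b h p" "dHfun b h p"] k m has_derivative_Hfun by (auto simp: abs_if split: if_splits)
  have "dHfun b h p z > 0" using d(2)[of "z - m"] z k dHfun_maximizer[OF assms(1)] by simp
  then have "Hfun b h p (m + k) > Hfun b h p m" using z k by (smt (verit) mult_pos_pos)
  moreover have "\<bar>m + k\<bar> \<le> 1" using k m by linarith
  ultimately show False using maximizers_max[OF assms(1), of "m + k"] by simp
qed

section \<open>Counting maximizers by Rolle's theorem\<close>

lemma dHfun_rolle:
  assumes "-1 < x" "x < y" "y < 1" "dHfun b h p x = 0" "dHfun b h p y = 0" "p \<ge> 1"
  obtains z where "x < z" "z < y" "ddHfun b p z = 0"
proof -
  obtain z where z: "x < z" "z < y" "dHfun b h p y - dHfun b h p x = (y - x) * ddHfun b p z"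
    using MVT2[of x y "dHfun b h p" "ddHfun b p"] assms has_derivative_dHfun by auto
  then show thesis using that[of z] assms by auto
qed

lemma maximizers_rolle:
  assumes "x \<in> maximizers b h p" "y \<in> maximizers b h p" "x < y"
  obtains z where "x < z" "z < y" "dHfun b h p z = 0"
proof -
  have xy: "\<bar>x\<bar> < 1" "\<bar>y\<bar> < 1" using assms maximizers_interior by blast+
  obtain z where z: "x < z" "z < y" "Hfun b h p y - Hfun b h p x = (y - x) * dHfun b h p z"
    using MVT2[of x y "Hfun b h p" "dHfun b h p"] assms(3) xy has_derivative_Hfun by auto
  then show thesis using that[of z] maximizers_eq[OF assms(1,2)] assms(3) by auto
qed

text \<open>Zeros of H'' are the points where c f(u) = 1 with f(u) = u^(p-2) - u^p. Three equal
  values of f force two zeros of f' strictly between them, but on the positive axis f' vanishes only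
  where p u^2 = p - 2. For odd p, f is not positive on the negative axis, so all zeros of H'' are
  positive anyway; for even p they come in symmetric pairs, which is why the restriction
  \<open>0 \<le> x\<close> appears.\<close>

lemma ddHfun_three_zeros:
  assumes p: "p \<ge> 3" and b: "b \<ge> 0" and lt: "-1 < x" "x < y" "y < z" "z < 1"
    and zero: "ddHfun b p x = 0" "ddHfun b p y = 0" "ddHfun b p z = 0"
    and dom: "0 \<le> x \<or> odd p"
  shows False
proof -
  \<comment> \<open>With p = q + 3 the exponents p - 2 and p - 3 of f and f' become q + 1 and q,
    free of truncated subtraction.\<close>
  obtain q where q: "p = q + 3" using p by (metis le_add_diff_inverse2)
  define c where "c = b * real p * (real p - 1)"
  define f where "f = (\<lambda>u::real. u ^ (q + 1) - u ^ (q + 3))"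
  have c0: "c \<ge> 0" using b p by (simp add: c_def)
  have eq1: "c * f u = 1" if "\<bar>u\<bar> < 1" "ddHfun b p u = 0" for u
  proof -
    have "1 - u\<^sup>2 > 0" using that(1) by (simp add: abs_square_less_1)
    then have "c * u ^ (p - 2) * (1 - u\<^sup>2) = 1" using that(2) by (simp add: ddHfun_def c_def field_simps)
    moreover have "u ^ (p - 2) * (1 - u\<^sup>2) = f u"
      by (simp add: f_def q power_add power2_eq_square power3_eq_cube algebra_simps)
    ultimately show ?thesis by (simp add: mult.assoc)
  qed
  have ab: "\<bar>x\<bar> < 1" "\<bar>y\<bar> < 1" "\<bar>z\<bar> < 1" using lt by auto
  note e = eq1[OF ab(1) zero(1)] eq1[OF ab(2) zero(2)] eq1[OF ab(3) zero(3)]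
  have c: "c > 0" using c0 e(1) by (cases "c = 0") auto
  have fe: "f x = f y" "f y = f z"
    using e c by (metis mult_left_cancel less_irrefl)+
  have x0: "0 \<le> x"
  proof (rule ccontr)
    assume n: "\<not> 0 \<le> x"
    then have "odd p" using dom by simp
    then have "odd (q + 1)" "even q" by (auto simp: q)
    then have "x ^ (q + 1) \<le> 0" using n by (simp add: mult_le_0_iff zero_le_even_power)
    moreover have "f x = x ^ (q + 1) * (1 - x\<^sup>2)"
      by (simp add: f_def power_add power2_eq_square power3_eq_cube algebra_simps)
    moreover have "1 - x\<^sup>2 > 0" using ab(1) by (simp add: abs_square_less_1)
    ultimately have "f x \<le> 0" by (simp add: mult_le_0_iff)
    then have "c * f x \<le> 0" using c by (simp add: mult_le_0_iff)
    then show False using e(1) by simp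
  qed
  define f' where "f' = (\<lambda>u::real. real (q + 1) * u ^ q - real (q + 3) * u ^ (q + 2))"
  have D: "(f has_real_derivative f' u) (at u)" for u
    unfolding f_def f'_def by (rule derivative_eq_intros refl | simp)+
  obtain u where u: "x < u" "u < y" "f y - f x = (y - x) * f' u"
    using MVT2[of x y f f'] lt D by blast
  obtain w where w: "y < w" "w < z" "f z - f y = (z - y) * f' w"
    using MVT2[of y z f f'] lt D by blast
  have root: "real (q + 3) * t\<^sup>2 = real (q + 1)" if "t > 0" "f' t = 0" for t
  proof -
    have "t ^ q * (real (q + 1) - real (q + 3) * t\<^sup>2) = 0"
      using that(2) by (simp add: f'_def power_add power2_eq_square algebra_simps)
    then show ?thesis using that(1) by simp
  qed
  have "f' u = 0" "f' w = 0" using u w fe lt by auto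
  then have "real (q + 3) * u\<^sup>2 = real (q + 3) * w\<^sup>2" using root[of u] root[of w] u w x0 lt by auto
  then have "u\<^sup>2 = w\<^sup>2" by simp
  then have "u = w" using u w x0 lt by (metis less_imp_le less_trans order_le_less_trans power2_eq_imp_eq)
  then show False using u w by simp
qed

lemma maximizers_reflect_even:
  assumes "even p" shows "maximizers b (- h) p = uminus ` maximizers b h p"
proof -
  have H: "Hfun b (- h) p x = Hfun b h p (- x)" for x
    using Hfun_minus[of b h p x] assms by simp
  show ?thesis
  proof (intro equalityI subsetI)
    fix x assume x: "x \<in> maximizers b (- h) p"
    have "- x \<in> maximizers b h p"
      unfolding maximizers_def
    proof (intro CollectI conjI ballI)
      show "- x \<in> {-1..1}" using x by (auto simp: maximizers_def)
      fix y :: real assume "y \<in> {-1..1}"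
      then have "Hfun b (- h) p (- y) \<le> Hfun b (- h) p x" using x by (auto simp: maximizers_def)
      then show "Hfun b h p y \<le> Hfun b h p (- x)" unfolding H by simp
    qed
    then show "x \<in> uminus ` maximizers b h p" by (rule rev_image_eqI) simp
  next
    fix x assume "x \<in> uminus ` maximizers b h p"
    then obtain y where y: "y \<in> maximizers b h p" "x = - y" by blast
    then show "x \<in> maximizers b (- h) p" unfolding maximizers_def
      by (auto simp: H)
  qed
qed

text \<open>For even p, reflecting a negative point changes H by -2 h m > 0; and 0 is excluded
  because H'(0) = h.\<close>

lemma maximizers_pos:
  assumes "even p" "p \<ge> 3" "h > 0" "m \<in> maximizers b h p" shows "m > 0"
proof -
  have "m \<noteq> 0"
    using dHfun_maximizer[OF assms(4)] assms(2,3) by (auto simp: dHfun_def power_0_left)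
  moreover have "\<not> m < 0"
  proof
    assume "m < 0"
    have "Hfun b h p (- m) = Hfun b h p m - 2 * h * m"
      using Hfun_minus[of b h p m] assms(1) by (simp add: Hfun_def)
    moreover have "h * m < 0" using \<open>m < 0\<close> assms(3) by (simp add: mult_less_0_iff)
    ultimately show False using maximizers_max[OF assms(4), of "- m"] maximizers_interior[OF assms(4)] by simp
  qed
  ultimately show ?thesis by simp
qed


text \<open>Since H'(0) = 0 and H''(0) = -1, H' is negative just to the right of 0, while H(m) \<ge>
  H(0) forces H' to be nonnegative somewhere before m. The two points may come in either order,
  hence the two uses of the intermediate value theorem. For h = 0 this supplies the additional
  critical point that the zero count of H'' needs.\<close>

lemma dHfun_zero_left_of_pos_maximizer:
  assumes p: "p \<ge> 3" and m: "m \<in> maximizers b 0 p" "m > 0"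
  obtains c where "0 < c" "c < m" "dHfun b 0 p c = 0"
proof -
  have m1: "\<bar>m\<bar> < 1" by (rule maximizers_interior[OF m(1)])
  have d0: "dHfun b 0 p 0 = 0" "ddHfun b p 0 < 0" using p by (auto simp: dHfun_def ddHfun_def power_0_left)
  obtain d where d: "d > 0" "\<And>k. 0 < k \<Longrightarrow> k < d \<Longrightarrow> dHfun b 0 p (0 + k) < dHfun b 0 p 0"
    using DERIV_neg_dec_right[OF has_derivative_dHfun d0(2)] p by force
  define k where "k = min (d / 2) (m / 2)"
  have k: "0 < k" "k < d" "k < m" using d m by (auto simp: k_def min_def field_simps)
  have neg: "dHfun b 0 p k < 0" using d(2)[of k] k d0 by simp
  have cont: "isCont (dHfun b 0 p) x" if "0 \<le> x" "x \<le> m" for x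
    by (rule DERIV_isCont[OF has_derivative_dHfun]) (use that m1 p in auto)
  obtain z where z: "0 < z" "z < m" "Hfun b 0 p m - Hfun b 0 p 0 = (m - 0) * dHfun b 0 p z"
    using MVT2[of 0 m "Hfun b 0 p" "dHfun b 0 p"] m m1 has_derivative_Hfun by auto
  have "Hfun b 0 p m \<ge> Hfun b 0 p 0" using maximizers_max[OF m(1), of 0] by simp
  then have "m * dHfun b 0 p z \<ge> 0" using z(3) by simp
  then have nn: "dHfun b 0 p z \<ge> 0" using m(2) by (simp add: zero_le_mult_iff)
  show thesis
  proof (cases "k < z")
    case True
    then obtain c where "k \<le> c" "c \<le> z" "dHfun b 0 p c = 0"
      using IVT[of "dHfun b 0 p" k 0 z] neg nn cont k z by auto
    then show thesis using that[of c] k z by auto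
  next
    case False
    then obtain c where "z \<le> c" "c \<le> k" "dHfun b 0 p c = 0"
      using IVT2[of "dHfun b 0 p" k 0 z] neg nn cont k z by auto
    then show thesis using that[of c] k z by auto
  qed
qed

text \<open>Between two maximizers \<open>H'\<close> vanishes, so Rolle's theorem produces two zeros of \<open>H''\<close> there;
  a third one, from degeneracy or from another zero of \<open>H'\<close>, is impossible.\<close>
lemma two_maximizers_ddHfun_zeros:
  assumes p: "p \<ge> 3" and xy: "x \<in> maximizers b h p" "y \<in> maximizers b h p" "x < y"
  obtains u v where "x < u" "u < v" "v < y" "ddHfun b p u = 0" "ddHfun b p v = 0"
proof -
  have ab: "\<bar>x\<bar> < 1" "\<bar>y\<bar> < 1" using xy maximizers_interior by blast+
  obtain z where z: "x < z" "z < y" "dHfun b h p z = 0" by (rule maximizers_rolle[OF xy])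
  obtain u where u: "x < u" "u < z" "ddHfun b p u = 0"
    by (rule dHfun_rolle[of x z b h p]) (use ab z dHfun_maximizer[OF xy(1)] p in auto)
  obtain v where v: "z < v" "v < y" "ddHfun b p v = 0"
    by (rule dHfun_rolle[of z y b h p]) (use ab z dHfun_maximizer[OF xy(2)] p in auto)
  show thesis by (rule that[of u v]) (use u v in auto)
qed

lemma ddHfun_minus_even: "even p \<Longrightarrow> ddHfun b p (- x) = ddHfun b p x"
  by (simp add: ddHfun_def)

lemma ddHfun_0: "p \<ge> 3 \<Longrightarrow> ddHfun b p 0 = -1"
  by (simp add: ddHfun_def power_0_left)

lemma two_maximizers_nondegenerate:
  assumes p: "p \<ge> 3" and b: "b \<ge> 0" and xy: "x \<in> maximizers b h p" "y \<in> maximizers b h p" "x < y"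
    and dom: "0 \<le> x \<or> odd p"
  shows "ddHfun b p x < 0" "ddHfun b p y < 0"
proof -
  have "\<bar>x\<bar> < 1" "\<bar>y\<bar> < 1" using xy maximizers_interior by blast+
  then have ab: "-1 < x" "y < 1" by auto
  obtain u v where uv: "x < u" "u < v" "v < y" "ddHfun b p u = 0" "ddHfun b p v = 0"
    by (rule two_maximizers_ddHfun_zeros[OF p xy])
  have "ddHfun b p x \<noteq> 0"
    using ddHfun_three_zeros[OF p b, of x u v] uv ab dom by auto
  then show "ddHfun b p x < 0" using ddHfun_maximizer_le_0[OF xy(1)] p by force
  have "ddHfun b p y \<noteq> 0"
    using ddHfun_three_zeros[OF p b, of u v y] uv ab dom by auto
  then show "ddHfun b p y < 0" using ddHfun_maximizer_le_0[OF xy(2)] p by force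
qed

lemma no_three_maximizers:
  assumes p: "p \<ge> 3" and b: "b \<ge> 0"
    and xyz: "x \<in> maximizers b h p" "y \<in> maximizers b h p" "z \<in> maximizers b h p" "x < y" "y < z"
    and dom: "0 \<le> x \<or> odd p"
  shows False
proof -
  have "\<bar>x\<bar> < 1" "\<bar>z\<bar> < 1" using xyz maximizers_interior by blast+
  then have ab: "-1 < x" "z < 1" by auto
  obtain u v where uv: "x < u" "u < v" "v < y" "ddHfun b p u = 0" "ddHfun b p v = 0"
    by (rule two_maximizers_ddHfun_zeros[OF p xyz(1,2,4)])
  obtain u' v' where uv': "y < u'" "u' < v'" "v' < z" "ddHfun b p u' = 0" "ddHfun b p v' = 0"
    by (rule two_maximizers_ddHfun_zeros[OF p xyz(2,3,5)])
  show False using ddHfun_three_zeros[OF p b, of u v u'] uv uv' ab dom by auto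
qed

lemma two_maximizers_exhaust:
  assumes p: "p \<ge> 3" and b: "b \<ge> 0" and xy: "x \<in> maximizers b h p" "y \<in> maximizers b h p" "x < y"
    and dom: "odd p \<or> (\<forall>m\<in>maximizers b h p. 0 \<le> m)"
  shows "maximizers b h p = {x, y}"
proof -
  have "z = x \<or> z = y" if z: "z \<in> maximizers b h p" for z
  proof (rule ccontr)
    assume "\<not> (z = x \<or> z = y)"
    then consider "z < x" | "x < z" "z < y" | "y < z" using xy(3) by linarith
    then show False
    proof cases
      case 1 then show False by (intro no_three_maximizers[OF p b z xy(1,2)]) (use dom xy z in auto)
    next
      case 2 then show False by (intro no_three_maximizers[OF p b xy(1) z xy(2)]) (use dom xy in auto)
    next
      case 3 then show False by (intro no_three_maximizers[OF p b xy(1,2) z]) (use dom xy in auto)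
    qed
  qed
  then show ?thesis using xy by auto
qed

lemma maximizers_odd:
  assumes p: "p \<ge> 3" "odd p" and b: "b \<ge> 0" and crit: "p_critical b h p"
  shows "\<exists>m1 m2. m1 < m2 \<and> maximizers b h p = {m1, m2} \<and> ddHfun b p m1 < 0 \<and> ddHfun b p m2 < 0"
proof -
  obtain x y where xy: "x \<in> maximizers b h p" "y \<in> maximizers b h p" "x < y"
    using crit unfolding p_critical_def by (metis linorder_neqE)
  then show ?thesis
    using two_maximizers_exhaust[OF p(1) b xy] two_maximizers_nondegenerate[OF p(1) b xy] p(2) by auto
qed

lemma maximizers_even_pos:
  assumes p: "p \<ge> 3" "even p" and b: "b \<ge> 0" and crit: "p_critical b h p" and h: "h > 0"
  shows "\<exists>m1 m2. 0 < m1 \<and> m1 < m2 \<and> maximizers b h p = {m1, m2} \<and> ddHfun b p m1 < 0 \<and> ddHfun b p m2 < 0"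
proof -
  obtain x y where xy: "x \<in> maximizers b h p" "y \<in> maximizers b h p" "x < y"
    using crit unfolding p_critical_def by (metis linorder_neqE)
  have pos: "m > 0" if "m \<in> maximizers b h p" for m using maximizers_pos[OF p(2,1) h that] .
  show ?thesis
    using two_maximizers_exhaust[OF p(1) b xy] two_maximizers_nondegenerate[OF p(1) b xy] pos xy
    by (metis less_imp_le)
qed

lemma maximizers_even_neg:
  assumes p: "p \<ge> 3" "even p" and b: "b \<ge> 0" and crit: "p_critical b h p" and h: "h < 0"
  shows "\<exists>m1 m2. m1 < m2 \<and> m2 < 0 \<and> maximizers b h p = {m1, m2} \<and> ddHfun b p m1 < 0 \<and> ddHfun b p m2 < 0"
proof -
  have refl: "maximizers b (- h) p = uminus ` maximizers b h p" by (rule maximizers_reflect_even[OF p(2)])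
  have "p_critical b (- h) p"
    using crit unfolding p_critical_def refl by (metis imageI minus_minus)
  then obtain m1 m2 where m: "0 < m1" "m1 < m2" "maximizers b (- h) p = {m1, m2}"
      "ddHfun b p m1 < 0" "ddHfun b p m2 < 0"
    using maximizers_even_pos[OF p b, of "- h"] h by auto
  have "maximizers b h p = uminus ` {m1, m2}"
    using maximizers_reflect_even[OF p(2), of b "- h"] m(3) by simp
  then show ?thesis
    using m by (intro exI[of _ "- m2"] exI[of _ "- m1"]) (auto simp: ddHfun_minus_even[OF p(2)])
qed

text \<open>The evenness of H reduces everything to the positive side. Two positive maximizers s < t
  would give two zeros of H'' between them and a third below s, from the critical point c in (0,s).
  If H''(m) = 0, then Rolle on the critical points 0 < c < m would add two more zeros. Whether 0 is
  a maximizer is left open here; that is decided by the comparison of b with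
  \<open>beta_tilde\<close>.\<close>

lemma maximizers_even_zero:
  assumes p: "p \<ge> 3" "even p" and b: "b \<ge> 0" and crit: "p_critical b 0 p"
  shows "\<exists>m>0. (maximizers b 0 p = {-m, m} \<or> maximizers b 0 p = {-m, 0, m}) \<and>
    ddHfun b p m < 0 \<and> ddHfun b p (- m) < 0"
proof -
  have refl: "- x \<in> maximizers b 0 p" if "x \<in> maximizers b 0 p" for x
    using maximizers_reflect_even[OF p(2), of b 0] that by force
  obtain m where m: "m \<in> maximizers b 0 p" "m > 0"
  proof -
    obtain x where "x \<in> maximizers b 0 p" "x \<noteq> 0" using crit unfolding p_critical_def by metis
    then show thesis using that[of x] that[of "- x"] refl[of x] by linarith
  qed
  have uniq: "x = m" if x: "x \<in> maximizers b 0 p" "x > 0" for x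
  proof (rule ccontr)
    assume ne: "x \<noteq> m"
    define s t where "s = min x m" and "t = max x m"
    have st: "s \<in> maximizers b 0 p" "t \<in> maximizers b 0 p" "0 < s" "s < t"
      using x m ne unfolding s_def t_def by (auto simp: min_def max_def)
    have t1: "\<bar>t\<bar> < 1" by (rule maximizers_interior[OF st(2)])
    obtain c where c: "0 < c" "c < s" "dHfun b 0 p c = 0"
      by (rule dHfun_zero_left_of_pos_maximizer[OF p(1) st(1,3)])
    obtain w where w: "c < w" "w < s" "ddHfun b p w = 0"
      by (rule dHfun_rolle[of c s b 0 p]) (use c st t1 p dHfun_maximizer[OF st(1)] in auto)
    obtain u v where uv: "s < u" "u < v" "v < t" "ddHfun b p u = 0" "ddHfun b p v = 0"
      by (rule two_maximizers_ddHfun_zeros[OF p(1) st(1,2,4)])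
    show False using ddHfun_three_zeros[OF p(1) b, of w u v] w uv c t1 by auto
  qed
  have m1: "\<bar>m\<bar> < 1" by (rule maximizers_interior[OF m(1)])
  have "ddHfun b p m \<noteq> 0"
  proof
    assume z: "ddHfun b p m = 0"
    obtain c where c: "0 < c" "c < m" "dHfun b 0 p c = 0"
      by (rule dHfun_zero_left_of_pos_maximizer[OF p(1) m])
    have d0: "dHfun b 0 p 0 = 0" using p by (simp add: dHfun_def power_0_left)
    obtain w where w: "0 < w" "w < c" "ddHfun b p w = 0"
      by (rule dHfun_rolle[of 0 c b 0 p]) (use c d0 m1 p in auto)
    obtain u where u: "c < u" "u < m" "ddHfun b p u = 0"
      by (rule dHfun_rolle[of c m b 0 p]) (use c m1 p dHfun_maximizer[OF m(1)] in auto)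
    show False using ddHfun_three_zeros[OF p(1) b, of w u m] w u z m1 by auto
  qed
  then have dd: "ddHfun b p m < 0" using ddHfun_maximizer_le_0[OF m(1)] p by force
  have sub: "x \<in> {-m, 0, m}" if "x \<in> maximizers b 0 p" for x
    using uniq[OF that] uniq[OF refl[OF that]] by force
  have "maximizers b 0 p = {-m, m} \<or> maximizers b 0 p = {-m, 0, m}"
    using sub m(1) refl[OF m(1)] by blast
  then show ?thesis using m(2) dd ddHfun_minus_even[OF p(2), of b m] by auto
qed

lemma critical_nondegenerate:
  assumes p: "p \<ge> 3" and b: "b \<ge> 0" and crit: "p_critical b h p"
  shows "finite (maximizers b h p)" "\<And>m. m \<in> maximizers b h p \<Longrightarrow> ddHfun b p m < 0"
proof -
  have "finite (maximizers b h p) \<and> (\<forall>m\<in>maximizers b h p. ddHfun b p m < 0)"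
  proof (cases "odd p")
    case True
    then show ?thesis using maximizers_odd[OF p _ b crit] by auto
  next
    case False
    then have ev: "even p" by simp
    consider "h > 0" | "h < 0" | "h = 0" by linarith
    then show ?thesis
    proof cases
      case 1 then show ?thesis using maximizers_even_pos[OF p ev b crit] by auto
    next
      case 2 then show ?thesis using maximizers_even_neg[OF p ev b crit] by auto
    next
      case 3
      then show ?thesis using maximizers_even_zero[OF p ev b] crit ddHfun_0[OF p, of b] by auto
    qed
  qed
  then show "finite (maximizers b h p)" "\<And>m. m \<in> maximizers b h p \<Longrightarrow> ddHfun b p m < 0" by auto
qed

section \<open>The threshold \<open>beta_tilde\<close> and the maximizer at the origin\<close>

lemma x_ln_x_gt:
  assumes "y \<ge> 0" "y \<noteq> (1::real)" shows "y * ln y > y - 1"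
proof (cases "y = 0")
  case False
  then have y: "y > 0" using assms by simp
  have "ln (1 / y) \<le> 1 / y - 1" using y by (intro ln_le_minus_one) auto
  moreover have "ln (1 / y) \<noteq> 1 / y - 1" using ln_eq_minus_one[of "1 / y"] y assms by auto
  ultimately have "- ln y < 1 / y - 1" using y by (simp add: ln_div)
  then have "y * (- ln y) < y * (1 / y - 1)" using y by (intro mult_strict_left_mono)
  then show ?thesis using y by (simp add: algebra_simps)
qed simp

text \<open>The strict tangent bound y ln y > y - 1 is added at y = 1 + x and y = 1 - x, where the
  linear terms cancel.\<close>

lemma Ient_pos:
  assumes "\<bar>x\<bar> \<le> 1" "x \<noteq> 0" shows "Ient x > 0"
proof -
  have "0 \<le> 1 + x" "0 \<le> 1 - x" using assms by auto
  then show ?thesis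
    using x_ln_x_gt[of "1 + x"] x_ln_x_gt[of "1 - x"] assms(2) unfolding Ient_def by simp
qed

lemma Hfun_0 [simp]: "p \<ge> 1 \<Longrightarrow> Hfun b h p 0 = 0"
  by (simp add: Hfun_def Ient_def power_0_left)

text \<open>Because H(0) = 0, the supremum is never negative. Continuity on the compact interval
  supplies the boundedness that makes the conditionally complete supremum meaningful.\<close>

lemma Sup_Hfun_eq_0_iff:
  assumes "p \<ge> 1"
  shows "(SUP x\<in>{-1..1}. Hfun b 0 p x) = 0 \<longleftrightarrow> (\<forall>x\<in>{-1..1}. Hfun b 0 p x \<le> 0)"
proof
  have "compact (Hfun b 0 p ` {-1..1})"
    by (intro compact_continuous_image continuous_on_Hfun) simp
  then have bdd: "bdd_above (Hfun b 0 p ` {-1..1})"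
    by (intro bounded_imp_bdd_above compact_imp_bounded)
  assume "(SUP x\<in>{-1..1}. Hfun b 0 p x) = 0"
  then show "\<forall>x\<in>{-1..1}. Hfun b 0 p x \<le> 0" using cSUP_upper[OF _ bdd] by auto
next
  assume *: "\<forall>x\<in>{-1..1}. Hfun b 0 p x \<le> 0"
  have "Hfun b 0 p 0 = 0" using assms by simp
  then show "(SUP x\<in>{-1..1}. Hfun b 0 p x) = 0"
    by (intro cSup_eq_maximum) (use * in \<open>auto intro!: rev_image_eqI[of 0]\<close>)
qed

text \<open>H'(0) = h gives h = 0. A second maximizer m has H(m) = H(0) = 0, so b m^p = I(m) > 0 and
  m^p > 0; any larger inverse temperature would make H positive at m. Hence b is the maximum of the
  set whose supremum defines \<open>beta_tilde\<close>.\<close>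

lemma zero_maximizer_imp_beta_tilde:
  assumes p: "p \<ge> 3" and b: "b \<ge> 0" and crit: "p_critical b h p" and z: "0 \<in> maximizers b h p"
  shows "h = 0 \<and> b = beta_tilde p"
proof -
  have h: "h = 0" using dHfun_maximizer[OF z] p by (simp add: dHfun_def power_0_left)
  obtain m where m: "m \<in> maximizers b 0 p" "m \<noteq> 0" using crit h unfolding p_critical_def by metis
  have m1: "\<bar>m\<bar> < 1" by (rule maximizers_interior[OF m(1)])
  have "Hfun b 0 p m = 0" using maximizers_eq[OF m(1)] z h p by simp
  then have bm: "b * m ^ p = Ient m" by (simp add: Hfun_def)
  then have "b * m ^ p > 0" using Ient_pos[of m] m m1 by simp
  then have mp: "m ^ p > 0" using b by (simp add: zero_less_mult_iff)
  have "Sup {b. b \<ge> 0 \<and> (SUP x\<in>{-1..1}. Hfun b 0 p x) = 0} = b"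
  proof (rule cSup_eq_maximum)
    have "\<forall>x\<in>{-1..1}. Hfun b 0 p x \<le> 0"
      using maximizers_max[OF z[unfolded h]] p by auto
    then show "b \<in> {b. b \<ge> 0 \<and> (SUP x\<in>{-1..1}. Hfun b 0 p x) = 0}"
      using b Sup_Hfun_eq_0_iff[of p b] p by auto
    fix b' assume "b' \<in> {b. b \<ge> 0 \<and> (SUP x\<in>{-1..1}. Hfun b 0 p x) = 0}"
    then have "\<forall>x\<in>{-1..1}. Hfun b' 0 p x \<le> 0" using Sup_Hfun_eq_0_iff[of p b'] p by auto
    moreover have "m \<in> {-1..1}" using m1 by auto
    ultimately have "Hfun b' 0 p m \<le> 0" by blast
    then have "b' * m ^ p \<le> b * m ^ p" unfolding bm by (simp add: Hfun_def)
    then show "b' \<le> b" using mp by simp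
  qed
  then show ?thesis using h by (simp add: beta_tilde_def)
qed

text \<open>The defining set contains its supremum: if H were positive at some x for the supremum,
  it would stay positive for members close enough below.\<close>

lemma beta_tilde_imp_zero_maximizer:
  assumes p: "p \<ge> 3" and bt: "beta_tilde p \<ge> 0" shows "0 \<in> maximizers (beta_tilde p) 0 p"
proof -
  let ?S = "{b. b \<ge> 0 \<and> (SUP x\<in>{-1..1}. Hfun b 0 p x) = 0}"
  have "Hfun (beta_tilde p) 0 p x \<le> 0" if x: "x \<in> {-1..1}" for x
  proof (rule ccontr)
    assume "\<not> Hfun (beta_tilde p) 0 p x \<le> 0"
    then have pos: "Hfun (beta_tilde p) 0 p x > 0" by simp
    have "Hfun 0 0 p y \<le> 0" if "y \<in> {-1..1}" for y
    proof (cases "y = 0")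
      case False
      then have "Ient y > 0" using that by (intro Ient_pos) auto
      then show ?thesis by (simp add: Hfun_def)
    qed (use p in simp)
    then have "0 \<in> ?S" using Sup_Hfun_eq_0_iff[of p 0] p by auto
    then have ne: "?S \<noteq> {}" by blast
    have x0: "x \<noteq> 0" using pos p by auto
    then have Ix: "Ient x > 0" using x by (intro Ient_pos) auto
    \<comment> \<open>As 0 \<le> x^p \<le> 1, lowering the inverse temperature by at most e costs at
      most e, half of the assumed positive value.\<close>
    define e where "e = Hfun (beta_tilde p) 0 p x / 2"
    have e: "e > 0" using pos by (simp add: e_def)
    have "beta_tilde p - e < Sup ?S" using e by (simp add: beta_tilde_def)
    then obtain b' where b': "b' \<in> ?S" "beta_tilde p - e < b'" using less_cSupD[OF ne] by blast
    have le: "Hfun b' 0 p x \<le> 0" using b'(1) Sup_Hfun_eq_0_iff[of p b'] p x by auto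
    have "x ^ p \<ge> 0"
    proof (rule ccontr)
      assume n: "\<not> x ^ p \<ge> 0"
      have "beta_tilde p * x ^ p > 0" using pos Ix by (simp add: Hfun_def)
      then show False using bt n by (simp add: zero_less_mult_iff)
    qed
    moreover have "\<bar>x ^ p\<bar> \<le> 1" using x by (auto simp: power_abs intro!: power_le_one)
    ultimately have "e * x ^ p \<le> e * 1" "(beta_tilde p - e) * x ^ p \<le> b' * x ^ p"
      using e b'(2) by (auto intro!: mult_left_mono mult_right_mono)
    then have "Hfun b' 0 p x \<ge> Hfun (beta_tilde p) 0 p x - e"
      by (simp add: Hfun_def algebra_simps)
    then show False using le e by (simp add: e_def)
  qed
  then show ?thesis using p by (auto simp: maximizers_def)
qed

section \<open>Monotonicity of the maximum likelihood estimate\<close>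

lemma cw_weight_pos: "cw_weight b h p N x > 0"
  by (simp add: cw_weight_def)

lemma cw_weight_sum_pos: "(\<Sum>x\<in>configs N. cw_weight b h p N x) > 0"
  by (intro sum_pos cw_weight_pos) auto

lemma cw_weight_shift:
  "cw_weight (b + d) h p N x = cw_weight b h p N x * exp (real N * d * xbar N x ^ p)"
  by (simp add: cw_weight_def exp_add[symmetric] algebra_simps)

text \<open>Chebyshev's association inequality: the difference of the two sides, doubled, is the sum
  over all pairs of u x * u y * (f x - f y) * (e x - e y). No term is negative, and the pair (r, s)
  contributes strictly.\<close>

lemma chebyshev_sum_strict:
  fixes u f e :: "'a \<Rightarrow> real"
  assumes fin: "finite A" and u: "\<And>x. x \<in> A \<Longrightarrow> u x > 0"
    and mono: "\<And>x y. x \<in> A \<Longrightarrow> y \<in> A \<Longrightarrow> f x < f y \<Longrightarrow> e x < e y"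
    and cong: "\<And>x y. x \<in> A \<Longrightarrow> y \<in> A \<Longrightarrow> f x = f y \<Longrightarrow> e x = e y"
    and ex: "r \<in> A" "s \<in> A" "f r \<noteq> f s"
  shows "(\<Sum>x\<in>A. u x * f x) * (\<Sum>x\<in>A. u x * e x) < (\<Sum>x\<in>A. u x * e x * f x) * (\<Sum>x\<in>A. u x)"
proof -
  define D where "D = (\<lambda>x y. u x * u y * ((f x - f y) * (e x - e y)))"
  have pos: "(f x - f y) * (e x - e y) > 0" if "x \<in> A" "y \<in> A" "f x \<noteq> f y" for x y
    using that mono[of x y] mono[of y x] by (cases "f x < f y") (auto intro: mult_pos_pos mult_neg_neg)
  have nn: "D x y \<ge> 0" if "x \<in> A" "y \<in> A" for x y
    using pos[OF that] u that by (cases "f x = f y") (auto simp: D_def less_imp_le)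
  have "0 < D r s" using pos[OF ex] u ex by (simp add: D_def)
  also have "\<dots> \<le> (\<Sum>y\<in>A. D r y)" by (rule member_le_sum[OF ex(2)]) (use nn ex fin in auto)
  also have "\<dots> \<le> (\<Sum>x\<in>A. \<Sum>y\<in>A. D x y)"
    by (rule member_le_sum[OF ex(1), of "\<lambda>x. \<Sum>y\<in>A. D x y"]) (use nn fin in \<open>auto intro!: sum_nonneg\<close>)
  also have "\<dots> = (\<Sum>x\<in>A. \<Sum>y\<in>A. (u x * e x * f x) * u y - (u x * f x) * (u y * e y)
      - (u x * e x) * (u y * f y) + u x * (u y * e y * f y))"
    by (simp add: D_def algebra_simps)
  also have "\<dots> = 2 * ((\<Sum>x\<in>A. u x * e x * f x) * (\<Sum>x\<in>A. u x) - (\<Sum>x\<in>A. u x * f x) * (\<Sum>x\<in>A. u x * e x))"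
    by (simp add: sum.distrib sum_subtractf sum_product[symmetric])
  finally show ?thesis by simp
qed

lemma xbar_pow_nonconstant:
  assumes "N \<ge> 2" "p \<ge> 1"
  obtains x y where "x \<in> configs N" "y \<in> configs N" "xbar N x ^ p \<noteq> xbar N y ^ p"
proof -
  define x where "x = (\<lambda>i\<in>{..<N}. 1 :: real)"
  \<comment> \<open>One flipped spin gives magnetization 1 - 2/N, which lies in [0,1) for N \<ge> 2;
    its power therefore differs from 1 for even p as well, where flipping all spins would not
    help.\<close>
  define y where "y = (\<lambda>i\<in>{..<N}. if i = 0 then -1 else 1 :: real)"
  have xy: "x \<in> configs N" "y \<in> configs N" by (auto simp: x_def y_def configs_def)
  have "xbar N x = 1" using assms by (simp add: xbar_def x_def)
  have "(\<Sum>i<N. y i) = (\<Sum>i<N. 1 - (if i = 0 then 2 else 0))" by (intro sum.cong) (auto simp: y_def)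
  also have "\<dots> = real N - 2" using assms by (simp add: sum_subtractf)
  finally have yb: "xbar N y = 1 - 2 / real N" using assms by (simp add: xbar_def field_simps)
  moreover have "0 < 2 / real N" "2 / real N \<le> 1" using assms by auto
  ultimately have "0 \<le> xbar N y" "xbar N y < 1" by auto
  then have "xbar N y ^ p < 1" using assms(2) by (simp add: power_less_one_iff)
  then show thesis using that[OF xy] \<open>xbar N x = 1\<close> by simp
qed

text \<open>Raising b by d reweights by exp(N d xbar^p), an increasing function of xbar^p, so the
  association inequality applies.\<close>

lemma cw_expect_power_strict_mono:
  assumes N: "N \<ge> 2" and p: "p \<ge> 1" and b: "b < b'"
  shows "cw_expect b h p N (\<lambda>y. xbar N y ^ p) < cw_expect b' h p N (\<lambda>y. xbar N y ^ p)"
proof -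
  define d where "d = b' - b"
  have d: "d > 0" "b' = b + d" using b by (auto simp: d_def)
  obtain x0 y0 where ex: "x0 \<in> configs N" "y0 \<in> configs N" "xbar N x0 ^ p \<noteq> xbar N y0 ^ p"
    by (rule xbar_pow_nonconstant[OF N p])
  have "(\<Sum>x\<in>configs N. cw_weight b h p N x * xbar N x ^ p) *
        (\<Sum>x\<in>configs N. cw_weight b h p N x * exp (real N * d * xbar N x ^ p))
      < (\<Sum>x\<in>configs N. cw_weight b h p N x * exp (real N * d * xbar N x ^ p) * xbar N x ^ p) *
        (\<Sum>x\<in>configs N. cw_weight b h p N x)"
    by (rule chebyshev_sum_strict[where f = "\<lambda>x. xbar N x ^ p" and r = x0 and s = y0])
      (use N d cw_weight_pos ex in auto)
  then show ?thesis
    unfolding cw_expect_def d(2) cw_weight_shift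
    using cw_weight_sum_pos[of b h p N] cw_weight_sum_pos[of "b + d" h p N, unfolded cw_weight_shift]
    by (simp add: divide_simps mult_ac)
qed

lemma isCont_cw_expect: "isCont (\<lambda>b. cw_expect b h p N g) b"
  unfolding cw_expect_def
proof (intro continuous_intros)
  show "(\<Sum>x\<in>configs N. cw_weight b h p N x) \<noteq> 0" using cw_weight_sum_pos[of b h p N] by simp
qed (simp_all add: cw_weight_def)

text \<open>The mean of xbar^p is continuous and strictly increasing in b. If the observed value is
  attained, the solution is unique and comparisons transfer. If it is not attained, the intermediate
  value theorem puts the whole curve on one side of it, in agreement with the conventions for the
  infinite values of the estimate.\<close>

lemma mle_le_iff:
  assumes N: "N \<ge> 2" and p: "p \<ge> 1"
  shows "mle h p N x \<le> ereal b \<longleftrightarrow> xbar N x ^ p \<le> cw_expect b h p N (\<lambda>y. xbar N y ^ p)"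
proof -
  define F where "F = (\<lambda>b. cw_expect b h p N (\<lambda>y. xbar N y ^ p))"
  define t where "t = xbar N x ^ p"
  have sm: "F a < F a'" if "a < a'" for a a'
    unfolding F_def by (rule cw_expect_power_strict_mono[OF N p that])
  have le: "F a \<le> F a' \<longleftrightarrow> a \<le> a'" for a a'
    using sm[of a a'] sm[of a' a] by (cases a a' rule: linorder_cases) auto
  have cont: "isCont F a" for a unfolding F_def by (rule isCont_cw_expect)
  have mle: "mle h p N x = (if \<exists>b. F b = t then ereal (THE b. F b = t) else if \<forall>b. t \<le> F b then -\<infinity> else \<infinity>)"
    unfolding mle_def F_def t_def by (simp add: Let_def)
  have "mle h p N x \<le> ereal b \<longleftrightarrow> t \<le> F b"
  proof (cases "\<exists>b. F b = t")
    case True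
    then obtain b0 where b0: "F b0 = t" by blast
    have "(THE b. F b = t) = b0" 
    proof (rule the_equality)
      fix a assume "F a = t"
      then have "a \<le> b0" "b0 \<le> a" using le[of a b0] le[of b0 a] b0 by auto
      then show "a = b0" by simp
    qed (rule b0)
    then show ?thesis using True le[of b0 b] b0 by (simp add: mle)
  next
    case False
    show ?thesis
    proof (cases "\<forall>b. t \<le> F b")
      case True
      then show ?thesis using False by (simp add: mle)
    next
      case nle: False
      then obtain b1 where b1: "F b1 < t" by (auto simp: not_le)
      have "F b < t"
      proof (rule ccontr)
        assume "\<not> F b < t"
        then have "t \<le> F b" by simp
        moreover have "b1 \<le> b" using le[of b1 b] b1 calculation by linarith
        ultimately show False using IVT[of F b1 t b] b1 cont False by auto
      qed
      then show ?thesis using False nle by (simp add: mle)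
    qed
  qed
  then show ?thesis by (simp add: F_def t_def)
qed

lemma Tstat_le_iff:
  assumes N: "N \<ge> 2" and p: "p \<ge> 1"
  shows "Tstat b h p N x \<le> ereal t \<longleftrightarrow>
    xbar N x ^ p \<le> cw_expect (b + t / sqrt (real N)) h p N (\<lambda>y. xbar N y ^ p)"
proof -
  have s: "sqrt (real N) > 0" using N by simp
  have "Tstat b h p N x \<le> ereal t \<longleftrightarrow> mle h p N x \<le> ereal (b + t / sqrt (real N))"
    using s by (cases "mle h p N x") (auto simp: Tstat_def field_simps)
  then show ?thesis by (simp add: mle_le_iff[OF N p])
qed

section \<open>Weak convergence on the extended reals from distribution functions\<close>

text \<open>The half-line indicator as a test function on the extended reals: integrating it against
  a law gives the distribution function, with any atom at minus infinity always counted.\<close>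

definition cdf_test :: "real \<Rightarrow> ereal \<Rightarrow> real" where
  "cdf_test t y = (if y \<le> ereal t then 1 else 0)"

lemma cdf_test_measurable [measurable]: "cdf_test t \<in> borel_measurable borel"
  unfolding cdf_test_def by measurable

text \<open>The break points avoid 0, where the limit laws have an atom.\<close>
lemma continuous_ereal_step_approx:
  fixes f :: "ereal \<Rightarrow> real"
  assumes f: "continuous_on UNIV f" and e: "e > 0"
  obtains n :: nat and t d :: "nat \<Rightarrow> real" and c :: real
  where "\<And>i. t i \<noteq> 0" "\<And>y. \<bar>f y - (c + (\<Sum>i\<le>n. d i * cdf_test (t i) y))\<bar> \<le> e"
proof -
  have cont: "isCont f y" for y using f by (simp add: continuous_on_eq_continuous_at)
  have "((\<lambda>x. f (ereal x)) \<longlongrightarrow> f \<infinity>) at_top"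
    by (intro isCont_tendsto_compose[OF cont]) (simp add: tendsto_PInfty_eq_at_top filterlim_ident)
  then have "eventually (\<lambda>x. dist (f (ereal x)) (f \<infinity>) < e) at_top" using e by (rule tendstoD)
  then obtain A1 where A1: "\<And>x. x \<ge> A1 \<Longrightarrow> \<bar>f (ereal x) - f \<infinity>\<bar> < e"
    by (auto simp: eventually_at_top_linorder dist_real_def)
  have "((\<lambda>x. f (ereal x)) \<longlongrightarrow> f (-\<infinity>)) at_bot"
    by (intro isCont_tendsto_compose[OF cont]) (auto simp: tendsto_MInfty eventually_gt_at_bot)
  then have "eventually (\<lambda>x. dist (f (ereal x)) (f (-\<infinity>)) < e) at_bot" using e by (rule tendstoD)
  then obtain A2 where A2: "\<And>x. x \<le> A2 \<Longrightarrow> \<bar>f (ereal x) - f (-\<infinity>)\<bar> < e"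
    by (auto simp: eventually_at_bot_linorder dist_real_def)
  define A where "A = max 1 (max A1 (- A2))"
  have A: "A > 0" "A \<ge> A1" "- A \<le> A2" by (auto simp: A_def)
  have "continuous_on {-A..A} (\<lambda>x. f (ereal x))"
    by (intro continuous_on_compose2[OF f] continuous_intros) auto
  then have "uniformly_continuous_on {-A..A} (\<lambda>x. f (ereal x))"
    by (intro compact_uniformly_continuous) auto
  then obtain \<delta> where \<delta>: "\<delta> > 0" "\<And>x y. x \<in> {-A..A} \<Longrightarrow> y \<in> {-A..A} \<Longrightarrow> dist x y < \<delta> \<Longrightarrow>
      dist (f (ereal x)) (f (ereal y)) < e"
    unfolding uniformly_continuous_on_def using e by metis
  obtain k :: nat where k: "2 * A / \<delta> < real k" using reals_Archimedean2 by blast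
  \<comment> \<open>With an odd number of equal subdivisions of [-A, A], the midpoint 0 is never a
    node.\<close>
  define n where "n = 2 * k + 1"
  have n: "n > 0" "odd n" "2 * A / real n < \<delta>"
  proof -
    have "2 * A < \<delta> * real k" using k \<delta> by (simp add: field_simps)
    also have "\<dots> \<le> \<delta> * real n" using \<delta> by (intro mult_left_mono) (auto simp: n_def)
    finally show "2 * A / real n < \<delta>" by (simp add: field_simps n_def)
  qed (auto simp: n_def)
  define t where "t = (\<lambda>i::nat. A * (2 * real i / real n - 1))"
  have t0: "t i \<noteq> 0" for i
  proof
    assume "t i = 0"
    then have "2 * real i = real n" using A n by (simp add: t_def field_simps)
    then have "2 * i = n" by linarith
    then show False using n(2) by auto
  qed
  have tn: "t 0 = - A" "t n = A" using n by (auto simp: t_def)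
  have tmono: "t i \<le> t j" if "i \<le> j" for i j
    unfolding t_def using that A n by (intro mult_left_mono) (auto simp: divide_right_mono)
  \<comment> \<open>The step values run from f(-\<infinity>) on the left end to f(\<infinity>)
    beyond the last node. The coefficients are their successive drops, so the sum over the nodes at
    or above y telescopes to the value of the step containing y.\<close>
  define v where "v = (\<lambda>i. if i = 0 then f (-\<infinity>) else if i \<le> n then f (ereal (t i)) else f \<infinity>)"
  define d where "d = (\<lambda>i. v i - v (Suc i))"
  have "\<bar>f y - (f \<infinity> + (\<Sum>i\<le>n. d i * cdf_test (t i) y))\<bar> \<le> e" for y
  proof (cases "y \<le> ereal (t n)")
    case False
    have "cdf_test (t i) y = 0" if "i \<le> n" for i
    proof -
      have "ereal (t i) \<le> ereal (t n)" using tmono[OF that] by simp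
      then have "\<not> y \<le> ereal (t i)" using False by (metis order_trans)
      then show ?thesis by (simp add: cdf_test_def)
    qed
    moreover have "\<bar>f y - f \<infinity>\<bar> \<le> e"
    proof (cases y)
      case (real r)
      then show ?thesis using False A1[of r] A by (simp add: tn)
    qed (use False e in auto)
    ultimately show ?thesis by simp
  next
    case True
    define j where "j = (LEAST i. y \<le> ereal (t i))"
    have yj: "y \<le> ereal (t j)" unfolding j_def by (rule LeastI[of _ n]) (rule True)
    have jn: "j \<le> n" unfolding j_def by (rule Least_le) (rule True)
    have lt: "ereal (t i) < y" if "i < j" for i
      using not_less_Least[of i "\<lambda>i. y \<le> ereal (t i)"] that unfolding j_def by (simp add: not_le)
    have test: "cdf_test (t i) y = (if j \<le> i then 1 else 0)" for i
    proof (cases "j \<le> i")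
      case True
      then have "ereal (t j) \<le> ereal (t i)" using tmono by simp
      then have "y \<le> ereal (t i)" using yj by (metis order_trans)
      then show ?thesis using True by (simp add: cdf_test_def)
    next
      case False
      then show ?thesis using lt[of i] by (simp add: cdf_test_def not_le)
    qed
    have "(\<Sum>i\<le>n. d i * cdf_test (t i) y) = (\<Sum>i\<in>{j..n}. d i)"
      unfolding test by (rule sum.mono_neutral_cong_right) (use jn in auto)
    also have "\<dots> = v j - v (Suc n)"
      using sum_Suc_diff[of j n "\<lambda>i. - v i"] jn by (simp add: d_def)
    also have "v (Suc n) = f \<infinity>" by (simp add: v_def)
    finally have S: "f \<infinity> + (\<Sum>i\<le>n. d i * cdf_test (t i) y) = v j" by simp
    have "\<bar>f y - v j\<bar> \<le> e"
    proof (cases "j = 0")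
      case True
      then have yA: "y \<le> ereal (- A)" using yj tn by simp
      have "\<bar>f y - f (-\<infinity>)\<bar> \<le> e"
      proof (cases y)
        case (real r)
        then show ?thesis using yA A2[of r] A by simp
      qed (use yA e in auto)
      then show ?thesis using True by (simp add: v_def)
    next
      case False
      have lo: "ereal (t (j - 1)) < y" using lt[of "j - 1"] False by simp
      obtain r where r: "y = ereal r" using lo yj by (cases y) auto
      have r1: "t (j - 1) < r" "r \<le> t j" using lo yj r by auto
      have "t j - t (j - 1) = 2 * A / real n"
        using False n by (cases j) (auto simp: t_def field_simps)
      then have "dist r (t j) < \<delta>" using r1 n(3) by (simp add: dist_real_def)
      moreover have "t 0 \<le> t (j - 1)" "t j \<le> t n" by (intro tmono; use jn in simp)+
      ultimately have "dist (f (ereal r)) (f (ereal (t j))) < e"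
        using r1 tn by (intro \<delta>(2)) auto
      then show ?thesis using False jn r by (simp add: v_def dist_real_def)
    qed
    then show ?thesis unfolding S .
  qed
  then show thesis by (rule that[OF t0])
qed

text \<open>A limit law given by weights and images of one standard normal variable: half-normals
  are images under absolute values, point masses under constant maps. The weights are real numbers
  of either sign; only their sum is prescribed where a law is meant.\<close>

definition mixture_int :: "(real \<times> (real \<Rightarrow> ereal)) list \<Rightarrow> (ereal \<Rightarrow> real) \<Rightarrow> real" where
  "mixture_int xs f = (\<Sum>(a, \<phi>)\<leftarrow>xs. a * (\<integral>z. f (\<phi> z) \<partial>gauss))"

lemma integrable_std_normal_bounded:
  assumes "f \<in> borel_measurable borel" "\<And>z. \<bar>f z\<bar> \<le> (B::real)"
  shows "integrable gauss f"
proof -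
  interpret real_distribution gauss by (rule real_dist_normal_dist)
  show ?thesis by (rule integrable_const_bound[of _ B]) (use assms in auto)
qed

lemma mixture_int_lin:
  assumes xs: "\<And>a \<phi>. (a, \<phi>) \<in> set xs \<Longrightarrow> \<phi> \<in> borel_measurable borel"
    and f: "f \<in> borel_measurable borel" "\<And>y. \<bar>f y\<bar> \<le> B"
    and g: "g \<in> borel_measurable borel" "\<And>y. \<bar>g y\<bar> \<le> B'"
  shows "mixture_int xs (\<lambda>y. f y + c * g y) = mixture_int xs f + c * mixture_int xs g"
  using xs
proof (induction xs)
  case (Cons x xs)
  obtain a \<phi> where x: "x = (a, \<phi>)" by (cases x)
  have \<phi>: "\<phi> \<in> borel_measurable borel" using Cons.prems[of a \<phi>] x by simp
  have "integrable gauss (\<lambda>z. f (\<phi> z))" "integrable gauss (\<lambda>z. g (\<phi> z))"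
    using f g measurable_compose[OF \<phi>] by (auto intro!: integrable_std_normal_bounded)
  moreover have "mixture_int xs (\<lambda>y. f y + c * g y) = mixture_int xs f + c * mixture_int xs g"
    using Cons by auto
  ultimately show ?case by (simp add: mixture_int_def x algebra_simps)
qed (simp add: mixture_int_def)

lemma mixture_int_bound:
  assumes xs: "\<And>a \<phi>. (a, \<phi>) \<in> set xs \<Longrightarrow> \<phi> \<in> borel_measurable borel"
    and f: "f \<in> borel_measurable borel" "\<And>y. \<bar>f y\<bar> \<le> B"
  shows "\<bar>mixture_int xs f\<bar> \<le> B * (\<Sum>(a, \<phi>)\<leftarrow>xs. \<bar>a\<bar>)"
  using xs
proof (induction xs)
  case (Cons x xs)
  obtain a \<phi> where x: "x = (a, \<phi>)" by (cases x)
  have \<phi>: "\<phi> \<in> borel_measurable borel" using Cons.prems[of a \<phi>] x by simp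
  have int: "integrable gauss (\<lambda>z. f (\<phi> z))"
    using f measurable_compose[OF \<phi>] by (auto intro!: integrable_std_normal_bounded)
  have "\<bar>\<integral>z. f (\<phi> z) \<partial>gauss\<bar> \<le> (\<integral>z. \<bar>f (\<phi> z)\<bar> \<partial>gauss)"
    by (rule integral_abs_bound)
  also have "\<dots> \<le> (\<integral>z. B \<partial>gauss)"
    using int f(2) by (intro integral_mono integrable_std_normal_bounded[of "\<lambda>_. B" "\<bar>B\<bar>"]) auto
  also have "\<dots> = B" by simp
  finally have "\<bar>a * (\<integral>z. f (\<phi> z) \<partial>gauss)\<bar> \<le> B * \<bar>a\<bar>"
    unfolding abs_mult mult.commute[of B] by (rule mult_left_mono) simp
  moreover have "\<bar>mixture_int xs f\<bar> \<le> B * (\<Sum>(a, \<phi>)\<leftarrow>xs. \<bar>a\<bar>)" using Cons by auto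
  ultimately show ?case by (simp add: mixture_int_def x algebra_simps)
qed (simp add: mixture_int_def)

lemma cw_expect_add: "cw_expect b h p N (\<lambda>x. f x + g x) = cw_expect b h p N f + cw_expect b h p N g"
  by (simp add: cw_expect_def distrib_left sum.distrib add_divide_distrib)

lemma cw_expect_cmult: "cw_expect b h p N (\<lambda>x. c * f x) = c * cw_expect b h p N f"
  by (simp add: cw_expect_def mult.left_commute sum_distrib_left[symmetric])

lemma cw_expect_const: "cw_expect b h p N (\<lambda>x. c) = c"
  using cw_weight_sum_pos[of b h p N] by (simp add: cw_expect_def sum_distrib_right[symmetric])

lemma cw_expect_sum: "cw_expect b h p N (\<lambda>x. \<Sum>i\<in>I. f i x) = (\<Sum>i\<in>I. cw_expect b h p N (f i))"
  unfolding cw_expect_def sum_divide_distrib[symmetric] sum_distrib_left by (subst sum.swap) simp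

lemma cw_expect_diff_le:
  assumes "\<And>x. \<bar>f x - g x\<bar> \<le> e"
  shows "\<bar>cw_expect b h p N f - cw_expect b h p N g\<bar> \<le> e"
proof -
  have mono: "cw_expect b h p N u \<le> cw_expect b h p N v" if "\<And>x. u x \<le> v x" for u v
    unfolding cw_expect_def
    by (intro divide_right_mono sum_mono mult_left_mono that less_imp_le cw_weight_pos cw_weight_sum_pos)
  have "cw_expect b h p N f \<le> cw_expect b h p N (\<lambda>x. g x + e)" "cw_expect b h p N g \<le> cw_expect b h p N (\<lambda>x. f x + e)"
    using assms by (auto intro!: mono simp: abs_le_iff diff_le_eq add.commute)
  then show ?thesis by (simp add: cw_expect_add cw_expect_const)
qed

text \<open>A continuous function on the compact space [-\<infinity>,\<infinity>] is uniformly close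
  to a step function with nodes away from 0. Both sides are linear in the test function, and a
  uniform error e costs e on the left and e times the total absolute weight on the right.\<close>

lemma conv_dist_ereal_of_cdf:
  assumes xs: "\<And>a \<phi>. (a, \<phi>) \<in> set xs \<Longrightarrow> \<phi> \<in> borel_measurable borel"
    and one: "(\<Sum>(a, \<phi>)\<leftarrow>xs. a) = 1"
    and cdf: "\<And>t. t \<noteq> 0 \<Longrightarrow> (\<lambda>N. cw_expect b h p N (\<lambda>x. cdf_test t (T N x))) \<longlonglongrightarrow> mixture_int xs (cdf_test t)"
  shows "conv_dist_ereal (\<lambda>N f. cw_expect b h p N (\<lambda>x. f (T N x))) (mixture_int xs)"
  unfolding conv_dist_ereal_def
proof (intro allI impI)
  fix f :: "ereal \<Rightarrow> real" assume f: "continuous_on UNIV f" and "bounded (range f)"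
  then obtain B where B: "\<And>y. \<bar>f y\<bar> \<le> B" by (auto simp: bounded_iff)
  have fm: "f \<in> borel_measurable borel" by (rule borel_measurable_continuous_onI[OF f])
  define K where "K = (\<Sum>(a, \<phi>)\<leftarrow>xs. \<bar>a\<bar>)"
  have K: "K \<ge> 0" unfolding K_def by (intro sum_list_nonneg) auto
  show "(\<lambda>N. cw_expect b h p N (\<lambda>x. f (T N x))) \<longlonglongrightarrow> mixture_int xs f"
  proof (rule LIMSEQ_I)
    fix r :: real assume r: "r > 0"
    define e where "e = r / (K + 3)"
    have e: "e > 0" "(K + 2) * e < r" using r K by (auto simp: e_def field_simps)
    obtain n :: nat and t d c where t: "\<And>i. t i \<noteq> 0"
      and S: "\<And>y. \<bar>f y - (c + (\<Sum>i\<le>n. d i * cdf_test (t i) y))\<bar> \<le> e"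
      using continuous_ereal_step_approx[OF f e(1)] by metis
    define g where "g = (\<lambda>y. c + (\<Sum>i\<le>n. d i * cdf_test (t i) y))"
    have cb: "\<bar>cdf_test s y\<bar> \<le> 1" for s y by (simp add: cdf_test_def)
    have mg: "mixture_int xs (\<lambda>y. c + (\<Sum>i<k. d i * cdf_test (t i) y))
       = c + (\<Sum>i<k. d i * mixture_int xs (cdf_test (t i)))" for k
    proof (induction k)
      case 0
      have "mixture_int xs (\<lambda>y. c) = c * (\<Sum>(a, \<phi>)\<leftarrow>xs. a)"
        unfolding mixture_int_def by (induction xs) (auto simp: algebra_simps)
      then show ?case using one by simp
    next
      case (Suc k)
      have "\<bar>c + (\<Sum>i<k. d i * cdf_test (t i) y)\<bar> \<le> \<bar>c\<bar> + (\<Sum>i<k. \<bar>d i\<bar>)" for y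
      proof -
        have "\<bar>\<Sum>i<k. d i * cdf_test (t i) y\<bar> \<le> (\<Sum>i<k. \<bar>d i\<bar> * 1)"
          by (rule order_trans[OF sum_abs]) (unfold abs_mult, intro sum_mono mult_left_mono cb, simp)
        then show ?thesis unfolding mult_1_right by linarith
      qed
      then have "mixture_int xs (\<lambda>y. (c + (\<Sum>i<k. d i * cdf_test (t i) y)) + d k * cdf_test (t k) y)
        = mixture_int xs (\<lambda>y. c + (\<Sum>i<k. d i * cdf_test (t i) y)) + d k * mixture_int xs (cdf_test (t k))"
        by (intro mixture_int_lin[OF xs _ _ _ cb]) auto
      then show ?case using Suc by (simp add: add.assoc)
    qed
    have Lg: "mixture_int xs g = c + (\<Sum>i\<le>n. d i * mixture_int xs (cdf_test (t i)))"
      using mg[of "Suc n"] by (simp add: g_def lessThan_Suc_atMost)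
    have Eg: "cw_expect b h p N (\<lambda>x. g (T N x)) = c + (\<Sum>i\<le>n. d i * cw_expect b h p N (\<lambda>x. cdf_test (t i) (T N x)))" for N
      unfolding g_def by (simp add: cw_expect_add cw_expect_const cw_expect_sum cw_expect_cmult)
    have "(\<lambda>N. cw_expect b h p N (\<lambda>x. g (T N x))) \<longlonglongrightarrow> mixture_int xs g"
      unfolding Eg Lg by (intro tendsto_intros cdf t)
    then obtain N0 where N0: "\<And>N. N \<ge> N0 \<Longrightarrow> norm (cw_expect b h p N (\<lambda>x. g (T N x)) - mixture_int xs g) < e"
      using LIMSEQ_D e(1) by blast
    have gm: "g \<in> borel_measurable borel" unfolding g_def by measurable
    have "\<bar>mixture_int xs (\<lambda>y. f y - g y)\<bar> \<le> e * K"
      unfolding K_def by (intro mixture_int_bound xs) (use fm gm S in \<open>auto simp: g_def\<close>)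
    moreover have "mixture_int xs (\<lambda>y. f y + (-1) * g y) = mixture_int xs f + (-1) * mixture_int xs g"
    proof (rule mixture_int_lin[OF xs fm B gm])
      fix y show "\<bar>g y\<bar> \<le> B + e" using S[of y] B[of y] unfolding g_def by linarith
    qed
    ultimately have Lfg: "\<bar>mixture_int xs f - mixture_int xs g\<bar> \<le> e * K" by simp
    show "\<exists>N0. \<forall>N\<ge>N0. norm (cw_expect b h p N (\<lambda>x. f (T N x)) - mixture_int xs f) < r"
    proof (intro exI[of _ N0] allI impI)
      fix N assume N: "N \<ge> N0"
      have "\<bar>cw_expect b h p N (\<lambda>x. f (T N x)) - cw_expect b h p N (\<lambda>x. g (T N x))\<bar> \<le> e"
        by (intro cw_expect_diff_le) (use S in \<open>auto simp: g_def\<close>)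
      moreover have "(K + 2) * e = e * K + e + e" by (simp add: algebra_simps)
      ultimately show "norm (cw_expect b h p N (\<lambda>x. f (T N x)) - mixture_int xs f) < r"
        using N0[OF N] Lfg e(2) unfolding real_norm_def by linarith
    qed
  qed
qed

section \<open>Local limits of tilted powers\<close>

lemma power_le_exp:
  fixes y c :: real
  assumes "y \<ge> 0" "c > 0"
  shows "y ^ q \<le> (real q / c) ^ q * exp (c * y)"
proof (cases "q = 0")
  case True
  then show ?thesis using assms by simp
next
  case False
  have "c * y / real q \<le> exp (c * y / real q)" using exp_ge_add_one_self[of "c * y / real q"] by linarith
  then have "y \<le> real q / c * exp (c * y / real q)" using False assms by (simp add: field_simps)
  then have "y ^ q \<le> (real q / c * exp (c * y / real q)) ^ q" using assms by (intro power_mono) auto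
  also have "\<dots> = (real q / c) ^ q * exp (c * y)"
    unfolding power_mult_distrib exp_of_nat_mult[symmetric] using False by simp
  finally show ?thesis .
qed

lemma inverse_sqrt_tendsto_0: "u \<longlonglongrightarrow> w \<Longrightarrow> (\<lambda>N. u N / sqrt (real N)) \<longlonglongrightarrow> (0::real)"
proof -
  assume u: "u \<longlonglongrightarrow> w"
  have "(\<lambda>N. 1 / sqrt (real N)) \<longlonglongrightarrow> 0" by real_asymp
  from tendsto_mult[OF u this] show ?thesis by simp
qed

text \<open>The deviation of xbar^p from m^p magnified by sqrt N, as a function of w = sqrt N *
  (xbar - m). Its limit is the usual delta-method derivative.\<close>

definition pow_dev :: "nat \<Rightarrow> real \<Rightarrow> nat \<Rightarrow> real \<Rightarrow> real" where
  "pow_dev p m N w = sqrt (real N) * ((m + w / sqrt (real N)) ^ p - m ^ p)"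

lemma pow_dev_tendsto:
  assumes u: "u \<longlonglongrightarrow> w"
  shows "(\<lambda>N. pow_dev p m N (u N)) \<longlonglongrightarrow> real p * m ^ (p - 1) * w"
proof -
  obtain Q where Q: "continuous_on UNIV Q"
     "\<And>u. (m + u) ^ p = m ^ p + real p * m ^ (p - 1) * u + u\<^sup>2 * Q u"
    using power_second_order[of p m] by blast
  have Qcont: "isCont Q x" for x using Q(1) by (simp add: continuous_on_eq_continuous_at)
  have u0: "(\<lambda>N. u N / sqrt (real N)) \<longlonglongrightarrow> 0" by (rule inverse_sqrt_tendsto_0[OF u])
  have "(\<lambda>N. real p * m ^ (p - 1) * u N + u N * (u N / sqrt (real N)) * Q (u N / sqrt (real N)))
    \<longlonglongrightarrow> real p * m ^ (p - 1) * w + w * 0 * Q 0"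
    by (intro tendsto_intros u u0 isCont_tendsto_compose[OF Qcont])
  moreover have "eventually (\<lambda>N. real p * m ^ (p - 1) * u N + u N * (u N / sqrt (real N)) * Q (u N / sqrt (real N))
    = pow_dev p m N (u N)) sequentially"
    using eventually_gt_at_top[of "0::nat"]
  proof eventually_elim
    case (elim N)
    have "A * y + y * (y / s) * q = s * (M + A * (y / s) + (y / s)\<^sup>2 * q - M)" if "s > 0" for A y s q M :: real
      using that by (simp add: power2_eq_square field_simps)
    from this[of "sqrt (real N)"] show ?case unfolding pow_dev_def Q(2) using elim by simp
  qed
  ultimately show ?thesis using Lim_transform_eventually by fastforce
qed

text \<open>The range of w keeps m + w / sqrt N inside [-1,1], where the p-th power has Lipschitz
  constant p.\<close>

lemma pow_dev_bound:
  assumes "\<bar>m\<bar> \<le> 1" "\<bar>w\<bar> \<le> (1 - \<bar>m\<bar>) * sqrt (real N)"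
  shows "\<bar>pow_dev p m N w\<bar> \<le> real p * \<bar>w\<bar>"
proof (cases "N = 0")
  case False
  then have s: "sqrt (real N) > 0" by simp
  have "\<bar>w / sqrt (real N)\<bar> \<le> 1 - \<bar>m\<bar>" using assms(2) s by (simp add: abs_divide divide_le_eq)
  then have "\<bar>m + w / sqrt (real N)\<bar> \<le> 1" by linarith
  then have "\<bar>(m + w / sqrt (real N)) ^ p - m ^ p\<bar> \<le> real p * \<bar>(m + w / sqrt (real N)) - m\<bar>"
    using norm_power_diff[of "m + w / sqrt (real N)" m p] assms(1) by simp
  then have "sqrt (real N) * \<bar>(m + w / sqrt (real N)) ^ p - m ^ p\<bar> \<le> sqrt (real N) * (real p * \<bar>w / sqrt (real N)\<bar>)"
    using s by (intro mult_left_mono) auto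
  then show ?thesis using s by (simp add: pow_dev_def abs_mult)
qed (simp add: pow_dev_def)

text \<open>The exponential is the density of the tilt by t / sqrt N, normalized at the value
  \<open>M0\<close> of the selected peaks. Then (q, j) = (0, 0) gives the denominator of the tilted
  mean, (1, 1) its numerator at scale sqrt N, and (p, 1) with \<open>M0\<close> = 0 the numerator at
  the scale N^(p/2) proper to a peak at the origin.\<close>

definition tilt_pow :: "nat \<Rightarrow> real \<Rightarrow> real \<Rightarrow> nat \<Rightarrow> nat \<Rightarrow> nat \<Rightarrow> real \<Rightarrow> real" where
  "tilt_pow p M0 t q j N x = exp (t * sqrt (real N) * (x ^ p - M0)) * sqrt (real N) ^ q * (x ^ p - M0) ^ j"

lemma tilt_pow_measurable [measurable]: "tilt_pow p M0 t q j N \<in> borel_measurable borel"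
  unfolding tilt_pow_def by measurable

lemma tilt_pow_bound:
  assumes M0: "\<bar>M0\<bar> \<le> 1" and x: "\<bar>x\<bar> \<le> 1"
  shows "\<bar>tilt_pow p M0 t q j N x\<bar> \<le> (real q ^ q * 2 ^ j) * exp ((2 * \<bar>t\<bar> + 1) * sqrt (real N))"
proof -
  have "\<bar>x ^ p\<bar> \<le> 1" using x by (simp add: power_abs power_le_one)
  then have d: "\<bar>x ^ p - M0\<bar> \<le> 2" using M0 by linarith
  have "\<bar>t * sqrt (real N) * (x ^ p - M0)\<bar> \<le> \<bar>t\<bar> * sqrt (real N) * 2"
    unfolding abs_mult by (intro mult_mono d) auto
  then have "exp (t * sqrt (real N) * (x ^ p - M0)) \<le> exp (2 * \<bar>t\<bar> * sqrt (real N))" by simp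
  moreover have "sqrt (real N) ^ q \<le> real q ^ q * exp (sqrt (real N))"
    using power_le_exp[of "sqrt (real N)" 1 q] by simp
  moreover have "\<bar>(x ^ p - M0) ^ j\<bar> \<le> 2 ^ j" using d unfolding power_abs by (intro power_mono) auto
  ultimately have "\<bar>tilt_pow p M0 t q j N x\<bar> \<le> exp (2 * \<bar>t\<bar> * sqrt (real N)) * (real q ^ q * exp (sqrt (real N))) * 2 ^ j"
    unfolding tilt_pow_def abs_mult by (intro mult_mono) auto
  also have "\<dots> = (real q ^ q * 2 ^ j) * exp ((2 * \<bar>t\<bar> + 1) * sqrt (real N))"
    by (simp add: distrib_right exp_add)
  finally show ?thesis .
qed

lemma gaussian_growth_exI:
  assumes "0 < \<delta>" "\<And>N w. \<bar>w\<bar> \<le> \<delta> * sqrt (real N) \<Longrightarrow> \<bar>F N w\<bar> \<le> C * exp (c * \<bar>w\<bar>)"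
  shows "\<exists>\<delta>>0. \<exists>C c. \<forall>N w. \<bar>w\<bar> \<le> \<delta> * sqrt (real N) \<longrightarrow> \<bar>F N w\<bar> \<le> C * exp (c * \<bar>w\<bar> :: real)"
  using assms by blast

lemma gauss_local_tilt_pow_0:
  assumes m: "\<bar>m\<bar> < 1"
  shows "gauss_local (tilt_pow p (m ^ p) t 0 0) m (\<lambda>w. exp (t * (real p * m ^ (p - 1) * w)))"
  unfolding gauss_local_def
proof (intro conjI)
  have eq: "tilt_pow p (m ^ p) t 0 0 N (m + w / sqrt (real N)) = exp (t * pow_dev p m N w)" for N w
    by (simp add: tilt_pow_def pow_dev_def mult.assoc)
  show "\<exists>bad. finite bad \<and> (\<forall>w u. w \<notin> bad \<longrightarrow> u \<longlonglongrightarrow> w \<longrightarrow>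
    (\<lambda>N. tilt_pow p (m ^ p) t 0 0 N (m + u N / sqrt (real N))) \<longlonglongrightarrow> exp (t * (real p * m ^ (p - 1) * w)))"
    unfolding eq by (intro exI[of _ "{}"] conjI allI impI tendsto_exp tendsto_mult tendsto_const pow_dev_tendsto) auto
  show "\<exists>\<delta>>0. \<exists>C c. \<forall>N w. \<bar>w\<bar> \<le> \<delta> * sqrt (real N) \<longrightarrow>
     \<bar>tilt_pow p (m ^ p) t 0 0 N (m + w / sqrt (real N))\<bar> \<le> C * exp (c * \<bar>w\<bar>)"
    unfolding eq
  proof (rule gaussian_growth_exI[of "1 - \<bar>m\<bar>" _ 1 "\<bar>t\<bar> * real p"])
    fix N w assume "\<bar>w\<bar> \<le> (1 - \<bar>m\<bar>) * sqrt (real N)"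
    then have "\<bar>pow_dev p m N w\<bar> \<le> real p * \<bar>w\<bar>" using m by (intro pow_dev_bound) auto
    then have "\<bar>t * pow_dev p m N w\<bar> \<le> \<bar>t\<bar> * (real p * \<bar>w\<bar>)" unfolding abs_mult by (intro mult_left_mono) auto
    then show "\<bar>exp (t * pow_dev p m N w)\<bar> \<le> 1 * exp (\<bar>t\<bar> * real p * \<bar>w\<bar>)" by (simp add: mult.assoc)
  qed (use m in auto)
qed measurable

lemma gauss_local_tilt_pow_1:
  assumes m: "\<bar>m\<bar> < 1"
  shows "gauss_local (tilt_pow p (m ^ p) t 1 1) m
    (\<lambda>w. exp (t * (real p * m ^ (p - 1) * w)) * (real p * m ^ (p - 1) * w))"
  unfolding gauss_local_def
proof (intro conjI)
  have eq: "tilt_pow p (m ^ p) t 1 1 N (m + w / sqrt (real N)) = exp (t * pow_dev p m N w) * pow_dev p m N w" for N w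
    by (simp add: tilt_pow_def pow_dev_def mult.assoc)
  show "\<exists>bad. finite bad \<and> (\<forall>w u. w \<notin> bad \<longrightarrow> u \<longlonglongrightarrow> w \<longrightarrow>
    (\<lambda>N. tilt_pow p (m ^ p) t 1 1 N (m + u N / sqrt (real N))) \<longlonglongrightarrow>
       exp (t * (real p * m ^ (p - 1) * w)) * (real p * m ^ (p - 1) * w))"
    unfolding eq by (intro exI[of _ "{}"] conjI allI impI tendsto_exp tendsto_mult tendsto_const pow_dev_tendsto) auto
  show "\<exists>\<delta>>0. \<exists>C c. \<forall>N w. \<bar>w\<bar> \<le> \<delta> * sqrt (real N) \<longrightarrow>
     \<bar>tilt_pow p (m ^ p) t 1 1 N (m + w / sqrt (real N))\<bar> \<le> C * exp (c * \<bar>w\<bar>)"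
    unfolding eq
  proof (rule gaussian_growth_exI[of "1 - \<bar>m\<bar>" _ 1 "\<bar>t\<bar> * real p + real p"])
    fix N w assume "\<bar>w\<bar> \<le> (1 - \<bar>m\<bar>) * sqrt (real N)"
    then have d: "\<bar>pow_dev p m N w\<bar> \<le> real p * \<bar>w\<bar>" using m by (intro pow_dev_bound) auto
    then have "\<bar>t * pow_dev p m N w\<bar> \<le> \<bar>t\<bar> * (real p * \<bar>w\<bar>)" unfolding abs_mult by (intro mult_left_mono) auto
    then have "exp (t * pow_dev p m N w) \<le> exp (\<bar>t\<bar> * (real p * \<bar>w\<bar>))" by simp
    moreover have "\<bar>pow_dev p m N w\<bar> \<le> exp (real p * \<bar>w\<bar>)"
      using d exp_ge_add_one_self[of "real p * \<bar>w\<bar>"] by linarith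
    ultimately have "\<bar>exp (t * pow_dev p m N w) * pow_dev p m N w\<bar> \<le> exp (\<bar>t\<bar> * (real p * \<bar>w\<bar>)) * exp (real p * \<bar>w\<bar>)"
      unfolding abs_mult by (intro mult_mono) auto
    then show "\<bar>exp (t * pow_dev p m N w) * pow_dev p m N w\<bar> \<le> 1 * exp ((\<bar>t\<bar> * real p + real p) * \<bar>w\<bar>)"
      by (simp add: exp_add[symmetric] algebra_simps)
  qed (use m in auto)
qed measurable

text \<open>The derivative of x^p vanishes at 0, so the tilt has no effect in the limit; t drops out
  and only w^p remains.\<close>

lemma gauss_local_tilt_pow_at_0:
  assumes p: "p \<ge> 2"
  shows "gauss_local (tilt_pow p 0 t p 1) 0 (\<lambda>w. w ^ p)"
  unfolding gauss_local_def
proof (intro conjI)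
  \<comment> \<open>The quotient is not cancelled because the formula is also meant to hold for N =
    0, where division by zero gives 0.\<close>
  have eq: "tilt_pow p 0 t p 1 N (0 + w / sqrt (real N)) = exp (t * pow_dev p 0 N w) * (sqrt (real N) * (w / sqrt (real N))) ^ p" for N w
    unfolding tilt_pow_def pow_dev_def power_mult_distrib using p by (simp add: mult.assoc power_0_left)
  show "\<exists>bad. finite bad \<and> (\<forall>w u. w \<notin> bad \<longrightarrow> u \<longlonglongrightarrow> w \<longrightarrow>
    (\<lambda>N. tilt_pow p 0 t p 1 N (0 + u N / sqrt (real N))) \<longlonglongrightarrow> w ^ p)"
  proof (intro exI[of _ "{}"] conjI allI impI)
    fix u :: "nat \<Rightarrow> real" and w assume u: "u \<longlonglongrightarrow> w"
    have "(\<lambda>N. exp (t * pow_dev p 0 N (u N)) * u N ^ p) \<longlonglongrightarrow> exp (t * (real p * 0 ^ (p - 1) * w)) * w ^ p"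
      by (intro tendsto_intros pow_dev_tendsto u)
    also have "exp (t * (real p * 0 ^ (p - 1) * w)) * w ^ p = w ^ p" using p by (simp add: power_0_left)
    finally have *: "(\<lambda>N. exp (t * pow_dev p 0 N (u N)) * u N ^ p) \<longlonglongrightarrow> w ^ p" .
    have "eventually (\<lambda>N. exp (t * pow_dev p 0 N (u N)) * u N ^ p = tilt_pow p 0 t p 1 N (0 + u N / sqrt (real N))) sequentially"
      using eventually_gt_at_top[of "0::nat"] by eventually_elim (unfold eq, simp)
    with * show "(\<lambda>N. tilt_pow p 0 t p 1 N (0 + u N / sqrt (real N))) \<longlonglongrightarrow> w ^ p"
      by (rule Lim_transform_eventually)
  qed auto
  show "\<exists>\<delta>>0. \<exists>C c. \<forall>N w. \<bar>w\<bar> \<le> \<delta> * sqrt (real N) \<longrightarrow>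
     \<bar>tilt_pow p 0 t p 1 N (0 + w / sqrt (real N))\<bar> \<le> C * exp (c * \<bar>w\<bar>)"
    unfolding eq
  proof (rule gaussian_growth_exI[of 1 _ "real p ^ p" "\<bar>t\<bar> * real p + 1"])
    fix N w assume w: "\<bar>w\<bar> \<le> 1 * sqrt (real N)"
    then have d: "\<bar>pow_dev p 0 N w\<bar> \<le> real p * \<bar>w\<bar>" by (intro pow_dev_bound) auto
    then have "\<bar>t * pow_dev p 0 N w\<bar> \<le> \<bar>t\<bar> * (real p * \<bar>w\<bar>)" unfolding abs_mult by (intro mult_left_mono) auto
    then have "exp (t * pow_dev p 0 N w) \<le> exp (\<bar>t\<bar> * (real p * \<bar>w\<bar>))" by simp
    moreover have "\<bar>(sqrt (real N) * (w / sqrt (real N))) ^ p\<bar> \<le> real p ^ p * exp \<bar>w\<bar>"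
    proof -
      have "\<bar>(sqrt (real N) * (w / sqrt (real N))) ^ p\<bar> \<le> \<bar>w\<bar> ^ p"
        unfolding power_abs by (intro power_mono) auto
      then show ?thesis using power_le_exp[of "\<bar>w\<bar>" 1 p] by simp
    qed
    ultimately have "\<bar>exp (t * pow_dev p 0 N w) * (sqrt (real N) * (w / sqrt (real N))) ^ p\<bar>
       \<le> exp (\<bar>t\<bar> * (real p * \<bar>w\<bar>)) * (real p ^ p * exp \<bar>w\<bar>)"
      unfolding abs_mult[of "exp _"] by (intro mult_mono) auto
    also have "\<dots> = real p ^ p * exp ((\<bar>t\<bar> * real p + 1) * \<bar>w\<bar>)"
    proof -
      have "exp (\<bar>t\<bar> * (real p * \<bar>w\<bar>)) * exp \<bar>w\<bar> = exp ((\<bar>t\<bar> * real p + 1) * \<bar>w\<bar>)"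
        unfolding exp_add[symmetric] by (simp add: algebra_simps)
      then show ?thesis by simp
    qed
    finally show "\<bar>exp (t * pow_dev p 0 N w) * (sqrt (real N) * (w / sqrt (real N))) ^ p\<bar>
       \<le> real p ^ p * exp ((\<bar>t\<bar> * real p + 1) * \<bar>w\<bar>)" .
  qed auto
qed measurable

text \<open>At a peak that the tilt disfavours, the exponent is below -2 \<kappa> sqrt N throughout
  a neighbourhood. Half of this decay absorbs the power of sqrt N and the other half still tends to
  0.\<close>

lemma gauss_local_tilt_pow_negligible:
  assumes m: "\<bar>m\<bar> < 1" and neg: "t * (m ^ p - M0) < 0" and M0: "\<bar>M0\<bar> \<le> 1"
  shows "gauss_local (tilt_pow p M0 t q j) m (\<lambda>_. 0)"
proof -
  define \<kappa> where "\<kappa> = - (t * (m ^ p - M0)) / 4"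
  have k: "\<kappa> > 0" using neg by (simp add: \<kappa>_def)
  have "((\<lambda>x. t * (x ^ p - M0)) \<longlongrightarrow> t * (m ^ p - M0)) (nhds m)"
    by (intro tendsto_intros filterlim_ident)
  then have "eventually (\<lambda>x. t * (x ^ p - M0) < - (2 * \<kappa>)) (nhds m)"
    by (rule order_tendstoD(2)) (use neg in \<open>simp add: \<kappa>_def\<close>)
  then obtain d0 where d0: "d0 > 0" "\<And>x. \<bar>x - m\<bar> < d0 \<Longrightarrow> t * (x ^ p - M0) < - (2 * \<kappa>)"
    unfolding eventually_nhds_metric by (auto simp: dist_real_def)
  define \<delta> where "\<delta> = min (d0 / 2) (1 - \<bar>m\<bar>)"
  have \<delta>: "\<delta> > 0" "\<delta> < d0" "\<delta> \<le> 1 - \<bar>m\<bar>" using d0 m by (auto simp: \<delta>_def)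
  define C where "C = (real q / \<kappa>) ^ q * 2 ^ j"
  have C: "C \<ge> 0" using k by (simp add: C_def)
  have bd: "\<bar>tilt_pow p M0 t q j N (m + w / sqrt (real N))\<bar> \<le> C * exp (- \<kappa> * sqrt (real N))"
    if w: "\<bar>w\<bar> \<le> \<delta> * sqrt (real N)" for N w
  proof -
    define x where "x = m + w / sqrt (real N)"
    have xm: "\<bar>x - m\<bar> \<le> \<delta>"
      using w \<delta> by (cases "N = 0") (auto simp: x_def abs_divide divide_le_eq)
    then have "t * (x ^ p - M0) < - (2 * \<kappa>)" using \<delta> by (intro d0) auto
    then have "sqrt (real N) * (t * (x ^ p - M0)) \<le> sqrt (real N) * (- (2 * \<kappa>))"
      by (intro mult_left_mono) auto
    then have e: "exp (t * sqrt (real N) * (x ^ p - M0)) \<le> exp (- (2 * \<kappa>) * sqrt (real N))"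
      by (simp add: mult_ac)
    have "\<bar>x\<bar> \<le> 1" using xm \<delta> by linarith
    then have "\<bar>x ^ p\<bar> \<le> 1" by (simp add: power_abs power_le_one)
    then have "\<bar>x ^ p - M0\<bar> \<le> 2" using M0 by linarith
    then have j: "\<bar>(x ^ p - M0) ^ j\<bar> \<le> 2 ^ j" unfolding power_abs by (intro power_mono) auto
    have q: "sqrt (real N) ^ q \<le> (real q / \<kappa>) ^ q * exp (\<kappa> * sqrt (real N))"
      by (rule power_le_exp) (use k in auto)
    have "\<bar>tilt_pow p M0 t q j N x\<bar> \<le> exp (- (2 * \<kappa>) * sqrt (real N)) * ((real q / \<kappa>) ^ q * exp (\<kappa> * sqrt (real N))) * 2 ^ j"
      unfolding tilt_pow_def abs_mult using e q j k by (intro mult_mono) auto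
    also have "\<dots> = C * (exp (- (2 * \<kappa>) * sqrt (real N)) * exp (\<kappa> * sqrt (real N)))"
      by (simp add: C_def)
    also have "\<dots> = C * exp (- \<kappa> * sqrt (real N))" by (simp add: exp_add[symmetric])
    finally show ?thesis unfolding x_def .
  qed
  show ?thesis
    unfolding gauss_local_def
  proof (intro conjI)
    show "\<exists>bad. finite bad \<and> (\<forall>w u. w \<notin> bad \<longrightarrow> u \<longlonglongrightarrow> w \<longrightarrow>
       (\<lambda>N. tilt_pow p M0 t q j N (m + u N / sqrt (real N))) \<longlonglongrightarrow> 0)"
    proof (intro exI[of _ "{}"] conjI allI impI)
      fix u :: "nat \<Rightarrow> real" and w assume u: "u \<longlonglongrightarrow> w"
      have "eventually (\<lambda>N. \<bar>u N / sqrt (real N)\<bar> < \<delta>) sequentially"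
        using order_tendstoD(2)[OF tendsto_rabs[OF inverse_sqrt_tendsto_0[OF u]]] \<delta> by simp
      then have ev: "eventually (\<lambda>N. norm (tilt_pow p M0 t q j N (m + u N / sqrt (real N))) \<le> C * exp (- \<kappa> * sqrt (real N))) sequentially"
        using eventually_gt_at_top[of "0::nat"]
      proof eventually_elim
        case (elim N)
        then have "\<bar>u N\<bar> \<le> \<delta> * sqrt (real N)" by (simp add: abs_divide divide_less_eq)
        then show ?case using bd by simp
      qed
      have "(\<lambda>N::nat. exp (- \<kappa> * sqrt (real N))) \<longlonglongrightarrow> 0" using k by real_asymp
      from tendsto_mult_left[OF this, of C]
      have "(\<lambda>N::nat. C * exp (- \<kappa> * sqrt (real N))) \<longlonglongrightarrow> 0" by simp
      with ev show "(\<lambda>N. tilt_pow p M0 t q j N (m + u N / sqrt (real N))) \<longlonglongrightarrow> 0"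
        by (rule Lim_null_comparison)
    qed auto
    show "\<exists>\<delta>>0. \<exists>C c. \<forall>N w. \<bar>w\<bar> \<le> \<delta> * sqrt (real N) \<longrightarrow>
       \<bar>tilt_pow p M0 t q j N (m + w / sqrt (real N))\<bar> \<le> C * exp (c * \<bar>w\<bar>)"
    proof (rule gaussian_growth_exI[of \<delta> _ C 0])
      fix N w assume w: "\<bar>w\<bar> \<le> \<delta> * sqrt (real N)"
      have "C * exp (- \<kappa> * sqrt (real N)) \<le> C * 1" using C k by (intro mult_left_mono) auto
      then show "\<bar>tilt_pow p M0 t q j N (m + w / sqrt (real N))\<bar> \<le> C * exp (0 * \<bar>w\<bar>)"
        using bd[OF w] by simp
    qed (rule \<delta>)
  qed measurable
qed

section \<open>Local limits of threshold indicators\<close>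

lemma tendsto_le_indicator:
  fixes a c :: "nat \<Rightarrow> real"
  assumes "a \<longlonglongrightarrow> A" "c \<longlonglongrightarrow> B" "A \<noteq> B"
  shows "(\<lambda>N. if a N \<le> c N then 1 else 0 :: real) \<longlonglongrightarrow> (if A \<le> B then 1 else 0)"
proof (cases "A < B")
  case True
  have "eventually (\<lambda>N. a N < c N) sequentially"
    using order_tendstoD(2)[OF assms(1), of "(A + B) / 2"] order_tendstoD(1)[OF assms(2), of "(A + B) / 2"] True
    by (auto simp: field_simps elim: eventually_elim2)
  then show ?thesis using True by (intro tendsto_eventually) (auto elim: eventually_mono)
next
  case False
  then have lt: "B < A" using assms(3) by simp
  have "eventually (\<lambda>N. c N < a N) sequentially"
    using order_tendstoD(2)[OF assms(2), of "(A + B) / 2"] order_tendstoD(1)[OF assms(1), of "(A + B) / 2"] lt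
    by (auto simp: field_simps elim: eventually_elim2)
  then show ?thesis using lt by (intro tendsto_eventually) (auto elim: eventually_mono)
qed

definition pow_le :: "nat \<Rightarrow> (nat \<Rightarrow> real) \<Rightarrow> nat \<Rightarrow> real \<Rightarrow> real" where
  "pow_le p \<tau> N x = (if x ^ p \<le> \<tau> N then 1 else 0)"

lemma pow_le_measurable [measurable]: "pow_le p \<tau> N \<in> borel_measurable borel"
  unfolding pow_le_def by measurable

lemma gauss_local_pow_leI:
  assumes "g \<in> borel_measurable borel" "finite bad"
    "\<And>w u. w \<notin> bad \<Longrightarrow> u \<longlonglongrightarrow> w \<Longrightarrow> (\<lambda>N. pow_le p \<tau> N (m + u N / sqrt (real N))) \<longlonglongrightarrow> g w"
  shows "gauss_local (pow_le p \<tau>) m g"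
  unfolding gauss_local_def
proof (intro conjI)
  show "\<exists>\<delta>>0. \<exists>C c. \<forall>N w. \<bar>w\<bar> \<le> \<delta> * sqrt (real N) \<longrightarrow> \<bar>pow_le p \<tau> N (m + w / sqrt (real N))\<bar> \<le> C * exp (c * \<bar>w\<bar>)"
    by (rule gaussian_growth_exI[of 1 _ 1 0]) (auto simp: pow_le_def)
qed (use assms in auto)

lemma gauss_local_pow_le_off:
  assumes \<tau>: "\<tau> \<longlonglongrightarrow> M0" and ne: "m ^ p \<noteq> M0"
  shows "gauss_local (pow_le p \<tau>) m (\<lambda>_. if m ^ p \<le> M0 then 1 else 0)"
proof (rule gauss_local_pow_leI[of _ "{}"])
  fix w and u :: "nat \<Rightarrow> real" assume u: "u \<longlonglongrightarrow> w"
  have "(\<lambda>N. (m + u N / sqrt (real N)) ^ p) \<longlonglongrightarrow> (m + 0) ^ p"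
    by (intro tendsto_intros inverse_sqrt_tendsto_0[OF u])
  then have "(\<lambda>N. (m + u N / sqrt (real N)) ^ p) \<longlonglongrightarrow> m ^ p" by simp
  then show "(\<lambda>N. pow_le p \<tau> N (m + u N / sqrt (real N))) \<longlonglongrightarrow> (if m ^ p \<le> M0 then 1 else 0)"
    unfolding pow_le_def by (rule tendsto_le_indicator[OF _ \<tau> ne])
qed auto

text \<open>Both the power and the threshold deviate from m^p by order 1 / sqrt N, so the comparison
  survives in the limit. It is undecided only at the one w where the two limits agree.\<close>

lemma gauss_local_pow_le_on:
  assumes \<tau>: "(\<lambda>N. sqrt (real N) * (\<tau> N - m ^ p)) \<longlonglongrightarrow> c" and ne: "real p * m ^ (p - 1) \<noteq> 0"
  shows "gauss_local (pow_le p \<tau>) m (\<lambda>w. if real p * m ^ (p - 1) * w \<le> c then 1 else 0)"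
proof (rule gauss_local_pow_leI)
  show "(\<lambda>w. if real p * m ^ (p - 1) * w \<le> c then 1 else 0) \<in> borel_measurable borel" by measurable
  show "finite {c / (real p * m ^ (p - 1))}" by simp
  fix w and u :: "nat \<Rightarrow> real" assume w: "w \<notin> {c / (real p * m ^ (p - 1))}" and u: "u \<longlonglongrightarrow> w"
  have wc: "real p * m ^ (p - 1) * w \<noteq> c" using w ne by (auto simp: field_simps)
  have "(\<lambda>N. if pow_dev p m N (u N) \<le> sqrt (real N) * (\<tau> N - m ^ p) then 1 else 0 :: real)
    \<longlonglongrightarrow> (if real p * m ^ (p - 1) * w \<le> c then 1 else 0)"
    by (rule tendsto_le_indicator[OF pow_dev_tendsto[OF u] \<tau> wc])
  moreover have "eventually (\<lambda>N. (if pow_dev p m N (u N) \<le> sqrt (real N) * (\<tau> N - m ^ p) then 1 else 0)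
     = pow_le p \<tau> N (m + u N / sqrt (real N))) sequentially"
    using eventually_gt_at_top[of "0::nat"]
    by eventually_elim (simp add: pow_le_def pow_dev_def)
  ultimately show "(\<lambda>N. pow_le p \<tau> N (m + u N / sqrt (real N))) \<longlonglongrightarrow> (if real p * m ^ (p - 1) * w \<le> c then 1 else 0)"
    by (rule Lim_transform_eventually)
qed

lemma finite_power_eq: "p \<ge> 1 \<Longrightarrow> finite {w::real. w ^ p = c}"
proof -
  assume p: "p \<ge> 1"
  have "monom 1 p - [:c:] \<noteq> (0 :: real poly)"
  proof
    assume "monom 1 p - [:c:] = 0"
    then have "coeff (monom 1 p - [:c:]) p = 0" by simp
    then show False using p by (simp add: coeff_pCons split: nat.splits)
  qed
  from poly_roots_finite[OF this] show ?thesis by (simp add: poly_monom)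
qed

text \<open>At the origin the comparison takes place at scale N^(-p/2); the undecided points are the
  finitely many roots of w^p = c.\<close>

lemma gauss_local_pow_le_at_0:
  assumes \<tau>: "(\<lambda>N. sqrt (real N) ^ p * \<tau> N) \<longlonglongrightarrow> c" and p: "p \<ge> 1"
  shows "gauss_local (pow_le p \<tau>) 0 (\<lambda>w. if w ^ p \<le> c then 1 else 0)"
proof (rule gauss_local_pow_leI)
  show "(\<lambda>w. if w ^ p \<le> c then 1 else 0) \<in> borel_measurable borel" by measurable
  show "finite {w. w ^ p = c}" by (rule finite_power_eq[OF p])
  fix w and u :: "nat \<Rightarrow> real" assume w: "w \<notin> {w. w ^ p = c}" and u: "u \<longlonglongrightarrow> w"
  have "(\<lambda>N. if u N ^ p \<le> sqrt (real N) ^ p * \<tau> N then 1 else 0 :: real) \<longlonglongrightarrow> (if w ^ p \<le> c then 1 else 0)"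
    by (rule tendsto_le_indicator[OF tendsto_power[OF u] \<tau>]) (use w in auto)
  moreover have "eventually (\<lambda>N. (if u N ^ p \<le> sqrt (real N) ^ p * \<tau> N then 1 else 0)
     = pow_le p \<tau> N (0 + u N / sqrt (real N))) sequentially"
    using eventually_gt_at_top[of "0::nat"]
  proof eventually_elim
    case (elim N)
    then have "(u N / sqrt (real N)) ^ p \<le> \<tau> N \<longleftrightarrow> u N ^ p \<le> sqrt (real N) ^ p * \<tau> N"
      by (simp add: power_divide divide_le_eq mult.commute)
    then show ?case by (simp add: pow_le_def)
  qed
  ultimately show "(\<lambda>N. pow_le p \<tau> N (0 + u N / sqrt (real N))) \<longlonglongrightarrow> (if w ^ p \<le> c then 1 else 0)"
    by (rule Lim_transform_eventually)
qed

section \<open>Gaussian integrals under exponential tilts\<close>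

lemma std_normal_exp_tilt:
  fixes f :: "real \<Rightarrow> real"
  assumes [measurable]: "f \<in> borel_measurable borel"
  shows "(\<integral>z. f z * exp (c * z) \<partial>gauss) = exp (c\<^sup>2 / 2) * (\<integral>z. f (z + c) \<partial>gauss)"
proof -
  have "(\<integral>z. f z * exp (c * z) \<partial>gauss) = (\<integral>z. std_normal_density z * (f z * exp (c * z)) \<partial>lborel)"
    by (rule integral_std_normal_eq) measurable
  also have "\<dots> = \<bar>1\<bar> *\<^sub>R (\<integral>z. std_normal_density (c + 1 * z) * (f (c + 1 * z) * exp (c * (c + 1 * z))) \<partial>lborel)"
    by (rule lborel_integral_real_affine) simp
  also have "\<dots> = (\<integral>z. exp (c\<^sup>2 / 2) * (std_normal_density z * f (z + c)) \<partial>lborel)"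
  proof -
    have "std_normal_density (c + 1 * z) * (f (c + 1 * z) * exp (c * (c + 1 * z)))
       = exp (c\<^sup>2 / 2) * (std_normal_density z * f (z + c))" for z
    proof -
      have "- (c + z)\<^sup>2 / 2 + c * (c + z) = c\<^sup>2 / 2 + - z\<^sup>2 / 2"
        by (simp add: field_simps power2_eq_square)
      then have "exp (- (c + z)\<^sup>2 / 2) * exp (c * (c + z)) = exp (c\<^sup>2 / 2) * exp (- z\<^sup>2 / 2)"
        unfolding exp_add[symmetric] by simp
      then show ?thesis by (simp add: std_normal_density_def add.commute)
    qed
    then show ?thesis by simp
  qed
  also have "\<dots> = exp (c\<^sup>2 / 2) * (\<integral>z. f (z + c) \<partial>gauss)"
    by (subst integral_std_normal_eq) auto
  finally show ?thesis .
qed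

lemma std_normal_mgf: "(\<integral>z. exp (c * z) \<partial>gauss) = exp (c\<^sup>2 / 2)"
  using std_normal_exp_tilt[of "\<lambda>_. 1" c] by simp

text \<open>The shift identity turns the integral into the mean of z + c, so no differentiation
  under the integral is involved.\<close>

lemma std_normal_mgf_deriv: "(\<integral>z. z * exp (c * z) \<partial>gauss) = c * exp (c\<^sup>2 / 2)"
proof -
  have i: "integrable gauss (\<lambda>z. z)"
    using integrable_std_normal_distribution_moment[of 1] by simp
  have "(\<integral>z. z \<partial>gauss) = 0"
    using integral_std_normal_moment_odd[of 0] by (subst integral_std_normal_eq) auto
  then have "(\<integral>z. z + c \<partial>gauss) = c"
    using i by (subst Bochner_Integration.integral_add) (auto intro!: integrable_std_normal_bounded[of "\<lambda>_. c" "\<bar>c\<bar>"])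
  then show ?thesis using std_normal_exp_tilt[of "\<lambda>z. z" c] by simp
qed

lemma std_normal_eq: "std_normal = gauss"
  by (simp add: std_normal_def)

section \<open>Half-normal distribution functions\<close>

lemma std_normal_minus_integral:
  fixes f :: "real \<Rightarrow> real"
  assumes [measurable]: "f \<in> borel_measurable borel"
  shows "(\<integral>z. f (- z) \<partial>gauss) = (\<integral>z. f z \<partial>gauss)"
proof -
  have "(\<integral>z. f z \<partial>gauss) = (\<integral>z. std_normal_density z * f z \<partial>lborel)"
    by (rule integral_std_normal_eq) measurable
  also have "\<dots> = \<bar>-1\<bar> *\<^sub>R (\<integral>z. std_normal_density (0 + -1 * z) * f (0 + -1 * z) \<partial>lborel)"
    by (rule lborel_integral_real_affine) simp
  also have "\<dots> = (\<integral>z. f (- z) \<partial>gauss)"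
    by (subst integral_std_normal_eq) (auto simp: std_normal_density_def)
  finally show ?thesis by simp
qed

lemma cdf_test_integrable:
  "\<phi> \<in> borel_measurable borel \<Longrightarrow> integrable gauss (\<lambda>z. cdf_test t (\<phi> z))"
  by (rule integrable_std_normal_bounded[of _ 1]) (auto simp: cdf_test_def)

text \<open>Dividing by l^2 turns the event into z / l \<le> t, and z / l is centered normal with
  variance 1 / l^2; for negative l the symmetry of z is used. Here l is the slope of a peak and t
  l^2 the limit of its magnified threshold.\<close>

lemma Nint_cdf_scale:
  assumes "l \<noteq> 0"
  shows "(\<integral>z. (if l * z \<le> t * l\<^sup>2 then 1 else 0) \<partial>gauss) = Nint (1 / l\<^sup>2) (cdf_test t)"
proof (cases "l > 0")
  case True
  have "(if l * z \<le> t * l\<^sup>2 then 1 else 0) = cdf_test t (ereal (sqrt (1 / l\<^sup>2) * z))" for z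
    using True by (simp add: cdf_test_def real_sqrt_divide field_simps power2_eq_square)
  then show ?thesis by (simp add: Nint_def std_normal_eq)
next
  case False
  then have l: "l < 0" using assms by simp
  have "(if l * z \<le> t * l\<^sup>2 then 1 else 0) = cdf_test t (ereal (sqrt (1 / l\<^sup>2) * (- z)))" for z
    using l by (simp add: cdf_test_def real_sqrt_divide field_simps power2_eq_square)
  then have "(\<integral>z. (if l * z \<le> t * l\<^sup>2 then 1 else 0) \<partial>gauss)
    = (\<integral>z. cdf_test t (ereal (sqrt (1 / l\<^sup>2) * (- z))) \<partial>gauss)" by simp
  also have "\<dots> = Nint (1 / l\<^sup>2) (cdf_test t)"
    unfolding Nint_def std_normal_eq
    by (rule std_normal_minus_integral[of "\<lambda>z. cdf_test t (ereal (sqrt (1 / l\<^sup>2) * z))"]) measurable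
  finally show ?thesis .
qed

lemma Nint_cdf_add_reflected:
  "(\<integral>z. cdf_test t (ereal (sqrt s * z)) + cdf_test t (ereal (sqrt s * (- z))) \<partial>gauss)
    = 2 * Nint s (cdf_test t)"
proof -
  have "(\<integral>z. cdf_test t (ereal (sqrt s * (- z))) \<partial>gauss) = Nint s (cdf_test t)"
    unfolding Nint_def std_normal_eq
    by (rule std_normal_minus_integral[of "\<lambda>z. cdf_test t (ereal (sqrt s * z))"]) measurable
  then show ?thesis
    by (subst Bochner_Integration.integral_add) (auto intro!: cdf_test_integrable simp: Nint_def std_normal_eq)
qed

text \<open>For t > 0 at least one of y \<le> t and -y \<le> t holds, and both hold exactly when |y|
  \<le> t; so the indicator is the sum of the two minus 1.\<close>

lemma Nplus_cdf_pos:
  assumes "t > 0" shows "Nplus s (cdf_test t) = 2 * Nint s (cdf_test t) - 1"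
proof -
  have "cdf_test t (ereal \<bar>sqrt s * z\<bar>) = (cdf_test t (ereal (sqrt s * z)) + cdf_test t (ereal (sqrt s * (- z)))) - 1" for z
    using assms by (auto simp: cdf_test_def abs_if)
  then have "Nplus s (cdf_test t) = (\<integral>z. (cdf_test t (ereal (sqrt s * z)) + cdf_test t (ereal (sqrt s * (- z)))) - 1 \<partial>gauss)"
    by (simp add: Nplus_def std_normal_eq)
  also have "\<dots> = 2 * Nint s (cdf_test t) - (\<integral>z. 1 \<partial>gauss)"
    unfolding Nint_cdf_add_reflected[symmetric]
    by (intro Bochner_Integration.integral_diff Bochner_Integration.integrable_add cdf_test_integrable
        integrable_std_normal_bounded[of "\<lambda>_. 1" 1]) auto
  finally show ?thesis by simp
qed

lemma Nplus_cdf_neg: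
  assumes "t < 0" shows "Nplus s (cdf_test t) = 0"
proof -
  have "cdf_test t (ereal \<bar>sqrt s * z\<bar>) = 0" for z using assms by (auto simp: cdf_test_def)
  then show ?thesis by (simp add: Nplus_def)
qed

lemma Nminus_cdf_pos:
  assumes "t > 0" shows "Nminus s (cdf_test t) = 1"
proof -
  have "cdf_test t (ereal (- \<bar>sqrt s * z\<bar>)) = 1" for z using assms by (auto simp: cdf_test_def)
  then show ?thesis by (simp add: Nminus_def std_normal_eq)
qed

lemma Nminus_cdf_neg:
  assumes "t < 0" shows "Nminus s (cdf_test t) = 2 * Nint s (cdf_test t)"
proof -
  have "cdf_test t (ereal (- \<bar>sqrt s * z\<bar>)) = cdf_test t (ereal (sqrt s * z)) + cdf_test t (ereal (sqrt s * (- z)))" for z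
    using assms by (auto simp: cdf_test_def abs_if)
  then show ?thesis unfolding Nint_cdf_add_reflected[symmetric] by (simp add: Nminus_def std_normal_eq)
qed

lemma gamma_p_eq:
  "gamma_p p = (\<integral>z. (if z ^ p \<le> (\<integral>w. w ^ p \<partial>gauss) then 1 else 0) \<partial>gauss)"
proof -
  let ?A = "{z. z ^ p \<le> (\<integral>w. w ^ p \<partial>gauss)}"
  have "(\<integral>z. (if z ^ p \<le> (\<integral>w. w ^ p \<partial>gauss) then 1 else 0) \<partial>gauss)
    = (\<integral>z. indicator ?A z \<partial>gauss)"
    by (intro Bochner_Integration.integral_cong) (auto simp: indicator_def)
  also have "\<dots> = measure gauss ?A" by simp
  finally show ?thesis by (simp add: gamma_p_def std_normal_eq)
qed

text \<open>For odd p the mean of Z^p is 0 and the event is Z \<le> 0. This is why the atom at minus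
  infinity has half the weight of the peak at the origin.\<close>

lemma gamma_p_odd:
  assumes "odd p" shows "gamma_p p = 1 / 2"
proof -
  obtain k where k: "p = 2 * k + 1" using assms oddE by blast
  have mu: "(\<integral>w. w ^ p \<partial>gauss) = 0"
    unfolding k using integral_std_normal_moment_odd[of k] by (subst integral_std_normal_eq) simp_all
  define f where "f = (\<lambda>z::real. if z \<le> 0 then 1 else 0 :: real)"
  have fm: "f \<in> borel_measurable borel" unfolding f_def by measurable
  have int: "integrable gauss f" "integrable gauss (\<lambda>z. f (- z))"
    by (rule integrable_std_normal_bounded[of _ 1]; auto simp: f_def)+
  have g: "gamma_p p = (\<integral>z. f z \<partial>gauss)"
    unfolding gamma_p_eq mu f_def using assms by (simp add: power_le_zero_eq odd_pos)
  have "AE z in gauss. f z + f (- z) = 1"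
    using AE_std_normal_notin_finite[of "{0}"] by (auto simp: f_def elim: eventually_mono)
  then have "(\<integral>z. f z + f (- z) \<partial>gauss) = (\<integral>z. 1 \<partial>gauss)"
    using fm by (intro integral_cong_AE) auto
  also have "(\<integral>z. f z + f (- z) \<partial>gauss) = 2 * gamma_p p"
    using int std_normal_minus_integral[OF fm] g by simp
  finally show ?thesis by simp
qed

section \<open>Limit laws\<close>

text \<open>The shift by t / sqrt N multiplies each weight by exp(t sqrt N xbar^p); the constant
  exp(t sqrt N a) cancels between numerator and denominator. The threshold becomes a ratio of two
  expectations under the law at b.\<close>

lemma tilted_mean_scaled:
  assumes "N > 0"
  shows "sqrt (real N) ^ q * (cw_expect (b + t / sqrt (real N)) h p N (\<lambda>y. xbar N y ^ p) - a)
    = cw_expect b h p N (\<lambda>x. tilt_pow p a t q 1 N (xbar N x)) / cw_expect b h p N (\<lambda>x. tilt_pow p a t 0 0 N (xbar N x))"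
proof -
  define s where "s = sqrt (real N)"
  have s: "s > 0" "s * s = real N" using assms by (auto simp: s_def)
  define u where "u = cw_weight b h p N"
  define e where "e = (\<lambda>x. exp (t * s * (xbar N x ^ p - a)))"
  define c where "c = exp (t * s * a)"
  have w: "cw_weight (b + t / s) h p N x = c * (u x * e x)" for x
  proof -
    have "real N * (t / s) = t * s" using s by (simp add: s(2)[symmetric])
    then show ?thesis unfolding cw_weight_shift u_def e_def c_def
      by (simp add: exp_add[symmetric] algebra_simps)
  qed
  have up: "(\<Sum>x\<in>configs N. u x) > 0" unfolding u_def by (rule cw_weight_sum_pos)
  have uep: "(\<Sum>x\<in>configs N. u x * e x) > 0"
    by (intro sum_pos) (auto simp: u_def e_def cw_weight_pos)
  have c: "c > 0" by (simp add: c_def)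
  have tilt: "cw_expect (b + t / s) h p N (\<lambda>y. xbar N y ^ p) = (\<Sum>x\<in>configs N. u x * e x * xbar N x ^ p) / (\<Sum>x\<in>configs N. u x * e x)"
    unfolding cw_expect_def w using c by (simp add: mult.assoc sum_distrib_left[symmetric])
  have "cw_expect (b + t / s) h p N (\<lambda>y. xbar N y ^ p) - a
    = (\<Sum>x\<in>configs N. u x * e x * (xbar N x ^ p - a)) / (\<Sum>x\<in>configs N. u x * e x)"
  proof -
    have "(\<Sum>x\<in>configs N. u x * e x * (xbar N x ^ p - a))
      = (\<Sum>x\<in>configs N. u x * e x * xbar N x ^ p) - a * (\<Sum>x\<in>configs N. u x * e x)"
      by (simp add: right_diff_distrib sum_subtractf sum_distrib_left mult_ac)
    then show ?thesis using uep tilt by (simp add: diff_divide_distrib)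
  qed
  moreover have "cw_expect b h p N (\<lambda>x. tilt_pow p a t q 1 N (xbar N x))
     = s ^ q * (\<Sum>x\<in>configs N. u x * e x * (xbar N x ^ p - a)) / (\<Sum>x\<in>configs N. u x)"
    unfolding cw_expect_def tilt_pow_def u_def e_def s_def by (simp add: sum_distrib_left mult_ac)
  moreover have "cw_expect b h p N (\<lambda>x. tilt_pow p a t 0 0 N (xbar N x))
     = (\<Sum>x\<in>configs N. u x * e x) / (\<Sum>x\<in>configs N. u x)"
    unfolding cw_expect_def tilt_pow_def u_def e_def s_def by simp
  ultimately show ?thesis using up uep unfolding s_def[symmetric] by simp
qed

locale critical_cw =
  fixes b h :: real and p :: nat
  assumes p: "p \<ge> 3" and b: "b \<ge> 0" and crit: "p_critical b h p"
begin

abbreviation "M \<equiv> maximizers b h p"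
abbreviation "wt \<equiv> peak_weight b p"
abbreviation "sd \<equiv> peak_sd b p"

definition "W = (\<Sum>m\<in>M. wt m)"

definition tau :: "real \<Rightarrow> nat \<Rightarrow> real" where
  "tau t N = cw_expect (b + t / sqrt (real N)) h p N (\<lambda>y. xbar N y ^ p)"

abbreviation "Tlaw \<equiv> (\<lambda>N f. cw_expect b h p N (\<lambda>x. f (Tstat b h p N x)))"
abbreviation "cw_mean N f \<equiv> cw_expect b h p N (\<lambda>x. f (xbar N x))"
abbreviation "prob_le t \<equiv> (\<lambda>N. cw_mean N (pow_le p (tau t) N))"
text \<open>The limiting distribution function when the tilt selects the peaks with m^p = y: they
  contribute a normal distribution function, and every other peak lies wholly below or wholly above
  the threshold.\<close>

abbreviation "peak_cdf t y L \<equiv>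
  (\<Sum>m\<in>M. wt m * (if m ^ p = y then Nint (1 / L) (cdf_test t) else if m ^ p \<le> y then 1 else 0)) / W"

text \<open>The limiting standard deviation of sqrt N * (xbar^p - m^p), up to sign. Its inverse
  square is the variance \<sigma>^2 of the limit theorem.\<close>

definition slope :: "real \<Rightarrow> real" where
  "slope m = real p * m ^ (p - 1) * sd m"

lemma finM: "finite M" and ddneg: "m \<in> M \<Longrightarrow> ddHfun b p m < 0"
  using critical_nondegenerate[OF p b crit] by auto

lemma M_interior: "m \<in> M \<Longrightarrow> \<bar>m\<bar> < 1"
  by (rule maximizers_interior)

lemma curv_pos: assumes "m \<in> M" shows "curv b p m > 0"
proof -
  have "m\<^sup>2 < 1" using M_interior[OF assms] by (simp add: abs_square_less_1)
  then show ?thesis unfolding curv_eq[OF M_interior[OF assms]] using ddneg[OF assms] by (simp add: mult_neg_neg)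
qed

lemma wt_pos: "m \<in> M \<Longrightarrow> wt m > 0"
  using curv_pos by (force simp: peak_weight_def)

lemma sd_sq: assumes "m \<in> M" shows "(sd m)\<^sup>2 = - 1 / ddHfun b p m"
proof -
  have m2: "m\<^sup>2 < 1" using M_interior[OF assms] by (simp add: abs_square_less_1)
  have "(curv b p m powr (-1/2))\<^sup>2 = 1 / curv b p m"
    using curv_pos[OF assms] by (simp add: power2_eq_square powr_add[symmetric] powr_minus_divide)
  then have "(sd m)\<^sup>2 = (1 - m\<^sup>2) * (1 / curv b p m)"
    using m2 unfolding peak_sd_def power_mult_distrib by simp
  also have "\<dots> = - 1 / ddHfun b p m"
    unfolding curv_eq[OF M_interior[OF assms]] using m2 ddneg[OF assms] by (simp add: field_simps)
  finally show ?thesis .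
qed

lemma slope_sq:
  assumes "m \<in> M" shows "1 / (slope m)\<^sup>2 = - ddHfun b p m / (real p ^ 2 * m ^ (2 * p - 2))"
proof -
  have "(m ^ (p - 1))\<^sup>2 = m ^ (2 * p - 2)" by (simp add: power_mult[symmetric] diff_mult_distrib2 mult.commute)
  then have "(slope m)\<^sup>2 = (real p ^ 2 * m ^ (2 * p - 2)) * (- 1 / ddHfun b p m)"
    unfolding slope_def power_mult_distrib sd_sq[OF assms] by simp
  then show ?thesis by simp
qed

lemma slope_nonzero: assumes "m \<in> M" "m \<noteq> 0" shows "slope m \<noteq> 0"
proof -
  have "(sd m)\<^sup>2 \<noteq> 0" unfolding sd_sq[OF assms(1)] using ddneg[OF assms(1)] by simp
  then show ?thesis unfolding slope_def using assms(2) p by auto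
qed

lemma M_nonempty: "M \<noteq> {}"
  using crit by (auto simp: p_critical_def)

lemma W_pos: "W > 0"
  unfolding W_def by (intro sum_pos finM M_nonempty wt_pos)

text \<open>The Laplace asymptotics for G divided by those for the constant 1; the exponential
  normalization cancels.\<close>

lemma expect_limit:
  assumes G: "\<And>N. G N \<in> borel_measurable borel"
    and loc: "\<And>m. m \<in> M \<Longrightarrow> gauss_local G m (g m)"
    and glob: "\<And>N x. \<bar>x\<bar> \<le> 1 \<Longrightarrow> \<bar>G N x\<bar> \<le> C * exp (c * sqrt (real N))"
  shows "(\<lambda>N. cw_mean N (G N))
    \<longlonglongrightarrow> (\<Sum>m\<in>M. wt m * (\<integral>z. g m (sd m * z) \<partial>gauss)) / W"
proof -
  obtain m0 where m0: "m0 \<in> M" using M_nonempty by blast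
  define Hm where "Hm = Hfun b h p m0"
  have Hm: "Hfun b h p m = Hm" if "m \<in> M" for m
    unfolding Hm_def by (rule maximizers_eq[OF that m0])
  have nd: "\<bar>m\<bar> < 1 \<and> artanh m = h + b * real p * m ^ (p - 1) \<and> curv b p m > 0" if "m \<in> M" for m
    using M_interior[OF that] artanh_maximizer[OF that] curv_pos[OF that] by blast
  have 1: "(\<lambda>N. (\<Sum>x\<in>configs N. cw_weight b h p N x * G N (xbar N x)) / (2 ^ N * exp (real N * Hm)))
    \<longlonglongrightarrow> (\<Sum>m\<in>M. wt m * (\<integral>z. g m (sd m * z) \<partial>gauss))"
    by (rule cw_laplace[OF finM Hm M_nonempty nd G loc glob])
  have "gauss_local (\<lambda>_ _. 1) m (\<lambda>_. 1)" for m
    unfolding gauss_local_def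
  proof (intro conjI)
    show "\<exists>\<delta>>0. \<exists>C c. \<forall>N w. \<bar>w\<bar> \<le> \<delta> * sqrt (real N) \<longrightarrow> \<bar>1\<bar> \<le> C * exp (c * \<bar>w\<bar>)"
      by (rule gaussian_growth_exI[of 1 _ 1 0]) auto
  qed auto
  then have "(\<lambda>N. (\<Sum>x\<in>configs N. cw_weight b h p N x * 1) / (2 ^ N * exp (real N * Hm)))
    \<longlonglongrightarrow> (\<Sum>m\<in>M. wt m * (\<integral>z. 1 \<partial>gauss))"
    by (intro cw_laplace[OF finM Hm M_nonempty nd, where G = "\<lambda>_ _. 1" and C = 1 and c = 0]) auto
  then have 2: "(\<lambda>N. (\<Sum>x\<in>configs N. cw_weight b h p N x) / (2 ^ N * exp (real N * Hm))) \<longlonglongrightarrow> W"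
    by (simp add: W_def)
  have "(\<lambda>N. ((\<Sum>x\<in>configs N. cw_weight b h p N x * G N (xbar N x)) / (2 ^ N * exp (real N * Hm))) /
     ((\<Sum>x\<in>configs N. cw_weight b h p N x) / (2 ^ N * exp (real N * Hm))))
    \<longlonglongrightarrow> (\<Sum>m\<in>M. wt m * (\<integral>z. g m (sd m * z) \<partial>gauss)) / W"
    using W_pos by (intro tendsto_divide 1 2) auto
  then show ?thesis by (simp add: cw_expect_def)
qed

lemma abs_pow_le_1: "m \<in> M \<Longrightarrow> \<bar>m ^ p\<bar> \<le> 1"
  using M_interior[of m] by (simp add: power_abs power_le_one)

lemma pow_le_limit:
  assumes "\<And>m. m \<in> M \<Longrightarrow> gauss_local (pow_le p \<tau>) m (g m)"
  shows "(\<lambda>N. cw_mean N (pow_le p \<tau> N))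
    \<longlonglongrightarrow> (\<Sum>m\<in>M. wt m * (\<integral>z. g m (sd m * z) \<partial>gauss)) / W"
  by (rule expect_limit[OF _ assms, where C = 1 and c = 0]) (auto simp: pow_le_def)

text \<open>Only the peaks with m^p = M0 survive the tilt. Each gives exp(t^2 L / 2) in the
  denominator and t L times that in the numerator, so their weights cancel and the magnified
  threshold tends to t L. The common value L is demanded because, for even p, the peaks m and -m are
  selected together.\<close>

lemma cdf_limit_nonzero_peak:
  assumes ex: "m0 \<in> M" "m0 ^ p = M0" and dom: "\<And>m. m \<in> M \<Longrightarrow> m ^ p \<noteq> M0 \<Longrightarrow> t * (m ^ p - M0) < 0"
    and M0: "M0 \<noteq> 0" and L: "\<And>m. m \<in> M \<Longrightarrow> m ^ p = M0 \<Longrightarrow> (slope m)\<^sup>2 = L"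
  shows "prob_le t \<longlonglongrightarrow>
    peak_cdf t M0 L"
proof -
  have nz: "m \<noteq> 0" if "m ^ p = M0" for m using that M0 p by auto
  have M01: "\<bar>M0\<bar> \<le> 1" using abs_pow_le_1[OF ex(1)] ex(2) by simp
  define gD where "gD = (\<lambda>m. if m ^ p = M0 then (\<lambda>w. exp (t * (real p * m ^ (p - 1) * w))) else (\<lambda>_. 0))"
  define gN where "gN = (\<lambda>m. if m ^ p = M0
    then (\<lambda>w. exp (t * (real p * m ^ (p - 1) * w)) * (real p * m ^ (p - 1) * w)) else (\<lambda>_. 0))"
  define D where "D = (\<Sum>m\<in>M. wt m * (if m ^ p = M0 then exp (t\<^sup>2 * L / 2) else 0)) / W"
  have D: "D > 0"
  proof -
    have "0 < (\<Sum>m\<in>M. wt m * (if m ^ p = M0 then exp (t\<^sup>2 * L / 2) else 0))"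
      using ex by (intro sum_pos2[OF finM ex(1)]) (auto simp: wt_pos less_imp_le)
    then show ?thesis using W_pos by (simp add: D_def)
  qed
  have Dlim: "(\<lambda>N. cw_mean N (tilt_pow p M0 t 0 0 N)) \<longlonglongrightarrow> D"
  proof -
    have "(\<lambda>N. cw_mean N (tilt_pow p M0 t 0 0 N)) \<longlonglongrightarrow>
      (\<Sum>m\<in>M. wt m * (\<integral>z. gD m (sd m * z) \<partial>gauss)) / W"
    proof (rule expect_limit)
      fix m assume m: "m \<in> M"
      show "gauss_local (tilt_pow p M0 t 0 0) m (gD m)"
        unfolding gD_def
        using gauss_local_tilt_pow_0[OF M_interior[OF m], of p t]
          gauss_local_tilt_pow_negligible[OF M_interior[OF m] dom[OF m] M01] by auto
    qed (use tilt_pow_bound[OF M01] in auto)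
    also have "(\<Sum>m\<in>M. wt m * (\<integral>z. gD m (sd m * z) \<partial>gauss)) / W = D"
      unfolding D_def
    proof (intro arg_cong2[of _ _ _ _ "(/)"] sum.cong refl arg_cong2[of _ _ _ _ "(*)"])
      fix m assume m: "m \<in> M"
      have "(\<integral>z. exp (t * (real p * m ^ (p - 1) * (sd m * z))) \<partial>gauss) = exp (t\<^sup>2 * L / 2)" if "m ^ p = M0"
        using std_normal_mgf[of "t * slope m"] L[OF m that] by (simp add: slope_def power_mult_distrib mult_ac)
      then show "(\<integral>z. gD m (sd m * z) \<partial>gauss)
        = (if m ^ p = M0 then exp (t\<^sup>2 * L / 2) else 0)" by (simp add: gD_def)
    qed
    finally show ?thesis .
  qed
  have Nlim: "(\<lambda>N. cw_mean N (tilt_pow p M0 t 1 1 N)) \<longlonglongrightarrow> t * L * D"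
  proof -
    have "(\<lambda>N. cw_mean N (tilt_pow p M0 t 1 1 N)) \<longlonglongrightarrow>
      (\<Sum>m\<in>M. wt m * (\<integral>z. gN m (sd m * z) \<partial>gauss)) / W"
    proof (rule expect_limit)
      fix m assume m: "m \<in> M"
      show "gauss_local (tilt_pow p M0 t 1 1) m (gN m)"
        unfolding gN_def
        using gauss_local_tilt_pow_1[OF M_interior[OF m], of p t]
          gauss_local_tilt_pow_negligible[OF M_interior[OF m] dom[OF m] M01] by auto
    qed (use tilt_pow_bound[OF M01] in auto)
    also have "(\<Sum>m\<in>M. wt m * (\<integral>z. gN m (sd m * z) \<partial>gauss)) / W
      = (\<Sum>m\<in>M. wt m * (t * L * (if m ^ p = M0 then exp (t\<^sup>2 * L / 2) else 0))) / W"
    proof (intro arg_cong2[of _ _ _ _ "(/)"] sum.cong refl arg_cong2[of _ _ _ _ "(*)"])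
      fix m assume m: "m \<in> M"
      have "(\<integral>z. exp (t * (real p * m ^ (p - 1) * (sd m * z))) * (real p * m ^ (p - 1) * (sd m * z)) \<partial>gauss)
        = t * L * exp (t\<^sup>2 * L / 2)" if "m ^ p = M0"
      proof -
        have "(\<integral>z. exp (t * (real p * m ^ (p - 1) * (sd m * z))) * (real p * m ^ (p - 1) * (sd m * z)) \<partial>gauss)
          = (\<integral>z. slope m * (z * exp ((t * slope m) * z)) \<partial>gauss)"
          by (simp add: slope_def mult_ac)
        also have "\<dots> = slope m * (t * slope m * exp ((t * slope m)\<^sup>2 / 2))"
          by (simp only: integral_mult_right_zero std_normal_mgf_deriv)
        also have "\<dots> = t * (slope m)\<^sup>2 * exp (t\<^sup>2 * (slope m)\<^sup>2 / 2)"
          by (simp add: power_mult_distrib power2_eq_square)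
        finally show ?thesis unfolding L[OF m that] .
      qed
      then show "(\<integral>z. gN m (sd m * z) \<partial>gauss)
        = t * L * (if m ^ p = M0 then exp (t\<^sup>2 * L / 2) else 0)" by (simp add: gN_def)
    qed
    also have "\<dots> = t * L * D"
      unfolding D_def by (simp add: sum_distrib_left mult_ac)
    finally show ?thesis .
  qed
  have "(\<lambda>N. cw_mean N (tilt_pow p M0 t 1 1 N) / cw_mean N (tilt_pow p M0 t 0 0 N))
     \<longlonglongrightarrow> t * L * D / D"
    using D by (intro tendsto_divide Nlim Dlim) auto
  moreover have "eventually (\<lambda>N. cw_mean N (tilt_pow p M0 t 1 1 N) / cw_mean N (tilt_pow p M0 t 0 0 N)
     = sqrt (real N) * (tau t N - M0)) sequentially"
    using eventually_gt_at_top[of "0::nat"]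
    by eventually_elim (use tilted_mean_scaled[where q = 1] in \<open>simp add: tau_def\<close>)
  ultimately have tl: "(\<lambda>N. sqrt (real N) * (tau t N - M0)) \<longlonglongrightarrow> t * L"
    using D by (auto dest: Lim_transform_eventually)
  have "(\<lambda>N. sqrt (real N) * (tau t N - M0) / sqrt (real N)) \<longlonglongrightarrow> 0"
    by (rule inverse_sqrt_tendsto_0[OF tl])
  moreover have "eventually (\<lambda>N. sqrt (real N) * (tau t N - M0) / sqrt (real N) = tau t N - M0) sequentially"
    using eventually_gt_at_top[of "0::nat"] by eventually_elim simp
  ultimately have "(\<lambda>N. tau t N - M0) \<longlonglongrightarrow> 0" by (rule Lim_transform_eventually)
  then have t0: "tau t \<longlonglongrightarrow> M0" by (rule LIM_zero_cancel)
  \<comment> \<open>The law of xbar is untilted, so here all peaks count: selected ones through the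
    comparison at scale 1 / sqrt N, the others through the sign of m^p - M0.\<close>
  have "prob_le t \<longlonglongrightarrow>
    (\<Sum>m\<in>M. wt m * (\<integral>z. (if m ^ p = M0 then (\<lambda>w. if real p * m ^ (p - 1) * w \<le> t * L then 1 else 0)
        else (\<lambda>_. if m ^ p \<le> M0 then 1 else 0)) (sd m * z) \<partial>gauss)) / W"
  proof (rule pow_le_limit)
    fix m assume m: "m \<in> M"
    show "gauss_local (pow_le p (tau t)) m (if m ^ p = M0 then (\<lambda>w. if real p * m ^ (p - 1) * w \<le> t * L then 1 else 0)
        else (\<lambda>_. if m ^ p \<le> M0 then 1 else 0))"
      using gauss_local_pow_le_on[of "tau t" m p "t * L"] gauss_local_pow_le_off[OF t0, of m p] tl nz[of m] p by auto
  qed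
  also have "(\<Sum>m\<in>M. wt m * (\<integral>z. (if m ^ p = M0 then (\<lambda>w. if real p * m ^ (p - 1) * w \<le> t * L then 1 else 0)
        else (\<lambda>_. if m ^ p \<le> M0 then 1 else 0)) (sd m * z) \<partial>gauss))
    = (\<Sum>m\<in>M. wt m * (if m ^ p = M0 then Nint (1 / L) (cdf_test t) else if m ^ p \<le> M0 then 1 else 0))"
  proof (intro sum.cong refl arg_cong2[of _ _ _ _ "(*)"])
    fix m assume m: "m \<in> M"
    have "(\<integral>z. (if real p * m ^ (p - 1) * (sd m * z) \<le> t * L then 1 else 0) \<partial>gauss) = Nint (1 / L) (cdf_test t)"
      if "m ^ p = M0"
      using Nint_cdf_scale[OF slope_nonzero[OF m nz[OF that]], of t] L[OF m that] by (simp add: slope_def mult.assoc)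
    then show "(\<integral>z. (if m ^ p = M0 then (\<lambda>w. if real p * m ^ (p - 1) * w \<le> t * L then 1 else 0)
        else (\<lambda>_. if m ^ p \<le> M0 then 1 else 0)) (sd m * z) \<partial>gauss)
      = (if m ^ p = M0 then Nint (1 / L) (cdf_test t) else if m ^ p \<le> M0 then 1 else 0)" by simp
  qed
  finally show ?thesis .
qed

lemma peak_at_0: "wt 0 = 1" "sd 0 = 1"
  using p by (auto simp: peak_weight_def peak_sd_def curv_def power_0_left)

text \<open>For t < 0 the tilt suppresses all peaks with m^p > 0, and the threshold is about
  N^(-p/2) times the mean of Z^p. Every other peak lies above it, and at the origin w^p is compared
  with that mean. The limit is the same for all t < 0, so it is the mass of an atom at minus
  infinity.\<close>

lemma cdf_limit_zero_peak:
  assumes ex: "0 \<in> M" and dom: "\<And>m. m \<in> M \<Longrightarrow> m \<noteq> 0 \<Longrightarrow> m ^ p > 0" and t: "t < 0"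
  shows "prob_le t \<longlonglongrightarrow> wt 0 * gamma_p p / W"
proof -
  have p0: "(0::real) ^ p = 0" using p by simp
  have neg: "t * (m ^ p - 0) < 0" if "m \<in> M" "m \<noteq> 0" for m
    using dom[OF that] t by (simp add: mult_neg_pos)
  define \<mu> where "\<mu> = (\<integral>w. w ^ p \<partial>gauss)"
  have only0: "(\<Sum>m\<in>M. wt m * (if m = 0 then c else 0)) = wt 0 * c" for c
    using ex finM by (subst sum.remove[OF finM ex]) (auto intro!: sum.neutral)
  have lim: "(\<lambda>N. cw_mean N (tilt_pow p 0 t q j N)) \<longlonglongrightarrow> wt 0 * (\<integral>z. g z \<partial>gauss) / W"
    if g: "gauss_local (tilt_pow p 0 t q j) 0 g" for q j g
  proof -
    have "(\<lambda>N. cw_mean N (tilt_pow p 0 t q j N)) \<longlonglongrightarrow>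
      (\<Sum>m\<in>M. wt m * (\<integral>z. (if m = 0 then g else (\<lambda>_. 0)) (sd m * z) \<partial>gauss)) / W"
    proof (rule expect_limit)
      fix m assume m: "m \<in> M"
      show "gauss_local (tilt_pow p 0 t q j) m (if m = 0 then g else (\<lambda>_. 0))"
        using g gauss_local_tilt_pow_negligible[OF M_interior[OF m] neg[OF m]] by auto
    qed (use tilt_pow_bound[of 0] in auto)
    also have "(\<Sum>m\<in>M. wt m * (\<integral>z. (if m = 0 then g else (\<lambda>_. 0)) (sd m * z) \<partial>gauss))
      = (\<Sum>m\<in>M. wt m * (if m = 0 then (\<integral>z. g z \<partial>gauss) else 0))"
      by (intro sum.cong) (auto simp: peak_at_0)
    finally show ?thesis unfolding only0 .
  qed
  have den: "(\<lambda>N. cw_mean N (tilt_pow p 0 t 0 0 N)) \<longlonglongrightarrow> wt 0 / W"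
    using lim[OF gauss_local_tilt_pow_0[of 0 p t, unfolded p0]] p by (simp add: power_0_left)
  have num: "(\<lambda>N. cw_mean N (tilt_pow p 0 t p 1 N)) \<longlonglongrightarrow> wt 0 * \<mu> / W"
    unfolding \<mu>_def using p by (intro lim gauss_local_tilt_pow_at_0) auto
  have "(\<lambda>N. cw_mean N (tilt_pow p 0 t p 1 N) / cw_mean N (tilt_pow p 0 t 0 0 N))
     \<longlonglongrightarrow> (wt 0 * \<mu> / W) / (wt 0 / W)"
    using W_pos wt_pos[OF ex] by (intro tendsto_divide num den) auto
  moreover have "eventually (\<lambda>N. cw_mean N (tilt_pow p 0 t p 1 N) / cw_mean N (tilt_pow p 0 t 0 0 N)
     = sqrt (real N) ^ p * tau t N) sequentially"
    using eventually_gt_at_top[of "0::nat"]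
    by eventually_elim (use tilted_mean_scaled[where q = p and a = 0] in \<open>simp add: tau_def\<close>)
  ultimately have tl: "(\<lambda>N. sqrt (real N) ^ p * tau t N) \<longlonglongrightarrow> \<mu>"
    using W_pos wt_pos[OF ex] by (auto dest: Lim_transform_eventually)
  have "(\<lambda>N. (1 / sqrt (real N)) ^ p * (sqrt (real N) ^ p * tau t N)) \<longlonglongrightarrow> 0 ^ p * \<mu>"
    by (intro tendsto_mult tendsto_power tl inverse_sqrt_tendsto_0[OF tendsto_const])
  moreover have "eventually (\<lambda>N. (1 / sqrt (real N)) ^ p * (sqrt (real N) ^ p * tau t N) = tau t N) sequentially"
    using eventually_gt_at_top[of "0::nat"] by eventually_elim (simp add: power_divide)
  ultimately have "tau t \<longlonglongrightarrow> 0 ^ p * \<mu>" by (rule Lim_transform_eventually)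
  then have t0: "tau t \<longlonglongrightarrow> 0" unfolding p0 by simp
  have "prob_le t \<longlonglongrightarrow>
    (\<Sum>m\<in>M. wt m * (\<integral>z. (if m = 0 then (\<lambda>w. if w ^ p \<le> \<mu> then 1 else 0) else (\<lambda>_. 0)) (sd m * z) \<partial>gauss)) / W"
  proof (rule pow_le_limit)
    fix m assume m: "m \<in> M"
    show "gauss_local (pow_le p (tau t)) m (if m = 0 then (\<lambda>w. if w ^ p \<le> \<mu> then 1 else 0) else (\<lambda>_. 0))"
    proof (cases "m = 0")
      case True
      then show ?thesis using gauss_local_pow_le_at_0[OF tl] p by simp
    next
      case False
      then show ?thesis using gauss_local_pow_le_off[OF t0, of m p] dom[OF m False] by simp
    qed
  qed
  also have "(\<Sum>m\<in>M. wt m * (\<integral>z. (if m = 0 then (\<lambda>w. if w ^ p \<le> \<mu> then 1 else 0) else (\<lambda>_. 0)) (sd m * z) \<partial>gauss))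
     = (\<Sum>m\<in>M. wt m * (if m = 0 then gamma_p p else 0))"
    by (intro sum.cong) (auto simp: peak_at_0 gamma_p_eq \<mu>_def)
  finally show ?thesis unfolding only0 .
qed

lemma Tstat_conv_dist:
  assumes xs: "\<And>a \<phi>. (a, \<phi>) \<in> set xs \<Longrightarrow> \<phi> \<in> borel_measurable borel"
    and one: "(\<Sum>(a, \<phi>)\<leftarrow>xs. a) = 1" and L: "\<And>f. L f = mixture_int xs f"
    and cdf: "\<And>t. t \<noteq> 0 \<Longrightarrow> prob_le t \<longlonglongrightarrow> L (cdf_test t)"
  shows "conv_dist_ereal Tlaw L"
proof -
  have "(\<lambda>N. cw_expect b h p N (\<lambda>x. cdf_test t (Tstat b h p N x))) \<longlonglongrightarrow> mixture_int xs (cdf_test t)"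
    if t: "t \<noteq> 0" for t
  proof -
    have "eventually (\<lambda>N. cw_expect b h p N (\<lambda>x. pow_le p (tau t) N (xbar N x))
       = cw_expect b h p N (\<lambda>x. cdf_test t (Tstat b h p N x))) sequentially"
      using eventually_ge_at_top[of "2::nat"]
    proof eventually_elim
      case (elim N)
      then have "pow_le p (tau t) N (xbar N x) = cdf_test t (Tstat b h p N x)" for x
        using Tstat_le_iff[of N p b h x t] p by (simp add: pow_le_def cdf_test_def tau_def)
      then show ?case by simp
    qed
    with cdf[OF t] show ?thesis unfolding L by (rule Lim_transform_eventually)
  qed
  from conv_dist_ereal_of_cdf[OF xs one this] show ?thesis
    by (simp add: L[abs_def] eta_contract_eq)
qed

text \<open>For t > 0 the limit is wt lo / W + (wt hi / W) * \<Phi>(t), for t < 0 it is (wt lo / W)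
  * \<Phi>(t), each \<Phi> with the variance of its peak. As \<Phi>(0) = 1/2, the jump at 0 is half
  the total weight, whatever the individual weights are.\<close>

lemma two_nonzero_peaks:
  assumes M: "M = {lo, hi}" and lt: "lo ^ p < hi ^ p" and nz: "lo \<noteq> 0" "hi \<noteq> 0"
  shows "conv_dist_ereal Tlaw
    (\<lambda>f. wt lo / W / 2 * Nminus (1 / (slope lo)\<^sup>2) f + wt hi / W / 2 * Nplus (1 / (slope hi)\<^sup>2) f + 1 / 2 * f 0)"
proof (rule Tstat_conv_dist[where xs = "[(wt lo / W / 2, \<lambda>z. ereal (- \<bar>sqrt (1 / (slope lo)\<^sup>2) * z\<bar>)),
      (wt hi / W / 2, \<lambda>z. ereal \<bar>sqrt (1 / (slope hi)\<^sup>2) * z\<bar>), (1 / 2, \<lambda>_. 0)]"])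
  have ne: "lo \<noteq> hi" using lt by auto
  then have W: "W = wt lo + wt hi" using M by (simp add: W_def)
  have pos: "wt lo > 0" "wt hi > 0" using M wt_pos by auto
  have W2: "wt lo / W + wt hi / W = 1" using W W_pos by (simp add: add_divide_distrib[symmetric])
  show "(\<Sum>(a, \<phi>)\<leftarrow>[(wt lo / W / 2, \<lambda>z. ereal (- \<bar>sqrt (1 / (slope lo)\<^sup>2) * z\<bar>)),
      (wt hi / W / 2, \<lambda>z. ereal \<bar>sqrt (1 / (slope hi)\<^sup>2) * z\<bar>), (1 / 2, \<lambda>_. 0)]. a) = 1"
    using W2 by simp
  fix t :: real assume t: "t \<noteq> 0"
  have p0: "lo ^ p \<noteq> 0" "hi ^ p \<noteq> 0" using nz by auto
  show "prob_le t \<longlonglongrightarrow>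
     wt lo / W / 2 * Nminus (1 / (slope lo)\<^sup>2) (cdf_test t) + wt hi / W / 2 * Nplus (1 / (slope hi)\<^sup>2) (cdf_test t) + 1 / 2 * cdf_test t 0"
  proof (cases "t > 0")
    case True
    have "prob_le t \<longlonglongrightarrow>
      peak_cdf t (hi ^ p) ((slope hi)\<^sup>2)"
      by (rule cdf_limit_nonzero_peak[OF _ refl]) (use M lt p0 True in \<open>auto simp: mult_pos_neg\<close>)
    also have "peak_cdf t (hi ^ p) ((slope hi)\<^sup>2)
      = wt lo / W + wt hi / W * Nint (1 / (slope hi)\<^sup>2) (cdf_test t)"
      unfolding M using ne lt by (simp add: add_divide_distrib)
    \<comment> \<open>The last summand is the mass 1/2 of the atom, kept as half the sum of the
      relative weights until \<open>W2\<close> evaluates it.\<close>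
    also have "\<dots> = wt lo / W / 2 * 1 + wt hi / W / 2 * (2 * Nint (1 / (slope hi)\<^sup>2) (cdf_test t) - 1) + (wt lo / W + wt hi / W) / 2 * 1"
      by (simp add: algebra_simps add_divide_distrib diff_divide_distrib)
    finally show ?thesis
      unfolding W2 Nplus_cdf_pos[OF True] Nminus_cdf_pos[OF True] using True by (simp add: cdf_test_def)
  next
    case False
    then have neg: "t < 0" using t by simp
    have "prob_le t \<longlonglongrightarrow>
      peak_cdf t (lo ^ p) ((slope lo)\<^sup>2)"
      by (rule cdf_limit_nonzero_peak[OF _ refl]) (use M lt p0 neg in \<open>auto simp: mult_neg_pos\<close>)
    also have "peak_cdf t (lo ^ p) ((slope lo)\<^sup>2)
      = wt lo / W * Nint (1 / (slope lo)\<^sup>2) (cdf_test t)"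
      unfolding M using ne lt by simp
    finally show ?thesis
      unfolding Nplus_cdf_neg[OF neg] Nminus_cdf_neg[OF neg] using neg by (simp add: cdf_test_def)
  qed
qed (auto simp: mixture_int_def Nplus_def Nminus_def std_normal_eq)

text \<open>For t > 0 the nonzero peak is selected as in the case of two nonzero peaks. For t < 0
  the origin is selected, and the lower half-normal degenerates to an atom at minus
  infinity.\<close>

lemma zero_and_positive_peak_odd:
  assumes M: "M = {0, m}" and m: "m ^ p > 0" and odd: "odd p"
  shows "conv_dist_ereal Tlaw
    (\<lambda>f. wt 0 / W / 2 * f (-\<infinity>) + wt m / W / 2 * Nplus (1 / (slope m)\<^sup>2) f + 1 / 2 * f 0)"
proof (rule Tstat_conv_dist[where xs = "[(wt 0 / W / 2, \<lambda>_. -\<infinity>),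
      (wt m / W / 2, \<lambda>z. ereal \<bar>sqrt (1 / (slope m)\<^sup>2) * z\<bar>), (1 / 2, \<lambda>_. 0)]"])
  have p0: "(0::real) ^ p = 0" using p by simp
  have ne: "m \<noteq> 0"
  proof
    assume "m = 0"
    then show False using m by (simp add: p0)
  qed
  then have W: "W = wt 0 + wt m" using M by (simp add: W_def)
  have W2: "wt 0 / W + wt m / W = 1" using W W_pos by (simp add: add_divide_distrib[symmetric])
  show "(\<Sum>(a, \<phi>)\<leftarrow>[(wt 0 / W / 2, \<lambda>_. -\<infinity>),
      (wt m / W / 2, \<lambda>z. ereal \<bar>sqrt (1 / (slope m)\<^sup>2) * z\<bar>), (1 / 2, \<lambda>_. 0)]. a) = 1"
    using W2 by simp
  fix t :: real assume t: "t \<noteq> 0"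
  show "prob_le t \<longlonglongrightarrow>
     wt 0 / W / 2 * cdf_test t (-\<infinity>) + wt m / W / 2 * Nplus (1 / (slope m)\<^sup>2) (cdf_test t) + 1 / 2 * cdf_test t 0"
  proof (cases "t > 0")
    case True
    have "prob_le t \<longlonglongrightarrow>
      peak_cdf t (m ^ p) ((slope m)\<^sup>2)"
    proof (rule cdf_limit_nonzero_peak[OF _ refl])
      show "m \<in> M" unfolding M by simp
      show "m ^ p \<noteq> 0" by (rule less_imp_neq[OF m, symmetric])
      fix x assume x: "x \<in> M"
      show "t * (x ^ p - m ^ p) < 0" if "x ^ p \<noteq> m ^ p"
      proof -
        have "x = 0" using x that unfolding M by blast
        then show ?thesis using mult_pos_neg[OF True, of "- (m ^ p)"] m unfolding p0 by (simp only: diff_0 neg_less_0_iff_less p0)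
      qed
      show "(slope x)\<^sup>2 = (slope m)\<^sup>2" if "x ^ p = m ^ p"
      proof -
        have "x \<noteq> 0" using that m unfolding p0 by (metis less_irrefl p0)
        then have "x = m" using x unfolding M by blast
        then show ?thesis by simp
      qed
    qed
    also have "peak_cdf t (m ^ p) ((slope m)\<^sup>2)
      = wt 0 / W + wt m / W * Nint (1 / (slope m)\<^sup>2) (cdf_test t)"
    proof -
      have "\<not> (0::real) ^ p = m ^ p" "(0::real) ^ p \<le> m ^ p" using m unfolding p0 by linarith+
      then show ?thesis unfolding M using ne by (simp only: sum.insert finite.intros insert_iff empty_iff sum.empty if_True if_False simp_thms) (simp add: add_divide_distrib)
    qed
    also have "\<dots> = wt 0 / W / 2 * 1 + wt m / W / 2 * (2 * Nint (1 / (slope m)\<^sup>2) (cdf_test t) - 1) + (wt 0 / W + wt m / W) / 2 * 1"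
      by (simp add: algebra_simps add_divide_distrib diff_divide_distrib)
    finally show ?thesis
      unfolding W2 Nplus_cdf_pos[OF True] using True by (simp add: cdf_test_def)
  next
    case False
    then have neg: "t < 0" using t by simp
    have "prob_le t \<longlonglongrightarrow> wt 0 * gamma_p p / W"
      by (rule cdf_limit_zero_peak) (use M m neg in auto)
    then show ?thesis
      unfolding Nplus_cdf_neg[OF neg] gamma_p_odd[OF odd] using neg by (simp add: cdf_test_def mult.commute)
  qed
qed (auto simp: mixture_int_def Nplus_def std_normal_eq)

lemma even_peak_minus:
  assumes "even p" shows "wt (- m) = wt m" "(slope (- m))\<^sup>2 = (slope m)\<^sup>2"
  using assms by (auto simp: peak_weight_def curv_def slope_def peak_sd_def power_mult_distrib power2_eq_square)

text \<open>Both peaks have the same p-th power and the same squared slope, so each sign of t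
  selects both. Nothing jumps at 0 and the mixture collapses to one normal law.\<close>

lemma two_symmetric_peaks:
  assumes M: "M = {- m, m}" and m: "m > 0" and ev: "even p"
  shows "conv_dist_ereal Tlaw (\<lambda>f. Nint (1 / (slope m)\<^sup>2) f)"
proof (rule Tstat_conv_dist[where xs = "[(1, \<lambda>z. ereal (sqrt (1 / (slope m)\<^sup>2) * z))]"])
  fix t :: real assume t: "t \<noteq> 0"
  have W: "W = 2 * wt m" using M m even_peak_minus[OF ev, of m] by (simp add: W_def)
  have "prob_le t \<longlonglongrightarrow>
      peak_cdf t (m ^ p) ((slope m)\<^sup>2)"
    by (rule cdf_limit_nonzero_peak[OF _ refl]) (use M m ev even_peak_minus in auto)
  also have "peak_cdf t (m ^ p) ((slope m)\<^sup>2)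
    = Nint (1 / (slope m)\<^sup>2) (cdf_test t)"
    unfolding M using m ev even_peak_minus[OF ev, of m] W W_pos by simp
  finally show "prob_le t \<longlonglongrightarrow> Nint (1 / (slope m)\<^sup>2) (cdf_test t)" .
qed (auto simp: mixture_int_def Nint_def std_normal_eq)

text \<open>For t > 0 the limit is wt 0 / W + 2 (wt m / W) * \<Phi>(t), that is, wt m / W times the
  half-normal distribution function plus 1 - wt m / W. For t < 0 only the share
  \<open>gamma_p\<close> of the central peak is counted, and the rest of the mass goes to the atom
  at 0.\<close>

lemma three_symmetric_peaks:
  assumes M: "M = {- m, 0, m}" and m: "m > 0" and ev: "even p"
  shows "conv_dist_ereal Tlaw
    (\<lambda>f. wt 0 / W * gamma_p p * f (-\<infinity>) + wt (- m) / W * Nplus (1 / (slope m)\<^sup>2) f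
      + (1 - wt (- m) / W - wt 0 / W * gamma_p p) * f 0)"
proof (rule Tstat_conv_dist[where xs = "[(wt 0 / W * gamma_p p, \<lambda>_. -\<infinity>),
      (wt (- m) / W, \<lambda>z. ereal \<bar>sqrt (1 / (slope m)\<^sup>2) * z\<bar>),
      (1 - wt (- m) / W - wt 0 / W * gamma_p p, \<lambda>_. 0)]"])
  have p0: "(0::real) ^ p = 0" and mp: "m ^ p > 0" using p m by simp_all
  have wtm: "wt (- m) = wt m" by (rule even_peak_minus[OF ev])
  have W: "W = wt 0 + 2 * wt m" using M m wtm by (simp add: W_def)
  have "(wt 0 + 2 * wt m) / W = 1" using W W_pos by simp
  then have W2: "1 = wt 0 / W + 2 * (wt m / W)" by (simp add: add_divide_distrib)
  fix t :: real assume t: "t \<noteq> 0"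
  show "prob_le t \<longlonglongrightarrow>
     wt 0 / W * gamma_p p * cdf_test t (-\<infinity>) + wt (- m) / W * Nplus (1 / (slope m)\<^sup>2) (cdf_test t)
      + (1 - wt (- m) / W - wt 0 / W * gamma_p p) * cdf_test t 0"
  proof (cases "t > 0")
    case True
    have "prob_le t \<longlonglongrightarrow>
      peak_cdf t (m ^ p) ((slope m)\<^sup>2)"
    proof (rule cdf_limit_nonzero_peak[OF _ refl])
      show "m \<in> M" "m ^ p \<noteq> 0" using M m by auto
      fix x assume x: "x \<in> M"
      show "t * (x ^ p - m ^ p) < 0" if "x ^ p \<noteq> m ^ p"
      proof -
        have "x = 0" using x M that ev by auto
        then show ?thesis using mp True by (simp add: p0 mult_pos_neg)
      qed
      show "(slope x)\<^sup>2 = (slope m)\<^sup>2" if "x ^ p = m ^ p"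
      proof -
        have "x = m \<or> x = - m" using x M that mp by (auto simp: p0)
        then show ?thesis using even_peak_minus(2)[OF ev] by auto
      qed
    qed
    also have "peak_cdf t (m ^ p) ((slope m)\<^sup>2)
      = wt 0 / W + 2 * (wt m / W * Nint (1 / (slope m)\<^sup>2) (cdf_test t))"
      unfolding M using m mp ev wtm by (simp add: add_divide_distrib p0)
    also have "\<dots> = wt m / W * (2 * Nint (1 / (slope m)\<^sup>2) (cdf_test t) - 1) + (wt 0 / W + 2 * (wt m / W) - wt m / W)"
      by (simp add: algebra_simps)
    finally show ?thesis
      unfolding W2[symmetric] Nplus_cdf_pos[OF True] wtm using True by (simp add: cdf_test_def algebra_simps)
  next
    case False
    then have neg: "t < 0" using t by simp
    have "prob_le t \<longlonglongrightarrow> wt 0 * gamma_p p / W"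
      by (rule cdf_limit_zero_peak) (use M m neg ev in auto)
    then show ?thesis
      unfolding Nplus_cdf_neg[OF neg] using neg by (simp add: cdf_test_def)
  qed
qed (auto simp: mixture_int_def Nplus_def std_normal_eq)

end

lemma power_strict_mono_odd:
  fixes x y :: real
  assumes n: "odd n" and xy: "x < y"
  shows "x ^ n < y ^ n"
proof -
  have n0: "n > 0" using n by (rule odd_pos)
  consider "0 \<le> x" | "y \<le> 0" | "x < 0" "0 < y" by linarith
  then show ?thesis
  proof cases
    case 1
    then show ?thesis using xy n0 by (intro power_strict_mono) auto
  next
    case 2
    then have "(- y) ^ n < (- x) ^ n" using xy n0 by (intro power_strict_mono) auto
    then show ?thesis using n by simp
  next
    case 3
    then have "x ^ n < 0" "0 < y ^ n" using n by auto
    then show ?thesis by linarith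
  qed
qed

theorem mainTheorem8:
  fixes p :: nat and \<beta> h :: real
  assumes hp: "p \<ge> 3" and hbeta: "\<beta> \<ge> 0" and hcrit: "p_critical \<beta> h p"
  defines "ms \<equiv> sorted_list_of_set (maximizers \<beta> h p)"
  defines "m \<equiv> (\<lambda>k::nat. ms ! (k - 1))"
  defines "H2 \<equiv> deriv (deriv (Hfun \<beta> h p))"
  defines "w \<equiv> (\<lambda>x::real. ((x\<^sup>2 - 1) * H2 x) powr (-1/2))"
  defines "pk \<equiv> (\<lambda>k::nat. w (m k) / (\<Sum>i\<leftarrow>ms. w i))"
  defines "sig2 \<equiv> (\<lambda>k::nat. - H2 (m k) / (real p ^ 2 * m k ^ (2 * p - 2)))"
  defines "E \<equiv> (\<lambda>N f. cw_expect \<beta> h p N (\<lambda>x. f (Tstat \<beta> h p N x)))"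
  shows
    "(odd p \<longrightarrow>
        length ms = 2
      \<and> ((\<beta>, h) \<noteq> (beta_tilde p, 0) \<longrightarrow>
           conv_dist_ereal E (\<lambda>f. pk 1 / 2 * Nminus (sig2 1) f
                                  + (1 - pk 1) / 2 * Nplus (sig2 2) f + 1 / 2 * f 0))
      \<and> ((\<beta>, h) = (beta_tilde p, 0) \<longrightarrow>
           conv_dist_ereal E (\<lambda>f. pk 1 / 2 * f (-\<infinity>)
                                  + (1 - pk 1) / 2 * Nplus (sig2 2) f + 1 / 2 * f 0)))
   \<and> (even p \<longrightarrow>
        (h > 0 \<longrightarrow>
           conv_dist_ereal E (\<lambda>f. pk 1 / 2 * Nminus (sig2 1) f
                                  + (1 - pk 1) / 2 * Nplus (sig2 2) f + 1 / 2 * f 0))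
      \<and> (h < 0 \<longrightarrow>
           conv_dist_ereal E (\<lambda>f. pk 1 / 2 * Nplus (sig2 1) f
                                  + (1 - pk 1) / 2 * Nminus (sig2 2) f + 1 / 2 * f 0))
      \<and> (h = 0 \<and> \<beta> > beta_tilde p \<longrightarrow>
           (\<exists>mstar > 0. maximizers \<beta> h p = {- mstar, mstar}
              \<and> conv_dist_ereal E
                  (\<lambda>f. Nint (- H2 mstar / (real p ^ 2 * mstar ^ (2 * p - 2))) f)))
      \<and> (h = 0 \<and> \<beta> = beta_tilde p \<longrightarrow>
           (\<exists>mstar > 0. maximizers \<beta> h p = {- mstar, 0, mstar}
              \<and> conv_dist_ereal E
                  (\<lambda>f. pk 2 * gamma_p p * f (-\<infinity>)
                       + pk 1 * Nplus (- H2 mstar / (real p ^ 2 * mstar ^ (2 * p - 2))) f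
                       + (1 - pk 1 - pk 2 * gamma_p p) * f 0))))"
proof -
  interpret critical_cw \<beta> h p by unfold_locales (fact hp hbeta hcrit)+
  \<comment> \<open>The iterated derivative is identified with the closed form only inside (-1,1),
    where all maximizers lie.\<close>
  have H2: "H2 x = ddHfun \<beta> p x" if "x \<in> M" for x
    unfolding H2_def using M_interior[OF that] hp by (intro deriv_deriv_Hfun) auto
  have w: "w x = wt x" if "x \<in> M" for x
    unfolding w_def peak_weight_def curv_eq[OF M_interior[OF that]] H2[OF that] ..
  have sum_w: "(\<Sum>i\<leftarrow>ms. w i) = W"
  proof -
    have "(\<Sum>i\<leftarrow>ms. w i) = (\<Sum>i\<in>M. w i)"
      unfolding ms_def using finM by (subst sum_list_distinct_conv_sum_set) auto
    then show ?thesis by (simp add: W_def w)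
  qed
  have sig: "1 / (slope x)\<^sup>2 = - H2 x / (real p ^ 2 * x ^ (2 * p - 2))" if "x \<in> M" for x
    unfolding slope_sq[OF that] H2[OF that] ..
  have pk: "pk k = wt (m k) / W" if "m k \<in> M" for k
    unfolding pk_def sum_w w[OF that] ..
  have sig2: "sig2 k = 1 / (slope (m k))\<^sup>2" if "m k \<in> M" for k
    unfolding sig2_def sig[OF that] ..
  have two: "ms = [x, y]" "pk 1 = wt x / W" "1 - wt x / W = wt y / W"
      "sig2 1 = 1 / (slope x)\<^sup>2" "sig2 2 = 1 / (slope y)\<^sup>2"
    if M: "M = {x, y}" "x < y" for x y
  proof -
    have ms: "ms = [x, y]" unfolding ms_def M(1) using M(2) by simp
    then have mk: "m 1 = x" "m 2 = y" by (simp_all add: m_def)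
    have "W = wt x + wt y" unfolding W_def M(1) using M(2) by simp
    then have "1 - wt x / W = wt y / W" using W_pos by (simp add: field_simps)
    then show "ms = [x, y]" "pk 1 = wt x / W" "1 - wt x / W = wt y / W"
      "sig2 1 = 1 / (slope x)\<^sup>2" "sig2 2 = 1 / (slope y)\<^sup>2"
      using ms pk[of 1] sig2[of 1] sig2[of 2] unfolding mk by (simp_all add: M(1))
  qed
  \<comment> \<open>Being at the point (\<open>beta_tilde p\<close>, 0) is equivalent to having the
    origin among the maximizers; this drives every case distinction below.\<close>
  have zero: "0 \<in> M \<longleftrightarrow> (\<beta>, h) = (beta_tilde p, 0)"
    using zero_maximizer_imp_beta_tilde[OF hp hbeta hcrit] beta_tilde_imp_zero_maximizer[OF hp] hbeta by auto
  show ?thesis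
  proof (intro conjI impI)
    assume odd: "odd p"
    obtain x y where xy: "x < y" "M = {x, y}" using maximizers_odd[OF hp odd hbeta hcrit] by blast
    note t = two[OF xy(2,1)]
    have pow: "x ^ p < y ^ p" by (rule power_strict_mono_odd[OF odd xy(1)])
    show "length ms = 2" unfolding t(1) by simp
    {
      assume "(\<beta>, h) \<noteq> (beta_tilde p, 0)"
      then have "x \<noteq> 0" "y \<noteq> 0" using zero xy by auto
      from two_nonzero_peaks[OF xy(2) pow this]
      show "conv_dist_ereal E (\<lambda>f. pk 1 / 2 * Nminus (sig2 1) f
                                  + (1 - pk 1) / 2 * Nplus (sig2 2) f + 1 / 2 * f 0)"
        unfolding E_def t .
    next
      assume bh: "(\<beta>, h) = (beta_tilde p, 0)"
      \<comment> \<open>For odd p and h = 0 the energy is not positive on the negative axis, so the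
        entropy makes H negative there; the origin is therefore the smaller of the two
        maximizers.\<close>
      have "z \<ge> 0" if "z \<in> M" for z
      proof (rule ccontr)
        assume "\<not> 0 \<le> z"
        then have z: "z < 0" "\<bar>z\<bar> \<le> 1" using M_interior[OF that] by auto
        then have "z ^ p < 0" using odd by simp
        then have "\<beta> * z ^ p \<le> 0" using mult_nonneg_nonpos[OF hbeta, of "z ^ p"] by linarith
        moreover have "Ient z > 0" using z by (intro Ient_pos) auto
        ultimately have "Hfun \<beta> h p z < 0" using bh by (simp add: Hfun_def)
        then show False using maximizers_max[OF that, of 0] hp by simp
      qed
      then have "0 \<le> x" "0 \<in> M" using zero bh xy by auto
      then have x: "x = 0" using xy by auto
      then have "y ^ p > 0" using xy by simp
      from zero_and_positive_peak_odd[OF xy(2)[unfolded x] this odd]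
      show "conv_dist_ereal E (\<lambda>f. pk 1 / 2 * f (-\<infinity>)
                                  + (1 - pk 1) / 2 * Nplus (sig2 2) f + 1 / 2 * f 0)"
        unfolding E_def t[unfolded x] .
    }
  next
    assume ev: "even p" and h: "h > 0"
    obtain x y where xy: "0 < x" "x < y" "M = {x, y}" using maximizers_even_pos[OF hp ev hbeta hcrit h] by blast
    note t = two[OF xy(3,2)]
    have pow: "x ^ p < y ^ p" using xy hp by (intro power_strict_mono) auto
    have nz: "x \<noteq> 0" "y \<noteq> 0" using xy by auto
    from two_nonzero_peaks[OF xy(3) pow nz]
    show "conv_dist_ereal E (\<lambda>f. pk 1 / 2 * Nminus (sig2 1) f
                                  + (1 - pk 1) / 2 * Nplus (sig2 2) f + 1 / 2 * f 0)"
      unfolding E_def t .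
  next
    assume ev: "even p" and h: "h < 0"
    obtain x y where xy: "x < y" "y < 0" "M = {x, y}" using maximizers_even_neg[OF hp ev hbeta hcrit h] by blast
    note t = two[OF xy(3,1)]
    have "(- y) ^ p < (- x) ^ p" using xy hp by (intro power_strict_mono) auto
    then have pow: "y ^ p < x ^ p" using ev by simp
    have nz: "y \<noteq> 0" "x \<noteq> 0" using xy by auto
    \<comment> \<open>On the negative axis an even power reverses the order: the larger maximizer y
      has the smaller p-th power and plays the lower peak.\<close>
    have M': "M = {y, x}" using xy(3) by auto
    from two_nonzero_peaks[OF M' pow nz]
    show "conv_dist_ereal E (\<lambda>f. pk 1 / 2 * Nplus (sig2 1) f
                                  + (1 - pk 1) / 2 * Nminus (sig2 2) f + 1 / 2 * f 0)"
      unfolding E_def t add.commute[of "wt y / W / 2 * _"] .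
  next
    assume ev: "even p" and h: "h = 0 \<and> \<beta> > beta_tilde p"
    then have "0 \<notin> M" using zero by auto
    moreover obtain x where x: "x > 0" "M = {- x, x} \<or> M = {- x, 0, x}"
      using maximizers_even_zero[OF hp ev hbeta] hcrit h by blast
    ultimately have M: "M = {- x, x}" by auto
    have "1 / (slope x)\<^sup>2 = - H2 x / (real p ^ 2 * x ^ (2 * p - 2))" using sig M by simp
    with two_symmetric_peaks[OF M x(1) ev]
    show "\<exists>mstar > 0. maximizers \<beta> h p = {- mstar, mstar}
              \<and> conv_dist_ereal E
                  (\<lambda>f. Nint (- H2 mstar / (real p ^ 2 * mstar ^ (2 * p - 2))) f)"
      using x(1) M unfolding E_def by (intro exI[of _ x]) simp
  next
    assume ev: "even p" and h: "h = 0 \<and> \<beta> = beta_tilde p"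
    then have "0 \<in> M" using zero by auto
    moreover obtain x where x: "x > 0" "M = {- x, x} \<or> M = {- x, 0, x}"
      using maximizers_even_zero[OF hp ev hbeta] hcrit h by blast
    ultimately have M: "M = {- x, 0, x}" by auto
    have s: "1 / (slope x)\<^sup>2 = - H2 x / (real p ^ 2 * x ^ (2 * p - 2))" using sig M by simp
    have "ms = [- x, 0, x]" unfolding ms_def M using x(1) by simp
    then have mk: "m 1 = - x" "m 2 = 0" by (simp_all add: m_def)
    then have "pk 1 = wt (- x) / W" "pk 2 = wt 0 / W" using pk[of 1] pk[of 2] M by auto
    with three_symmetric_peaks[OF M x(1) ev] s
    show "\<exists>mstar > 0. maximizers \<beta> h p = {- mstar, 0, mstar}
              \<and> conv_dist_ereal E
                  (\<lambda>f. pk 2 * gamma_p p * f (-\<infinity>)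
                       + pk 1 * Nplus (- H2 mstar / (real p ^ 2 * mstar ^ (2 * p - 2))) f
                       + (1 - pk 1 - pk 2 * gamma_p p) * f 0)"
      using x(1) M unfolding E_def by (intro exI[of _ x]) simp
  qed
qed

end
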